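(* Let $0<p<q\leq 1$ and let $M$ be a pointed $q$-metric space. Then $\mathcal F_p(M)$ has the Schur $p$-property.
   Context: All vector spaces are real. For $0<s\le 1$, an $s$-Banach space is a complete quasi-normed space $X$ with $\|x+y\|^s\le\|x\|^s+\|y\|^s$ for all $x,y\in X$. For $0<s\le1$, an $s$-metric on a set $M$ is a function $d\colon M\times M\to[0,\infty)$ such that $d^s$ is a metric; topological notions refer to the metric $d^s$. A pointed $s$-metric space is an $s$-metric space with a distinguished base point $0$; a map is pointed if it sends base point to base point (the base point of a vector space being $0$). If $0<p\le q\le1$, every $q$-metric space is a $p$-metric space. For a pointed $p$-metric space $(M,d,0)$, the Lipschitz-free $p$-space $\mathcal F_p(M)$ is the (unique up to linear isometry) $p$-Banach space equipped with an isometric pointed map $\delta_M\colon M\to\mathcal F_p(M)$ whose linear span is dense, such that every pointed Lipschitz map $f\colon M\to Y$ into a $p$-Banach space $Y$ has a unique bounded linear extension $\widehat f\colon\mathcal F_p(M)\to Y$ with $\widehat f\,\delta_M=f$, and $\|\widehat f\|=\operatorname{Lip}(f)$. A sequence $(x_n)$ in a $p$-Banach space is equivalent to the canonical basis of $\ell_p$ if there are constants $c,C>0$ with $c^p\sum_n|a_n|^p\le\|\sum_n a_nx_n\|^p\le C^p\sum_n|a_n|^p$ for every finitely supported scalar sequence $(a_n)$. A $p$-Banach space $X$ has the Schur $p$-property if every infinite bounded uniformly separated subset of $X$ contains a sequence equivalent to the canonical basis of $\ell_p$ (uniformly separated: there is $\delta>0$ such that $\|x-y\|\ge\delta$ for distinct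 elements). *)

theory Defs
  imports "HOL-Analysis.Analysis" "HOL-Library.Function_Algebras"
begin

instantiation "fun" :: (type, real_vector) real_vector
begin

definition scaleR_fun :: "real \<Rightarrow> ('a \<Rightarrow> 'b) \<Rightarrow> 'a \<Rightarrow> 'b"
  where "scaleR_fun c f = (\<lambda>x. c *\<^sub>R f x)"

instance
  by standard (simp_all add: scaleR_fun_def plus_fun_def scaleR_add_right scaleR_add_left)

end

text \<open>
  All structures live on carriers: an \<open>s\<close>-metric space is a set \<open>M\<close> with a distance \<open>d\<close>, and a
  (quasi-)normed space is a linear subspace \<open>V\<close> of a real vector space type with a function \<open>N\<close>
  whose values outside \<open>V\<close> are irrelevant. \<^locale>\<open>Metric_space\<close> asks for symmetry on the whole
  type; this is no restriction, as a distance on \<open>M\<close> can be extended by \<open>0\<close> outside \<open>M\<close>.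
\<close>

definition s_metric_on :: "real \<Rightarrow> 'a set \<Rightarrow> ('a \<Rightarrow> 'a \<Rightarrow> real) \<Rightarrow> bool"
  where "s_metric_on s M d \<longleftrightarrow>
    (\<forall>x\<in>M. \<forall>y\<in>M. 0 \<le> d x y) \<and> Metric_space M (\<lambda>x y. d x y powr s)"

definition quasi_norm_on :: "'b::real_vector set \<Rightarrow> ('b \<Rightarrow> real) \<Rightarrow> bool"
  where "quasi_norm_on V N \<longleftrightarrow>
    subspace V \<and>
    (\<forall>x\<in>V. 0 \<le> N x \<and> (N x = 0 \<longleftrightarrow> x = 0)) \<and>
    (\<forall>x\<in>V. \<forall>a. N (a *\<^sub>R x) = \<bar>a\<bar> * N x) \<and>
    (\<exists>K\<ge>1. \<forall>x\<in>V. \<forall>y\<in>V. N (x + y) \<le> K * (N x + N y))"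

definition complete_quasi_norm_on :: "'b::real_vector set \<Rightarrow> ('b \<Rightarrow> real) \<Rightarrow> bool"
  where "complete_quasi_norm_on V N \<longleftrightarrow>
    (\<forall>\<sigma>::nat \<Rightarrow> 'b.
       range \<sigma> \<subseteq> V \<and> (\<forall>e>0. \<exists>k. \<forall>m\<ge>k. \<forall>n\<ge>k. N (\<sigma> m - \<sigma> n) < e) \<longrightarrow>
       (\<exists>x\<in>V. (\<lambda>n. N (\<sigma> n - x)) \<longlonglongrightarrow> 0))"

definition s_banach_on :: "real \<Rightarrow> 'b::real_vector set \<Rightarrow> ('b \<Rightarrow> real) \<Rightarrow> bool"
  where "s_banach_on s V N \<longleftrightarrow>
    quasi_norm_on V N \<and> complete_quasi_norm_on V N \<and>
    (\<forall>x\<in>V. \<forall>y\<in>V. N (x + y) powr s \<le> N x powr s + N y powr s)"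

definition lipschitz_into ::
  "'a set \<Rightarrow> ('a \<Rightarrow> 'a \<Rightarrow> real) \<Rightarrow> 'c::real_vector set \<Rightarrow> ('c \<Rightarrow> real) \<Rightarrow> ('a \<Rightarrow> 'c) \<Rightarrow> bool"
  where "lipschitz_into M d W N' f \<longleftrightarrow>
    f ` M \<subseteq> W \<and> (\<exists>L\<ge>0. \<forall>x\<in>M. \<forall>y\<in>M. N' (f x - f y) \<le> L * d x y)"

definition lipschitz_const ::
  "'a set \<Rightarrow> ('a \<Rightarrow> 'a \<Rightarrow> real) \<Rightarrow> ('c::real_vector \<Rightarrow> real) \<Rightarrow> ('a \<Rightarrow> 'c) \<Rightarrow> real"
  where "lipschitz_const M d N' f =
    Inf {L. 0 \<le> L \<and> (\<forall>x\<in>M. \<forall>y\<in>M. N' (f x - f y) \<le> L * d x y)}"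

definition bounded_linear_into ::
  "'b::real_vector set \<Rightarrow> ('b \<Rightarrow> real) \<Rightarrow> 'c::real_vector set \<Rightarrow> ('c \<Rightarrow> real) \<Rightarrow> ('b \<Rightarrow> 'c) \<Rightarrow> bool"
  where "bounded_linear_into V N W N' g \<longleftrightarrow>
    g ` V \<subseteq> W \<and>
    (\<forall>x\<in>V. \<forall>y\<in>V. g (x + y) = g x + g y) \<and>
    (\<forall>x\<in>V. \<forall>a. g (a *\<^sub>R x) = a *\<^sub>R g x) \<and>
    (\<exists>C. \<forall>x\<in>V. N' (g x) \<le> C * N x)"

definition operator_norm ::
  "'b::real_vector set \<Rightarrow> ('b \<Rightarrow> real) \<Rightarrow> ('c::real_vector \<Rightarrow> real) \<Rightarrow> ('b \<Rightarrow> 'c) \<Rightarrow> real"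
  where "operator_norm V N N' g = Sup {N' (g x) | x. x \<in> V \<and> N x \<le> 1}"

text \<open>
  Unique extension of pointed Lipschitz maps from \<open>M\<close> into one given target space \<open>(W, N')\<close>.
  The maps \<open>g\<close> matter only on \<open>V\<close>; \<^term>\<open>extensional V\<close> fixes them outside \<open>V\<close>, so that
  unique existence has its usual meaning.
\<close>

definition extends_lipschitz_into ::
  "'a set \<Rightarrow> ('a \<Rightarrow> 'a \<Rightarrow> real) \<Rightarrow> 'a \<Rightarrow> 'b::real_vector set \<Rightarrow> ('b \<Rightarrow> real) \<Rightarrow> ('a \<Rightarrow> 'b) \<Rightarrow>
   'c::real_vector set \<Rightarrow> ('c \<Rightarrow> real) \<Rightarrow> bool"
  where "extends_lipschitz_into M d z V N \<delta> W N' \<longleftrightarrow>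
    (\<forall>f. lipschitz_into M d W N' f \<and> f z = 0 \<longrightarrow>
      (\<exists>!g. g \<in> extensional V \<and> bounded_linear_into V N W N' g \<and> (\<forall>x\<in>M. g (\<delta> x) = f x)) \<and>
      (\<forall>g. bounded_linear_into V N W N' g \<and> (\<forall>x\<in>M. g (\<delta> x) = f x) \<longrightarrow>
           operator_norm V N N' g = lipschitz_const M d N' f))"

text \<open>
  \<open>(V, N, \<delta>)\<close> is the Lipschitz-free \<open>p\<close>-space over the pointed space \<open>(M, d, z)\<close>.

  The universal property should range over the \<open>p\<close>-Banach spaces of every type, which cannot be
  quantified over inside a formula. It is imposed for all \<open>p\<close>-Banach spaces carried by
  subspaces of \<^typ>\<open>nat \<Rightarrow> 'a \<Rightarrow> real\<close>, where \<^typ>\<open>'a\<close> is the type of the points of \<open>M\<close>. This is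
  equivalent to the full universal property, because \<open>F\<^sub>p(M)\<close> itself is, up to linear
  isometry, one of these spaces. Indeed, \<open>F\<^sub>p(M)\<close> is the completion of a space of finitely supported
  functions \<^typ>\<open>'a \<Rightarrow> real\<close>, that is, the quotient of the space \<open>C\<close> of Cauchy sequences of
  such functions by the space of null sequences, and an algebraic complement of the null
  sequences in \<open>C\<close> is a subspace of \<^typ>\<open>nat \<Rightarrow> 'a \<Rightarrow> real\<close> isomorphic to this quotient.
  The usual uniqueness argument, applied with this copy of \<open>F\<^sub>p(M)\<close> as the target, then gives a
  linear isometry between \<open>V\<close> and \<open>F\<^sub>p(M)\<close> that is compatible with the embeddings of \<open>M\<close>.
\<close>

definition lipschitz_free ::
  "real \<Rightarrow> 'a set \<Rightarrow> ('a \<Rightarrow> 'a \<Rightarrow> real) \<Rightarrow> 'a \<Rightarrow>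
   'b::real_vector set \<Rightarrow> ('b \<Rightarrow> real) \<Rightarrow> ('a \<Rightarrow> 'b) \<Rightarrow> bool"
  where "lipschitz_free p M d z V N \<delta> \<longleftrightarrow>
    s_banach_on p V N \<and>
    \<delta> ` M \<subseteq> V \<and> \<delta> z = 0 \<and>
    (\<forall>x\<in>M. \<forall>y\<in>M. N (\<delta> x - \<delta> y) = d x y) \<and>
    (\<forall>x\<in>V. \<forall>e>0. \<exists>y\<in>span (\<delta> ` M). N (x - y) < e) \<and>
    (\<forall>(W :: (nat \<Rightarrow> 'a \<Rightarrow> real) set) N'.
       s_banach_on p W N' \<longrightarrow> extends_lipschitz_into M d z V N \<delta> W N')"

definition equivalent_to_lp_basis ::
  "real \<Rightarrow> ('b::real_vector \<Rightarrow> real) \<Rightarrow> (nat \<Rightarrow> 'b) \<Rightarrow> bool"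
  where "equivalent_to_lp_basis p N x \<longleftrightarrow>
    (\<exists>c>0. \<exists>C>0. \<forall>a :: nat \<Rightarrow> real. finite {n. a n \<noteq> 0} \<longrightarrow>
       c powr p * (\<Sum>n | a n \<noteq> 0. \<bar>a n\<bar> powr p) \<le> N (\<Sum>n | a n \<noteq> 0. a n *\<^sub>R x n) powr p \<and>
       N (\<Sum>n | a n \<noteq> 0. a n *\<^sub>R x n) powr p \<le> C powr p * (\<Sum>n | a n \<noteq> 0. \<bar>a n\<bar> powr p))"

definition uniformly_separated :: "('b::real_vector \<Rightarrow> real) \<Rightarrow> 'b set \<Rightarrow> bool"
  where "uniformly_separated N A \<longleftrightarrow>
    (\<exists>r>0. \<forall>x\<in>A. \<forall>y\<in>A. x \<noteq> y \<longrightarrow> r \<le> N (x - y))"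

definition schur_property :: "real \<Rightarrow> 'b::real_vector set \<Rightarrow> ('b \<Rightarrow> real) \<Rightarrow> bool"
  where "schur_property p V N \<longleftrightarrow>
    (\<forall>A\<subseteq>V. infinite A \<and> (\<exists>B. \<forall>x\<in>A. N x \<le> B) \<and> uniformly_separated N A \<longrightarrow>
       (\<exists>x. range x \<subseteq> A \<and> equivalent_to_lp_basis p N x))"

end

theory Submission
  imports Defs "HOL-Library.Ramsey" "HOL-Library.Nat_Bijection"
begin

text \<open>
  Put \<open>\<rho> = d powr q\<close>, a metric, and \<open>\<alpha> = p / q < 1\<close>. On finitely supported functions of total mass \<open>0\<close>
  the \<open>p\<close>-th power of the norm of the free space is the transport seminorm
  \<open>inf (\<Sum>i. \<bar>a i\<bar> powr p * \<rho> (x i) (y i) powr \<alpha>)\<close>, the infimum being over all representations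
  \<open>f = (\<Sum>i. a i * (point_mass (x i) - point_mass (y i)))\<close>. Since \<open>p \<le> 1\<close>, an optimal representation
  is a forest, and cutting a forest at random heights bounds the transport seminorm of
  \<open>\<rho> powr \<alpha>\<close> by interpolation between the mass \<open>\<Sum>x. \<bar>f x\<bar> powr p\<close> and the transport seminorm of
  \<open>\<rho>\<close>. As in real interpolation, the norm is therefore equivalent to the sum over the scales
  \<open>t = 2 ^ k\<close> of the transport seminorms for the costs \<open>min (t powr (\<alpha> - 1) * \<rho>) (t powr \<alpha>)\<close>;
  this is where \<open>p < q\<close> enters.

  Given a bounded separated sequence, either some subsequence is separated at a single scale, or
  subsequences are almost constant at any finite set of scales. In the second case humps glide over
  the scales. In the first case the sequence consists, up to a small error, of functions with
  bounded mass. A subsequence of these puts little mass near the supports of its earlier members,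
  so that the supports can be isolated from each other by Whitney-type neighbourhoods of random
  size.
\<close>

text \<open>For \<open>p < 1\<close> a \<open>p\<close>-Banach space may have very few continuous
  functionals, so lower estimates cannot rely on real-valued Lipschitz functions. They come from
  \<open>p\<close>-seminorms, taken as \<open>p\<close>-th powers: these are subadditive, and
  contributions of disjoint sets of scales add up, which is the shape of an lp estimate. Two
  obstacles shape the argument. At a fixed scale a subsequence may be almost constant without being
  small; each hump is therefore measured modulo all multiples of a later element. At a single scale,
  distinct elements may cancel by sharing a finite set of points; the cost is therefore relaxed so
  that mass may vanish on a finite set \<open>E\<close>. This ignores only a finite-dimensional
  span, so all but finitely many elements stay large. The free space is known only through its
  universal property. Applied to a completion of the transport seminorm, it shows that the free norm
  is not smaller; the other bound is the triangle inequality. The completion must live in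
  \<open>nat \<Rightarrow> 'a \<Rightarrow> real\<close>, the type over which the property is
  imposed.\<close>

text \<open>After division by \<open>x + y\<close> both terms lie in the unit interval, where
  \<open>t \<le> t powr p\<close>.\<close>

lemma powr_add_le_add_powr:
  fixes x y p :: real
  assumes "0 \<le> x" "0 \<le> y" "0 < p" "p \<le> 1"
  shows "(x + y) powr p \<le> x powr p + y powr p"
proof (cases "x + y = 0")
  case True
  then have "x = 0" "y = 0" using assms by auto
  then show ?thesis by simp
next
  case False
  define s where "s = x + y"
  have s: "0 < s" using False assms s_def by auto
  have *: "t / s \<le> (t / s) powr p" if "0 \<le> t" "t \<le> s" for t
  proof (cases "t = 0")
    case False
    have "(t / s) powr 1 \<le> (t / s) powr p"
      using that s assms False by (intro powr_mono') auto
    then show ?thesis using that s by simp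
  qed simp
  have "1 = x / s + y / s" using s by (simp add: s_def add_divide_distrib[symmetric])
  also have "\<dots> \<le> (x / s) powr p + (y / s) powr p"
    using *[of x] *[of y] assms s_def by auto
  also have "\<dots> = (x powr p + y powr p) / s powr p"
    using assms s by (simp add: powr_divide add_divide_distrib)
  finally show ?thesis using s unfolding s_def[symmetric] by (simp add: field_simps)
qed

section \<open>\<open>p\<close>-seminorms\<close>

text \<open>\<open>P\<close> is the \<open>p\<close>-th power of a \<open>p\<close>-norm, which
  makes it subadditive with constant 1 at the price of homogeneity of degree \<open>p\<close>. A
  kernel is allowed, because transport along a pseudometric vanishes on some nonzero
  functions.\<close>

locale p_seminorm =
  fixes p :: real and V :: "'v::real_vector set" and P :: "'v \<Rightarrow> real"
  assumes p_pos: "0 < p"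
    and subspace: "subspace V"
    and nonneg: "x \<in> V \<Longrightarrow> 0 \<le> P x"
    and triangle: "x \<in> V \<Longrightarrow> y \<in> V \<Longrightarrow> P (x + y) \<le> P x + P y"
    and scale: "x \<in> V \<Longrightarrow> P (a *\<^sub>R x) = \<bar>a\<bar> powr p * P x"
begin

lemma zero: "P 0 = 0"
  using scale[of 0 0] p_pos subspace_0[OF subspace] by simp

lemma uminus: "x \<in> V \<Longrightarrow> P (- x) = P x"
  using scale[of x "- 1"] by simp

lemma diff_le: "x \<in> V \<Longrightarrow> y \<in> V \<Longrightarrow> P (x - y) \<le> P x + P y"
  using triangle[of x "- y"] uminus[of y] subspace_neg[OF subspace, of y] by simp

lemma diff_commute: "x \<in> V \<Longrightarrow> y \<in> V \<Longrightarrow> P (x - y) = P (y - x)"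
  using uminus[of "x - y"] subspace_diff[OF subspace, of x y] by simp

lemma diff_ge: "x \<in> V \<Longrightarrow> y \<in> V \<Longrightarrow> P x - P y \<le> P (x + y)"
  using diff_le[of "x + y" y] subspace_add[OF subspace, of x y] by simp

lemma diff_ge': "x \<in> V \<Longrightarrow> y \<in> V \<Longrightarrow> P x - P y \<le> P (x - y)"
  using triangle[of "x - y" y] subspace_diff[OF subspace, of x y] by simp

lemma diff_triangle:
  assumes "x \<in> V" "y \<in> V" "z \<in> V"
  shows "P (x - z) \<le> P (x - y) + P (y - z)"
proof -
  have "P ((x - y) + (y - z)) \<le> P (x - y) + P (y - z)"
    using assms by (intro triangle subspace_diff[OF subspace])
  then show ?thesis by simp
qed

lemma sum_le:
  assumes "\<And>i. i \<in> I \<Longrightarrow> x i \<in> V"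
  shows "P (\<Sum>i\<in>I. a i *\<^sub>R x i) \<le> (\<Sum>i\<in>I. \<bar>a i\<bar> powr p * P (x i))"
  using assms
proof (induction I rule: infinite_finite_induct)
  case (insert i I)
  have m: "a i *\<^sub>R x i \<in> V" "(\<Sum>i\<in>I. a i *\<^sub>R x i) \<in> V"
    using insert by (auto intro!: subspace_scale[OF subspace] subspace_sum[OF subspace])
  have "P (\<Sum>i\<in>insert i I. a i *\<^sub>R x i) \<le> P (a i *\<^sub>R x i) + P (\<Sum>i\<in>I. a i *\<^sub>R x i)"
    using insert(1,2) triangle[OF m] by simp
  then show ?case using insert scale[of "x i" "a i"] by auto
qed (auto simp: zero)

text \<open>
  Bounded sequences in a finite-dimensional subspace cluster. Since \<open>P\<close> may have a kernel, the
  coefficients of a bounded sequence can be unbounded; in that case the new direction \<open>b\<close> lies in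
  the closure of the old span and can be absorbed there.
\<close>
lemma finite_dimensional_close_pair:
  assumes "finite B" "B \<subseteq> V" "\<And>n. v n \<in> span B" "\<And>n::nat. P (v n) \<le> R" "0 < e"
  shows "\<exists>i j. i < j \<and> P (v i - v j) < e"
  using assms
proof (induction B arbitrary: v R e rule: finite_induct)
  case empty
  then have "v n = 0" for n by simp
  then have "P (v 0 - v 1) < e" using zero \<open>0 < e\<close> by simp
  then show ?case by (intro exI[of _ 0] exI[of _ 1]) auto
next
  case (insert b B)
  have B: "B \<subseteq> V" "b \<in> V" using insert by auto
  have spB: "span B \<subseteq> V" "span (insert b B) \<subseteq> V"
    using span_minimal[OF _ subspace] B by auto
  have vV: "v n \<in> V" for n using insert spB by auto
  have "\<exists>t. v n - t *\<^sub>R b \<in> span B" for n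
    using insert(5)[of n] by (simp add: span_breakdown_eq)
  then obtain t where t: "\<And>n. v n - t n *\<^sub>R b \<in> span B" by metis
  define u where "u n = v n - t n *\<^sub>R b" for n
  have u: "u n \<in> span B" "u n \<in> V" for n using t spB u_def by auto
  have tb: "c *\<^sub>R b \<in> V" for c using B subspace_scale[OF subspace] by auto
  have Pb: "0 \<le> P b" using nonneg B by auto
  show ?case
  proof (cases "\<exists>T. \<forall>n. \<bar>t n\<bar> \<le> T")
    \<comment> \<open>Bounded coefficients: along a convergent subsequence of \<open>t\<close> the
      \<open>b\<close>-parts are close, and the induction hypothesis treats the remaining parts
      \<open>u\<close>.\<close>
    case True
    then obtain T where T: "\<And>n. \<bar>t n\<bar> \<le> T" by blast
    then have "bounded (range t)" by (auto simp: bounded_iff)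
    then obtain l \<sigma> where \<sigma>: "strict_mono \<sigma>" "(t \<circ> \<sigma>) \<longlonglongrightarrow> l"
      using bounded_imp_convergent_subsequence by blast
    then have "Cauchy (t \<circ> \<sigma>)" by (auto intro: LIMSEQ_imp_Cauchy)
    define d where "d = (e / 2 / (P b + 1)) powr (1 / p)"
    have d: "0 < d" using insert(7) Pb by (auto simp: d_def)
    obtain n0 where n0: "\<And>i j. n0 \<le> i \<Longrightarrow> n0 \<le> j \<Longrightarrow> \<bar>t (\<sigma> i) - t (\<sigma> j)\<bar> < d"
      using \<open>Cauchy (t \<circ> \<sigma>)\<close> d unfolding Cauchy_def dist_real_def comp_def by metis
    have "P (u n) \<le> R + T powr p * P b" for n
    proof -
      have "P (u n) \<le> P (v n) + P (t n *\<^sub>R b)"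
        unfolding u_def by (rule diff_le[OF vV tb])
      also have "\<dots> \<le> R + \<bar>t n\<bar> powr p * P b" using insert(6)[of n] scale[OF B(2)] by simp
      also have "\<dots> \<le> R + T powr p * P b"
        using T[of n] Pb p_pos by (auto intro!: mult_right_mono powr_mono2)
      finally show ?thesis .
    qed
    then have "\<exists>i j. i < j \<and> P (u (\<sigma> (i + n0)) - u (\<sigma> (j + n0))) < e / 2"
      using insert.IH[of "\<lambda>n. u (\<sigma> (n + n0))" "R + T powr p * P b" "e / 2"] B u insert(7) by auto
    then obtain i j where ij: "i < j" "P (u (\<sigma> (i + n0)) - u (\<sigma> (j + n0))) < e / 2" by auto
    define i' j' where "i' = \<sigma> (i + n0)" and "j' = \<sigma> (j + n0)"
    have "i' < j'" using ij \<sigma>(1) by (auto simp: i'_def j'_def strict_mono_def)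
    have "\<bar>t i' - t j'\<bar> powr p \<le> d powr p"
      using n0[of "i + n0" "j + n0"] p_pos by (auto simp: i'_def j'_def intro!: powr_mono2)
    also have "\<dots> = e / 2 / (P b + 1)" using insert(7) Pb p_pos by (auto simp: d_def powr_powr)
    finally have "\<bar>t i' - t j'\<bar> powr p * P b \<le> e / 2 / (P b + 1) * P b"
      using Pb by (rule mult_right_mono)
    also have "\<dots> \<le> e / 2" using Pb insert(7) by (auto simp: field_simps)
    finally have 1: "P ((t i' - t j') *\<^sub>R b) \<le> e / 2" using scale[OF B(2)] by simp
    have "v i' - v j' = (u i' - u j') + (t i' - t j') *\<^sub>R b"
      by (simp add: u_def algebra_simps)
    then have "P (v i' - v j') \<le> P (u i' - u j') + P ((t i' - t j') *\<^sub>R b)"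
      using triangle[OF subspace_diff[OF subspace u(2) u(2)] tb] by metis
    also have "\<dots> < e" using 1 ij(2) by (simp add: i'_def j'_def)
    finally show ?thesis using \<open>i' < j'\<close> by blast
  next
    case False
    have approx: "\<exists>b'\<in>span B. P (b - b') \<le> h" if h: "0 < h" for h
    proof -
      \<comment> \<open>\<open>T\<close> is so large that
        \<open>\<bar>R\<bar> \<le> h * \<bar>t n\<bar> powr p\<close>. Then \<open>v n\<close>
        divided by \<open>t n\<close>, whose \<open>b\<close>-coefficient is 1, has seminorm at most
        \<open>h\<close>, so \<open>b\<close> is that close to the old span.\<close>
      define T where "T = max 1 ((\<bar>R\<bar> / h) powr (1 / p))"
      obtain n where n: "T < \<bar>t n\<bar>" using False by (meson not_le)
      have tn: "0 < \<bar>t n\<bar>" using n by (auto simp: T_def)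
      have "\<bar>R\<bar> / h = ((\<bar>R\<bar> / h) powr (1 / p)) powr p" using h p_pos by (simp add: powr_powr)
      also have "\<dots> \<le> \<bar>t n\<bar> powr p" using n p_pos by (intro powr_mono2) (auto simp: T_def)
      finally have le: "\<bar>R\<bar> \<le> h * \<bar>t n\<bar> powr p" using h by (simp add: field_simps)
      define b' where "b' = (- (1 / t n)) *\<^sub>R u n"
      have b': "b' \<in> span B" using u by (auto simp: b'_def intro!: span_neg span_scale)
      have "b - b' = (1 / t n) *\<^sub>R v n"
        using tn by (auto simp: b'_def u_def scaleR_diff_right)
      then have "P (b - b') = (1 / \<bar>t n\<bar>) powr p * P (v n)" using scale[OF vV] by simp
      also have "\<dots> \<le> (1 / \<bar>t n\<bar>) powr p * \<bar>R\<bar>"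
        using insert(6)[of n] by (intro mult_left_mono) auto
      also have "\<dots> \<le> (1 / \<bar>t n\<bar>) powr p * (h * \<bar>t n\<bar> powr p)" using le by (intro mult_left_mono) auto
      also have "\<dots> = h" using tn by (simp add: powr_divide)
      finally show ?thesis using b' by blast
    qed
    \<comment> \<open>The substitute for \<open>b\<close> depends on \<open>n\<close>, since its
      error is multiplied by the unbounded \<open>\<bar>t n\<bar> powr p\<close>.\<close>
    have "\<exists>b'\<in>span B. \<bar>t n\<bar> powr p * P (b - b') \<le> e / 3" for n
    proof -
      obtain b' where b': "b' \<in> span B" "P (b - b') \<le> e / 3 / (\<bar>t n\<bar> powr p + 1)"
        using approx[of "e / 3 / (\<bar>t n\<bar> powr p + 1)"] insert(7)
        by (meson add_nonneg_pos divide_pos_pos powr_ge_zero zero_less_numeral zero_less_one)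
      have "\<bar>t n\<bar> powr p * P (b - b') \<le> \<bar>t n\<bar> powr p * (e / 3 / (\<bar>t n\<bar> powr p + 1))"
        using b' by (intro mult_left_mono) auto
      also have "\<dots> \<le> e / 3" using insert(7) by (auto simp: field_simps add_pos_nonneg)
      finally show ?thesis using b' by blast
    qed
    then obtain b' where b': "\<And>n. b' n \<in> span B" "\<And>n. \<bar>t n\<bar> powr p * P (b - b' n) \<le> e / 3"
      by metis
    define v' where "v' n = u n + t n *\<^sub>R b' n" for n
    have v': "v' n \<in> span B" "v' n \<in> V" for n
      using u b' spB by (auto simp: v'_def intro!: span_add span_scale)
    have b'V: "b' n \<in> V" for n using b' spB by auto
    have close: "P (v n - v' n) \<le> e / 3" for n
    proof -
      have "v n - v' n = t n *\<^sub>R (b - b' n)" by (simp add: v'_def u_def algebra_simps)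
      then show ?thesis
        using b'(2)[of n] scale[OF subspace_diff[OF subspace B(2) b'V[of n]], of "t n"] by simp
    qed
    have "P (v' n) \<le> R + e" for n
      using diff_ge'[OF v'(2)[of n] vV[of n]] close[of n] insert(6)[of n] insert(7)
        diff_commute[OF v'(2)[of n] vV[of n]] by linarith
    then have "\<exists>i j. i < j \<and> P (v' i - v' j) < e / 3"
      using insert.IH[of v' "R + e" "e / 3"] B v' insert(7) by auto
    then obtain i j where ij: "i < j" "P (v' i - v' j) < e / 3" by auto
    have "P (v i - v j) \<le> P (v i - v' i) + P (v' i - v j)"
      by (rule diff_triangle[OF vV v'(2) vV])
    also have "P (v' i - v j) \<le> P (v' i - v' j) + P (v' j - v j)"
      by (rule diff_triangle[OF v'(2) v'(2) vV])
    also have "P (v' j - v j) = P (v j - v' j)" by (rule diff_commute[OF v'(2) vV])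
    finally have "P (v i - v j) < e" using close[of i] close[of j] ij by linarith
    then show ?thesis using ij by blast
  qed
qed

end

lemma p_seminorm_sum:
  assumes "\<And>k. k \<in> K \<Longrightarrow> p_seminorm p V (W k)" "0 < p" "subspace V"
  shows "p_seminorm p V (\<lambda>x. \<Sum>k\<in>K. W k x)"
proof
  show "0 \<le> (\<Sum>k\<in>K. W k x)" if "x \<in> V" for x
    using assms(1) p_seminorm.nonneg that by (metis sum_nonneg)
  show "(\<Sum>k\<in>K. W k (x + y)) \<le> (\<Sum>k\<in>K. W k x) + (\<Sum>k\<in>K. W k y)" if "x \<in> V" "y \<in> V" for x y
    unfolding sum.distrib[symmetric] by (intro sum_mono p_seminorm.triangle[OF assms(1)] that)
  show "(\<Sum>k\<in>K. W k (a *\<^sub>R x)) = \<bar>a\<bar> powr p * (\<Sum>k\<in>K. W k x)" if "x \<in> V" for x a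
    unfolding sum_distrib_left by (intro sum.cong refl p_seminorm.scale[OF assms(1)] that)
qed (use assms in auto)


section \<open>A gliding hump\<close>

text \<open>Pigeonhole: points at distance at least \<open>s\<close> fall into different cells of
  length \<open>s\<close>.\<close>

lemma card_separated_reals_le:
  fixes \<mu> :: "'i \<Rightarrow> real"
  assumes "0 < s" "\<And>i. i \<in> I \<Longrightarrow> \<bar>\<mu> i\<bar> \<le> R"
    and sep: "\<And>i j. i \<in> I \<Longrightarrow> j \<in> I \<Longrightarrow> i \<noteq> j \<Longrightarrow> s \<le> \<bar>\<mu> i - \<mu> j\<bar>"
  shows "card I \<le> card {\<lfloor>- R / s\<rfloor>..\<lfloor>R / s\<rfloor>}"
proof (rule card_inj_on_le)
  show "inj_on (\<lambda>i. \<lfloor>\<mu> i / s\<rfloor>) I"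
  proof (rule inj_onI, rule ccontr)
    fix i j assume ij: "i \<in> I" "j \<in> I" "\<lfloor>\<mu> i / s\<rfloor> = \<lfloor>\<mu> j / s\<rfloor>" "i \<noteq> j"
    have "\<bar>\<mu> i / s - \<mu> j / s\<bar> < 1" using ij(3) by linarith
    then have "\<bar>\<mu> i - \<mu> j\<bar> < s"
      using assms(1) by (simp add: diff_divide_distrib[symmetric] abs_divide field_simps)
    then show False using sep[OF ij(1,2,4)] by simp
  qed
  show "(\<lambda>i. \<lfloor>\<mu> i / s\<rfloor>) ` I \<subseteq> {\<lfloor>- R / s\<rfloor>..\<lfloor>R / s\<rfloor>}"
  proof
    fix y assume "y \<in> (\<lambda>i. \<lfloor>\<mu> i / s\<rfloor>) ` I"
    then obtain i where i: "i \<in> I" "y = \<lfloor>\<mu> i / s\<rfloor>" by auto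
    have "- R \<le> \<mu> i" "\<mu> i \<le> R" using assms(2)[OF i(1)] by auto
    then have "- R / s \<le> \<mu> i / s" "\<mu> i / s \<le> R / s"
      using assms(1) by (intro divide_right_mono; simp)+
    then show "y \<in> {\<lfloor>- R / s\<rfloor>..\<lfloor>R / s\<rfloor>}"
      using i(2) by (simp add: floor_mono)
  qed
qed auto

text \<open>The index \<open>k\<close> stands for a scale, and no relation between different
  \<open>W k\<close> is assumed. The condition \<open>thin\<close> says that no scale separates any
  subsequence.\<close>

locale gliding_hump =
  fixes p :: real and V :: "'v::real_vector set" and W :: "nat \<Rightarrow> 'v \<Rightarrow> real"
    and x :: "nat \<Rightarrow> 'v" and B r :: real
  assumes W: "p_seminorm p V (W k)"
    and summable: "f \<in> V \<Longrightarrow> summable (\<lambda>k. W k f)"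
    and x: "x n \<in> V"
    and bounded: "(\<Sum>k. W k (x n)) \<le> B"
    and separated: "i \<noteq> j \<Longrightarrow> r \<le> (\<Sum>k. W k (x i - x j))"
    and r_pos: "0 < r"
    and thin: "infinite S \<Longrightarrow> 0 < e \<Longrightarrow> \<exists>i\<in>S. \<exists>j\<in>S. i \<noteq> j \<and> W k (x i - x j) < e"
begin

definition block :: "nat \<Rightarrow> nat \<Rightarrow> 'v \<Rightarrow> real"
  where "block K K' f = (\<Sum>k\<in>{K..<K'}. W k f)"

lemma p_pos: "0 < p" and subspace: "subspace V"
  using p_seminorm.p_pos[OF W] p_seminorm.subspace[OF W] by auto

lemma block: "p_seminorm p V (block K K')"
  unfolding block_def by (rule p_seminorm_sum[OF W p_pos subspace])

lemma W_nonneg: "f \<in> V \<Longrightarrow> 0 \<le> W k f"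
  using p_seminorm.nonneg[OF W] .

lemma xdiff: "x i - x j \<in> V"
  using subspace_diff[OF subspace x x] .

lemma sum_le_suminf: "f \<in> V \<Longrightarrow> finite K \<Longrightarrow> (\<Sum>k\<in>K. W k f) \<le> (\<Sum>k. W k f)"
  by (rule sum_le_suminf[OF summable]) (auto intro: W_nonneg)

lemma block_le_tail:
  assumes "f \<in> V" "K' \<le> K"
  shows "block K L f \<le> (\<Sum>k. W (k + K') f)"
proof -
  have "block K L f = (\<Sum>k\<in>{K - K'..<L - K'}. W (k + K') f)"
    unfolding block_def using assms(2)
    by (intro sum.reindex_bij_witness[of _ "\<lambda>k. k + K'" "\<lambda>k. k - K'"]) auto
  also have "\<dots> \<le> (\<Sum>k. W (k + K') f)"
    using assms(1) summable_ignore_initial_segment[OF summable[OF assms(1)], of K']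
    by (intro Series.sum_le_suminf) (auto intro: W_nonneg)
  finally show ?thesis .
qed

text \<open>Ramsey: colour a pair by the first index below \<open>K\<close> at which it is at least
  \<open>e\<close> apart, and by \<open>K\<close> if there is none. An infinite homogeneous set of a
  colour below \<open>K\<close> would contradict \<open>thin\<close>.\<close>

lemma thin_set:
  assumes "infinite S" "0 < e"
  shows "\<exists>S'\<subseteq>S. infinite S' \<and> (\<forall>i\<in>S'. \<forall>j\<in>S'. \<forall>k<K. W k (x i - x j) < e)"
proof -
  define bad where "bad E k \<longleftrightarrow> k < K \<and> (\<exists>i\<in>E. \<exists>j\<in>E. e \<le> W k (x i - x j))" for E :: "nat set" and k
  define c where "c E = (if \<exists>k. bad E k then LEAST k. bad E k else K)" for E
  have c: "bad E (c E)" if "\<exists>k. bad E k" for E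
    using LeastI_ex[OF that] that by (simp add: c_def)
  have cK: "c E < Suc K" for E
  proof (cases "\<exists>k. bad E k")
    case True then show ?thesis using c[OF True] by (auto simp: bad_def)
  qed (simp add: c_def)
  obtain Y t where Y: "Y \<subseteq> S" "infinite Y" "t < Suc K"
    "\<And>i j. i \<in> Y \<Longrightarrow> j \<in> Y \<Longrightarrow> i \<noteq> j \<Longrightarrow> c {i, j} = t"
    using Ramsey2[OF assms(1), of c "Suc K"] cK by blast
  have W0: "W k (x i - x i) = 0" for k i using p_seminorm.zero[OF W] by simp
  show ?thesis
  proof (cases "t < K")
    case True
    obtain i j where ij: "i \<in> Y" "j \<in> Y" "i \<noteq> j" "W t (x i - x j) < e"
      using thin[OF Y(2) assms(2)] by blast
    have "c {i, j} = t" using Y(4) ij by blast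
    then have "\<exists>k. bad {i, j} k" using True by (metis c_def nat_neq_iff)
    then have "bad {i, j} t" using c \<open>c {i, j} = t\<close> by metis
    then show ?thesis
      using ij(4) W0 assms(2) p_seminorm.diff_commute[OF W x x, of t i j] by (auto simp: bad_def)
  next
    case False
    have "W k (x i - x j) < e" if "i \<in> Y" "j \<in> Y" "k < K" for i j k
    proof (cases "i = j")
      case True then show ?thesis using W0 assms(2) by simp
    next
      case ne: False
      have "\<not> bad {i, j} k'" for k'
      proof
        assume "bad {i, j} k'"
        then have "bad {i, j} (c {i, j})" using c by blast
        then have "c {i, j} < K" by (simp add: bad_def)
        then show False using False Y(4)[OF that(1,2) ne] by simp
      qed
      then show ?thesis using that(3) by (fastforce simp: bad_def not_le[symmetric])
    qed
    then show ?thesis using Y by blast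
  qed
qed

text \<open>
  The tail of the sequence need not converge to \<open>0\<close> in the block, so the block has to see the chosen
  element modulo every multiple of the later ones. Among sufficiently many candidates one works: if
  all were close to the line through \<open>x N\<close>, they could not be separated.
\<close>
lemma next_block:
  assumes "infinite S" "0 < e"
  shows "\<exists>n\<in>S. \<exists>K'\<ge>K. \<exists>S'\<subseteq>S. infinite S' \<and> (\<forall>N\<in>S'. n < N) \<and> (\<Sum>k. W (k + K') (x n)) \<le> e \<and>
    (\<forall>N\<in>S'. \<forall>l. r / 8 \<le> block K K' (x n - l *\<^sub>R x N)) \<and>
    (\<forall>N\<in>S'. \<forall>N'\<in>S'. block K K' (x N - x N') \<le> e)"
proof -
  obtain S1 where S1: "S1 \<subseteq> S" "infinite S1"
    "\<And>i j k. i \<in> S1 \<Longrightarrow> j \<in> S1 \<Longrightarrow> k < K \<Longrightarrow> W k (x i - x j) < r / 4 / (K + 1)"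
  proof -
    have "0 < r / 4 / (K + 1)" using r_pos by simp
    from thin_set[OF assms(1) this, of K] show ?thesis using that by blast
  qed
  have head: "(\<Sum>k<K. W k (x i - x j)) \<le> r / 4" if "i \<in> S1" "j \<in> S1" for i j
  proof -
    have "(\<Sum>k<K. W k (x i - x j)) \<le> (\<Sum>k<K. r / 4 / (K + 1))"
      using S1(3)[OF that] by (intro sum_mono) (auto intro: less_imp_le)
    also have "\<dots> \<le> r / 4" using r_pos by (simp add: field_simps)
    finally show ?thesis .
  qed
  \<comment> \<open>If every candidate were close to the line through \<open>x N\<close>, its
    position on that line, measured by the real number \<open>\<mu>\<close> below, would be bounded
    by \<open>R0\<close>, and the positions would be \<open>s0\<close>-separated. The set
    \<open>I\<close> has one element more than this permits.\<close>
  define R0 s0 where "R0 = (B + r / 8) powr (1 / p)" and "s0 = (r / 4) powr (1 / p)"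
  have s0: "0 < s0" using r_pos by (simp add: s0_def)
  obtain I where I: "finite I" "card I = Suc (card {\<lfloor>- R0 / s0\<rfloor>..\<lfloor>R0 / s0\<rfloor>})" "I \<subseteq> S1"
    using infinite_arbitrarily_large[OF S1(2)] by blast
  define e' where "e' = min e (r / 8)"
  have e': "0 < e'" using assms(2) r_pos by (simp add: e'_def)
  have tail: "\<exists>L. \<forall>L'\<ge>L. (\<Sum>k. W (k + L') (x i)) < e'" for i
  proof -
    obtain L where "\<And>L'. L \<le> L' \<Longrightarrow> norm (\<Sum>k. W (k + L') (x i)) < e'"
      using suminf_exist_split[OF e' summable[OF x]] by blast
    then show ?thesis by (metis abs_ge_self order_le_less_trans real_norm_def)
  qed
  then obtain L where L: "\<And>i L'. L i \<le> L' \<Longrightarrow> (\<Sum>k. W (k + L') (x i)) < e'" by metis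
  define K' where "K' = K + (\<Sum>i\<in>I. L i)"
  have K': "K \<le> K'" "\<And>i. i \<in> I \<Longrightarrow> (\<Sum>k. W (k + K') (x i)) < e'"
    using I(1) by (auto simp: K'_def intro!: L trans_le_add2 member_le_sum)
  interpret Q: p_seminorm p V "block K K'" by (rule block)
  \<comment> \<open>Of the total distance \<open>r\<close>, the scales below \<open>K\<close> carry
    at most \<open>r / 4\<close>, by the choice of \<open>S1\<close>, and the scales from
    \<open>K'\<close> on carry at most two tails of \<open>r / 8\<close>.\<close>
  have Qsep: "r / 2 \<le> block K K' (x i - x j)" if ij: "i \<in> I" "j \<in> I" "i \<noteq> j" for i j
  proof -
    have sm: "summable (\<lambda>k. W (k + K') (x i))" for i
      by (rule summable_ignore_initial_segment[OF summable[OF x]])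
    have "(\<Sum>k. W (k + K') (x i - x j)) \<le> (\<Sum>k. W (k + K') (x i) + W (k + K') (x j))"
      by (rule suminf_le[OF p_seminorm.diff_le[OF W x x]
            summable_ignore_initial_segment[OF summable[OF xdiff]] summable_add[OF sm sm]])
    also have "\<dots> = (\<Sum>k. W (k + K') (x i)) + (\<Sum>k. W (k + K') (x j))"
      by (rule suminf_add[OF sm sm, symmetric])
    also have "\<dots> \<le> r / 4" using K'(2)[OF ij(1)] K'(2)[OF ij(2)] by (auto simp: e'_def)
    finally have 1: "(\<Sum>k. W (k + K') (x i - x j)) \<le> r / 4" .
    have "(\<Sum>k. W k (x i - x j)) = (\<Sum>k. W (k + K') (x i - x j)) + (\<Sum>k<K'. W k (x i - x j))"
      by (rule suminf_split_initial_segment[OF summable[OF xdiff]])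
    also have "(\<Sum>k<K'. W k (x i - x j)) = (\<Sum>k<K. W k (x i - x j)) + block K K' (x i - x j)"
      unfolding block_def using K'(1) by (simp add: lessThan_atLeast0 sum.atLeastLessThan_concat)
    finally show ?thesis using separated[OF ij(3)] 1 head[OF subsetD[OF I(3) ij(1)] subsetD[OF I(3) ij(2)]]
      by linarith
  qed
  define good where "good i N \<longleftrightarrow> (\<forall>l. r / 8 \<le> block K K' (x i - l *\<^sub>R x N))" for i N
  have "\<exists>i\<in>I. good i N" for N
  proof (rule ccontr)
    assume "\<not> ?thesis"
    then have "\<forall>i\<in>I. \<exists>l. block K K' (x i - l *\<^sub>R x N) < r / 8" by (auto simp: good_def not_le)
    then obtain l where l: "\<And>i. i \<in> I \<Longrightarrow> block K K' (x i - l i *\<^sub>R x N) < r / 8" by metis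
    define \<kappa> where "\<kappa> = block K K' (x N)"
    have \<kappa>: "0 \<le> \<kappa>" unfolding \<kappa>_def by (rule Q.nonneg[OF x])
    \<comment> \<open>This rescaling makes \<open>\<bar>\<mu> i - \<mu> j\<bar> powr p\<close> equal
      to the block seminorm of \<open>(l i - l j) *\<^sub>R x N\<close>, so that counting on the
      real line applies.\<close>
    define \<mu> where "\<mu> i = l i * \<kappa> powr (1 / p)" for i
    have lx: "c *\<^sub>R x N \<in> V" for c by (rule subspace_scale[OF subspace x])
    have pw: "\<bar>c * \<kappa> powr (1 / p)\<bar> powr p = block K K' (c *\<^sub>R x N)" for c
      using Q.scale[OF x] \<kappa> p_pos by (simp add: abs_mult powr_mult powr_powr \<kappa>_def)
    have root: "y \<le> z powr (1 / p)" if "y powr p \<le> z" "0 \<le> y" for y z :: real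
      using powr_mono2[of "1 / p" "y powr p" z] that p_pos by (simp add: powr_powr)
    have root': "z powr (1 / p) \<le> y" if "z \<le> y powr p" "0 \<le> y" "0 \<le> z" for y z :: real
      using powr_mono2[of "1 / p" z "y powr p"] that p_pos by (simp add: powr_powr)
    have "card I \<le> card {\<lfloor>- R0 / s0\<rfloor>..\<lfloor>R0 / s0\<rfloor>}"
    proof (rule card_separated_reals_le[OF s0, of I \<mu> R0])
      fix i assume i: "i \<in> I"
      have "block K K' (x i) \<le> (\<Sum>k. W k (x i))"
        unfolding block_def by (rule sum_le_suminf[OF x]) simp
      then have "block K K' (x i) \<le> B" using bounded[of i] by simp
      moreover have "block K K' (l i *\<^sub>R x N) \<le> block K K' (x i) + block K K' (x i - l i *\<^sub>R x N)"
        using Q.diff_ge'[OF lx x, of "l i" i] Q.diff_commute[OF lx x, of "l i" i] by simp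
      ultimately have "\<bar>\<mu> i\<bar> powr p \<le> B + r / 8" using l[OF i] by (simp add: \<mu>_def pw)
      then show "\<bar>\<mu> i\<bar> \<le> R0" unfolding R0_def by (intro root) auto
    next
      fix i j assume ij: "i \<in> I" "j \<in> I" "i \<noteq> j"
      have "block K K' (x i - x j) \<le> block K K' (x i - l i *\<^sub>R x N) + block K K' (l i *\<^sub>R x N - x j)"
        by (rule Q.diff_triangle[OF x lx x])
      also have "block K K' (l i *\<^sub>R x N - x j)
          \<le> block K K' (l i *\<^sub>R x N - l j *\<^sub>R x N) + block K K' (l j *\<^sub>R x N - x j)"
        by (rule Q.diff_triangle[OF lx lx x])
      finally have "r / 4 \<le> block K K' ((l i - l j) *\<^sub>R x N)"
        using Qsep[OF ij] l[OF ij(1)] l[OF ij(2)] Q.diff_commute[OF lx x, of "l j" j]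
        by (simp add: scaleR_diff_left)
      then have "r / 4 \<le> \<bar>\<mu> i - \<mu> j\<bar> powr p"
        using pw[of "l i - l j"] by (simp add: \<mu>_def left_diff_distrib)
      then show "s0 \<le> \<bar>\<mu> i - \<mu> j\<bar>" unfolding s0_def using r_pos by (intro root') auto
    qed
    then show False using I(2) by simp
  qed
  then obtain g where g: "\<And>N. g N \<in> I" "\<And>N. good (g N) N" by metis
  \<comment> \<open>The good candidate depends on \<open>N\<close>, but there are only finitely many
    candidates, so one of them serves infinitely many \<open>N\<close>. Discarding the indices up to
    \<open>Max I\<close> ensures \<open>n < N\<close>.\<close>
  define S2 where "S2 = S1 - {..Max I}"
  have S2: "infinite S2" using S1(2) by (simp add: S2_def)
  have "\<exists>i\<in>I. infinite {N\<in>S2. g N = i}"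
  proof (rule ccontr)
    assume "\<not> ?thesis"
    then have "finite (\<Union>i\<in>I. {N\<in>S2. g N = i})" using I(1) by auto
    moreover have "S2 \<subseteq> (\<Union>i\<in>I. {N\<in>S2. g N = i})" using g by auto
    ultimately show False using S2 finite_subset by blast
  qed
  then obtain n where n: "n \<in> I" "infinite {N\<in>S2. g N = n}" by auto
  have K'pos: "0 < e / (K' + 1)" using assms(2) by simp
  obtain S' where S': "S' \<subseteq> {N\<in>S2. g N = n}" "infinite S'"
    "\<And>i j k. i \<in> S' \<Longrightarrow> j \<in> S' \<Longrightarrow> k < K' \<Longrightarrow> W k (x i - x j) < e / (K' + 1)"
    using thin_set[OF n(2) K'pos, of K'] by blast
  have "block K K' (x N - x N') \<le> e" if "N \<in> S'" "N' \<in> S'" for N N'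
  proof -
    have "block K K' (x N - x N') \<le> (\<Sum>k\<in>{K..<K'}. e / (K' + 1))"
      unfolding block_def using S'(3)[OF that] by (intro sum_mono) (auto intro: less_imp_le)
    also have "\<dots> = real (K' - K) * (e / (K' + 1))" by simp
    also have "\<dots> \<le> real (K' + 1) * (e / (K' + 1))" using assms(2) by (intro mult_right_mono) auto
    finally show ?thesis by simp
  qed
  moreover have "n < N" if "N \<in> S'" for N
  proof -
    have "n \<le> Max I" using I(1) n(1) by simp
    moreover have "\<not> N \<le> Max I" using that S'(1) by (auto simp: S2_def)
    ultimately show ?thesis by simp
  qed
  moreover have "good n N" if "N \<in> S'" for N using that S'(1) g(2)[of N] by auto
  moreover have "S' \<subseteq> S" using S'(1) S1(1) by (auto simp: S2_def)
  moreover have "n \<in> S" using n(1) I(3) S1(1) by auto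
  moreover have "(\<Sum>k. W (k + K') (x n)) \<le> e" using K'(2)[OF n(1)] by (simp add: e'_def)
  ultimately show ?thesis
    using K'(1) S'(2) unfolding good_def by (intro bexI[of _ n] exI[of _ K'] exI[of _ S']) auto
qed

text \<open>Block \<open>j\<close> sees the \<open>j\<close>-th term modulo multiples of one later
  element, with strength \<open>r / 8\<close>. All other terms disturb the blocks by at most
  \<open>r / 16\<close> in total per coefficient, and adding up the disjoint blocks leaves
  \<open>r / 16\<close>.\<close>

theorem lp_lower_bound:
  "\<exists>\<sigma> :: nat \<Rightarrow> nat. strict_mono \<sigma> \<and> (\<forall>J a. r / 16 * (\<Sum>j<J. \<bar>a j\<bar> powr p)
    \<le> (\<Sum>k. W k (\<Sum>j<J. a j *\<^sub>R x (\<sigma> j))))"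
proof -
  \<comment> \<open>The geometric decay keeps the total disturbance caused by one element summable
    over the blocks.\<close>
  define e where "e j = r / 64 * (1 / 2) ^ j" for j :: nat
  have e_pos: "0 < e j" for j using r_pos by (simp add: e_def)
  define P where "P j s \<longleftrightarrow> (case s of (n, K, K', S) \<Rightarrow> infinite S \<and> K \<le> K' \<and> (\<forall>N\<in>S. n < N) \<and>
      (\<Sum>k. W (k + K') (x n)) \<le> e j \<and>
      (\<forall>N\<in>S. \<forall>l. r / 8 \<le> block K K' (x n - l *\<^sub>R x N)) \<and>
      (\<forall>N\<in>S. \<forall>N'\<in>S. block K K' (x N - x N') \<le> e j))"
    for j :: nat and s :: "nat \<times> nat \<times> nat \<times> nat set"
  define R where "R s s' \<longleftrightarrow> (case s of (n, K, K', S) \<Rightarrow> case s' of (n', L, L', S') \<Rightarrow>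
      n' \<in> S \<and> L = K' \<and> S' \<subseteq> S)" for s s' :: "nat \<times> nat \<times> nat \<times> nat set"
  have "\<exists>f. \<forall>j. P j (f j) \<and> R (f j) (f (Suc j))"
  proof (rule dependent_nat_choice)
    show "\<exists>s. P 0 s"
      using next_block[of UNIV "e 0" 0] e_pos by (auto simp: P_def)
    show "\<exists>s'. P (Suc j) s' \<and> R s s'" if "P j s" for s j
    proof -
      obtain n K K' S where s: "s = (n, K, K', S)" by (cases s) auto
      have "infinite S" using that by (simp add: P_def s)
      from next_block[OF this e_pos, of K' "Suc j"] obtain n' L' S' where
        "n' \<in> S" "K' \<le> L'" "S' \<subseteq> S" "infinite S'" "\<forall>N\<in>S'. n' < N"
        "(\<Sum>k. W (k + L') (x n')) \<le> e (Suc j)"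
        "\<forall>N\<in>S'. \<forall>l. r / 8 \<le> block K' L' (x n' - l *\<^sub>R x N)"
        "\<forall>N\<in>S'. \<forall>N'\<in>S'. block K' L' (x N - x N') \<le> e (Suc j)" by auto
      then show ?thesis by (intro exI[of _ "(n', K', L', S')"]) (auto simp: P_def R_def s)
    qed
  qed
  then obtain f where f: "\<And>j. P j (f j)" "\<And>j. R (f j) (f (Suc j))" by blast
  define \<sigma> K S where "\<sigma> j = fst (f j)" and "K j = fst (snd (f j))" and "S j = snd (snd (snd (f j)))" for j
  have f_eq: "f j = (\<sigma> j, K j, K (Suc j), S j)" for j
    using f(2)[of j] by (cases "f j"; cases "f (Suc j)") (auto simp: R_def \<sigma>_def K_def S_def)
  have SS: "S (Suc j) \<subseteq> S j" "\<sigma> (Suc j) \<in> S j" for j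
    using f(2)[of j] by (auto simp: R_def f_eq)
  have S_mono: "S m \<subseteq> S j" if "j \<le> m" for j m
    using that by (induction m rule: dec_induct) (use SS in auto)
  have \<sigma>S: "\<sigma> m \<in> S j" if "j < m" for j m
    using S_mono[of j "m - 1"] SS(2)[of "m - 1"] that by (cases m) auto
  have K_mono: "K j \<le> K (Suc j)" for j using f(1)[of j] by (simp add: P_def f_eq)
  then have K_mono': "K j \<le> K m" if "j \<le> m" for j m
    using that by (rule lift_Suc_mono_le[of K])
  have tail: "(\<Sum>k. W (k + K (Suc j)) (x (\<sigma> j))) \<le> e j" for j
    using f(1)[of j] by (simp add: P_def f_eq)
  have low: "r / 8 \<le> block (K j) (K (Suc j)) (x (\<sigma> j) - l *\<^sub>R x (\<sigma> m))" if "j < m" for j m l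
    using f(1)[of j] \<sigma>S[OF that] by (simp add: P_def f_eq)
  have close: "block (K j) (K (Suc j)) (x (\<sigma> m) - x (\<sigma> m')) \<le> e j" if "j < m" "j < m'" for j m m'
    using f(1)[of j] \<sigma>S[OF that(1)] \<sigma>S[OF that(2)] by (simp add: P_def f_eq)
  have mono: "strict_mono \<sigma>"
    using f(1) SS(2) by (auto simp: strict_mono_Suc_iff P_def f_eq)
  have main: "r / 16 * (\<Sum>j<J. \<bar>a j\<bar> powr p) \<le> (\<Sum>k. W k (\<Sum>j<J. a j *\<^sub>R x (\<sigma> j)))" for J a
  proof -
    define F where "F = (\<Sum>j<J. a j *\<^sub>R x (\<sigma> j))"
    \<comment> \<open>All later terms are almost equal to \<open>y\<close> in an earlier block.
      Replacing them by \<open>y\<close> merges them into one multiple \<open>c *\<^sub>R y\<close>,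
      against which \<open>low\<close> protects the \<open>j\<close>-th term whatever
      \<open>c\<close> is.\<close>
    define y where "y = x (\<sigma> J)"
    define Q where "Q j = block (K j) (K (Suc j))" for j
    have FV: "F \<in> V" unfolding F_def by (intro subspace_sum[OF subspace] subspace_scale[OF subspace] x)
    have yV: "y \<in> V" by (simp add: y_def x)
    define z where "z j m = (if m < j then x (\<sigma> m) else x (\<sigma> m) - y)" for j m
    have zV: "z j m \<in> V" for j m by (auto simp: z_def x yV intro: subspace_diff[OF subspace])
    define A where "A m = \<bar>a m\<bar> powr p" for m
    have A: "0 \<le> A m" for m by (simp add: A_def)
    have Qj: "A j * (r / 8) - (\<Sum>m\<in>{..<J} - {j}. A m * Q j (z j m)) \<le> Q j F" if j: "j < J" for j
    proof -
      interpret Q: p_seminorm p V "Q j" unfolding Q_def by (rule block)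
      define c where "c = (\<Sum>m\<in>{j<..<J}. a m)"
      have "F = a j *\<^sub>R x (\<sigma> j) + (\<Sum>m\<in>{..<J} - {j}. a m *\<^sub>R x (\<sigma> m))"
        unfolding F_def using j by (intro sum.remove) auto
      also have "(\<Sum>m\<in>{..<J} - {j}. a m *\<^sub>R x (\<sigma> m))
          = (\<Sum>m\<in>{..<J} - {j}. a m *\<^sub>R z j m + (if m < j then 0 else a m *\<^sub>R y))"
        by (intro sum.cong) (auto simp: z_def algebra_simps)
      also have "\<dots> = (\<Sum>m\<in>{..<J} - {j}. a m *\<^sub>R z j m) + (\<Sum>m\<in>{..<J} - {j}. if m < j then 0 else a m *\<^sub>R y)"
        by (rule sum.distrib)
      also have "(\<Sum>m\<in>{..<J} - {j}. if m < j then 0 else a m *\<^sub>R y) = (\<Sum>m\<in>{j<..<J}. a m *\<^sub>R y)"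
        by (intro sum.mono_neutral_cong_right) auto
      also have "\<dots> = c *\<^sub>R y" by (simp add: c_def scaleR_sum_left)
      finally have F: "F = (a j *\<^sub>R x (\<sigma> j) + c *\<^sub>R y) + (\<Sum>m\<in>{..<J} - {j}. a m *\<^sub>R z j m)"
        by (simp add: algebra_simps)
      have uV: "a j *\<^sub>R x (\<sigma> j) + c *\<^sub>R y \<in> V"
        by (intro subspace_add[OF subspace] subspace_scale[OF subspace] x yV)
      have vV: "(\<Sum>m\<in>{..<J} - {j}. a m *\<^sub>R z j m) \<in> V"
        by (intro subspace_sum[OF subspace] subspace_scale[OF subspace] zV)
      have "A j * (r / 8) \<le> Q j (a j *\<^sub>R x (\<sigma> j) + c *\<^sub>R y)"
      proof (cases "a j = 0")
        case True
        then show ?thesis using Q.nonneg[OF uV] p_pos by (simp add: A_def)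
      next
        case False
        have eq: "a j *\<^sub>R x (\<sigma> j) + c *\<^sub>R y = a j *\<^sub>R (x (\<sigma> j) - (- c / a j) *\<^sub>R y)"
          using False by (simp add: algebra_simps)
        have dV: "x (\<sigma> j) - (- c / a j) *\<^sub>R y \<in> V"
          by (intro subspace_diff[OF subspace] subspace_scale[OF subspace] x yV)
        show ?thesis unfolding eq Q.scale[OF dV] A_def
          using low[OF j, of "- c / a j"] by (intro mult_left_mono) (auto simp: Q_def y_def)
      qed
      moreover have "Q j (\<Sum>m\<in>{..<J} - {j}. a m *\<^sub>R z j m) \<le> (\<Sum>m\<in>{..<J} - {j}. A m * Q j (z j m))"
        unfolding A_def by (rule Q.sum_le[OF zV])
      ultimately show ?thesis using Q.diff_ge[OF uV vV] F by simp
    qed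
    \<comment> \<open>The earlier blocks see only the difference of element \<open>m\<close> and
      \<open>y\<close>, which is small by \<open>close\<close>; the later blocks see only its tail,
      which is small by \<open>tail\<close>. Together they give
      \<open>r / 64 * 2 + r / 64\<close>.\<close>
    have cross: "(\<Sum>j\<in>{..<J} - {m}. Q j (z j m)) \<le> r / 16" if m: "m < J" for m
    proof -
      have "(\<Sum>j\<in>{..<J} - {m}. Q j (z j m)) = (\<Sum>j<m. Q j (z j m)) + (\<Sum>j\<in>{Suc m..<J}. Q j (z j m))"
      proof -
        have "{..<J} - {m} = {..<m} \<union> {Suc m..<J}" using m by auto
        moreover have "{..<m} \<inter> {Suc m..<J} = {}" by auto
        ultimately show ?thesis by (simp add: sum.union_disjoint)
      qed
      also have "(\<Sum>j<m. Q j (z j m)) \<le> (\<Sum>j<m. e j)"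
        using close m by (intro sum_mono) (auto simp: z_def Q_def y_def)
      also have "(\<Sum>j<m. e j) = r / 64 * (\<Sum>j<m. (1 / 2) ^ j)" by (simp add: e_def sum_distrib_left)
      also have "\<dots> \<le> r / 64 * 2" using r_pos by (intro mult_left_mono) (auto simp: sum_gp_strict)
      also have "(\<Sum>j\<in>{Suc m..<J}. Q j (z j m)) = (\<Sum>j\<in>{Suc m..<J}. Q j (x (\<sigma> m)))"
        by (intro sum.cong) (auto simp: z_def)
      also have "\<dots> = block (K (Suc m)) (K J) (x (\<sigma> m))"
      proof -
        have "(\<Sum>j\<in>{Suc m..<J'}. Q j f) = block (K (Suc m)) (K J') f" if "Suc m \<le> J'" for f J'
          using that
        proof (induction J' rule: dec_induct)
          case (step n)
          then show ?case using K_mono' K_mono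
            by (simp add: Q_def block_def sum.atLeastLessThan_concat)
        qed (simp add: block_def)
        then show ?thesis using m by auto
      qed
      also have "\<dots> \<le> (\<Sum>k. W (k + K (Suc m)) (x (\<sigma> m)))" by (rule block_le_tail[OF x order_refl])
      also have "\<dots> \<le> e m" by (rule tail)
      also have "e m \<le> r / 64 * 1" unfolding e_def using r_pos by (intro mult_left_mono) (auto simp: power_le_one)
      finally show ?thesis using r_pos by simp
    qed
    have "(\<Sum>j<J. Q j F) = block (K 0) (K J) F"
    proof (induction J)
      case (Suc n)
      then show ?case using K_mono'[of 0 n] K_mono[of n]
        by (simp add: Q_def block_def sum.atLeastLessThan_concat)
    qed (simp add: block_def)
    also have "\<dots> \<le> (\<Sum>k. W k F)" unfolding block_def by (rule sum_le_suminf[OF FV]) simp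
    finally have up: "(\<Sum>j<J. Q j F) \<le> (\<Sum>k. W k F)" .
    have "r / 16 * (\<Sum>j<J. A j) = (\<Sum>j<J. A j * (r / 8)) - (\<Sum>m<J. A m * (r / 16))"
      unfolding sum_distrib_right[symmetric] by simp
    also have "\<dots> \<le> (\<Sum>j<J. A j * (r / 8)) - (\<Sum>m<J. A m * (\<Sum>j\<in>{..<J} - {m}. Q j (z j m)))"
      using cross A by (intro diff_left_mono sum_mono mult_left_mono) auto
    also have "(\<Sum>m<J. A m * (\<Sum>j\<in>{..<J} - {m}. Q j (z j m)))
        = (\<Sum>j<J. \<Sum>m\<in>{..<J} - {j}. A m * Q j (z j m))"
    proof -
      have "(\<Sum>m<J. A m * (\<Sum>j\<in>{..<J} - {m}. Q j (z j m)))
          = (\<Sum>m<J. \<Sum>j<J. if j = m then 0 else A m * Q j (z j m))"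
        unfolding sum_distrib_left by (intro sum.cong refl sum.mono_neutral_cong_left) auto
      also have "\<dots> = (\<Sum>j<J. \<Sum>m<J. if j = m then 0 else A m * Q j (z j m))" by (rule sum.swap)
      also have "\<dots> = (\<Sum>j<J. \<Sum>m\<in>{..<J} - {j}. A m * Q j (z j m))"
        by (intro sum.cong refl sum.mono_neutral_cong_right) auto
      finally show ?thesis .
    qed
    also have "(\<Sum>j<J. A j * (r / 8)) - (\<Sum>j<J. \<Sum>m\<in>{..<J} - {j}. A m * Q j (z j m))
        \<le> (\<Sum>j<J. Q j F)"
      unfolding sum_subtractf[symmetric] using Qj by (intro sum_mono) auto
    finally show ?thesis using up by (simp add: A_def F_def)
  qed
  show ?thesis by (intro exI[of _ \<sigma>] conjI allI mono main)
qed

end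

section \<open>Transport seminorms\<close>

definition point_mass :: "'a \<Rightarrow> 'a \<Rightarrow> real"
  where "point_mass x = (\<lambda>y. if y = x then 1 else 0)"

definition dipole :: "'a \<Rightarrow> 'a \<Rightarrow> 'a \<Rightarrow> real"
  where "dipole x y = point_mass x - point_mass y"

text \<open>A plan is a list of weighted edges, so that repeated edges are allowed, concatenation
  adds plans, and induction is available.\<close>

definition combination :: "(real \<times> 'a \<times> 'a) list \<Rightarrow> 'a \<Rightarrow> real"
  where "combination l = (\<Sum>(a, x, y)\<leftarrow>l. a *\<^sub>R dipole x y)"

definition cost :: "real \<Rightarrow> ('a \<Rightarrow> 'a \<Rightarrow> real) \<Rightarrow> (real \<times> 'a \<times> 'a) list \<Rightarrow> real"
  where "cost p c l = (\<Sum>(a, x, y)\<leftarrow>l. \<bar>a\<bar> powr p * c x y)"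

text \<open>These are the finitely supported functions with total sum 0; in this form membership
  supplies a plan.\<close>

definition balanced :: "('a \<Rightarrow> real) set"
  where "balanced = range combination"

definition transport :: "real \<Rightarrow> ('a \<Rightarrow> 'a \<Rightarrow> real) \<Rightarrow> ('a \<Rightarrow> real) \<Rightarrow> real"
  where "transport p c f = Inf {cost p c l | l. combination l = f}"

text \<open>The linear extension of \<open>F\<close> from point masses to finitely supported
  functions.\<close>

definition lift :: "('a \<Rightarrow> 'v::real_vector) \<Rightarrow> ('a \<Rightarrow> real) \<Rightarrow> 'v"
  where "lift F f = (\<Sum>x | f x \<noteq> 0. f x *\<^sub>R F x)"

definition push :: "('a \<Rightarrow> 'a) \<Rightarrow> ('a \<Rightarrow> real) \<Rightarrow> 'a \<Rightarrow> real"
  where "push r = lift (\<lambda>x. point_mass (r x))"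

definition mass :: "real \<Rightarrow> ('a \<Rightarrow> real) \<Rightarrow> real"
  where "mass p f = (\<Sum>x | f x \<noteq> 0. \<bar>f x\<bar> powr p)"

text \<open>
  Induction leaves functions eta-expanded, so that the pointwise simplification rules would apply to
  them; they are removed where this does harm.
\<close>
lemmas pointwise = plus_fun_apply zero_fun_apply minus_apply

lemma combination_simps [simp]:
  "combination [] = 0"
  "combination ((a, x, y) # l) = a *\<^sub>R dipole x y + combination l"
  "combination (l @ l') = combination l + combination l'"
  by (auto simp: combination_def)

lemma cost_simps [simp]:
  "cost p c [] = 0"
  "cost p c ((a, x, y) # l) = \<bar>a\<bar> powr p * c x y + cost p c l"
  "cost p c (l @ l') = cost p c l + cost p c l'"
  by (auto simp: cost_def)

lemma cost_nonneg: "(\<And>x y. 0 \<le> c x y) \<Longrightarrow> 0 \<le> cost p c l"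
  by (induction l) auto

lemma cost_mono: "(\<And>x y. c x y \<le> c' x y) \<Longrightarrow> cost p c l \<le> cost p c' l"
  by (induction l) (auto intro!: add_mono mult_left_mono)

lemma cost_sum:
  "cost p (\<lambda>x y. \<Sum>k\<in>K. c k x y) l = (\<Sum>k\<in>K. cost p (c k) l)"
  by (induction l) (auto simp: sum.distrib sum_distrib_left)

lemma cost_scale: "cost p (\<lambda>x y. t * c x y) l = t * cost p c l"
  by (induction l) (auto simp: algebra_simps)

lemma combination_map_scale:
  "combination (map (\<lambda>(a, x, y). (t * a, x, y)) l) = t *\<^sub>R combination l"
  by (induction l) (auto simp: scaleR_add_right simp del: pointwise)

lemma cost_map_scale:
  "cost p c (map (\<lambda>(a, x, y). (t * a, x, y)) l) = \<bar>t\<bar> powr p * cost p c l"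
  by (induction l) (auto simp: abs_mult powr_mult algebra_simps)

lemma subspace_balanced: "subspace balanced"
  unfolding subspace_def balanced_def
proof (intro conjI ballI allI)
  show "0 \<in> range combination" by (rule range_eqI[of _ _ "[]"]) simp
  show "x + y \<in> range combination" if xy: "x \<in> range combination" "y \<in> range combination"
    for x y :: "'a \<Rightarrow> real"
  proof -
    obtain l l' where "x = combination l" "y = combination l'" using xy by blast
    then have "x + y = combination (l @ l')" by simp
    then show ?thesis by blast
  qed
  show "c *\<^sub>R x \<in> range combination" if x: "x \<in> range combination" for c and x :: "'a \<Rightarrow> real"
  proof -
    obtain l where "x = combination l" using x by blast
    then have "c *\<^sub>R x = combination (map (\<lambda>(a, x, y). (c * a, x, y)) l)"
      by (simp only: combination_map_scale)
    then show ?thesis by blast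
  qed
qed

lemmas balanced_0 = subspace_0[OF subspace_balanced]
  and balanced_add = subspace_add[OF subspace_balanced]
  and balanced_diff = subspace_diff[OF subspace_balanced]
  and balanced_scale = subspace_scale[OF subspace_balanced]
  and balanced_sum = subspace_sum[OF subspace_balanced]

lemma combination_balanced [simp]: "combination l \<in> balanced"
  by (simp add: balanced_def)

lemma dipole_balanced [simp]: "dipole x y \<in> balanced"
  using combination_balanced[of "[(1, x, y)]"] by simp

lemma transport_le:
  assumes "\<And>x y. 0 \<le> c x y"
  shows "transport p c (combination l) \<le> cost p c l"
  unfolding transport_def
  by (rule cInf_lower) (auto intro!: bdd_belowI[of _ 0] cost_nonneg assms)

lemma transport_dipole_le:
  assumes "\<And>x y. 0 \<le> c x y"
  shows "transport p c (dipole x y) \<le> c x y"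
  using transport_le[where c = c and l = "[(1, x, y)]", OF assms, of p] by simp

lemma transport_less:
  assumes "f \<in> balanced" "0 < e"
  obtains l where "combination l = f" "cost p c l < transport p c f + e"
proof -
  have "{cost p c l | l. combination l = f} \<noteq> {}" using assms(1) by (auto simp: balanced_def)
  from cInf_lessD[OF this, of "transport p c f + e"] assms(2) that show ?thesis
    by (auto simp: transport_def)
qed

lemma transport_greatest:
  assumes "f \<in> balanced" "\<And>l. combination l = f \<Longrightarrow> t \<le> cost p c l"
  shows "t \<le> transport p c f"
  unfolding transport_def using assms by (intro cInf_greatest) (auto simp: balanced_def)

lemma p_seminorm_transport:
  assumes "0 < p" "\<And>x y. 0 \<le> c x y"
  shows "p_seminorm p balanced (transport p c)"
proof
  show "0 \<le> transport p c f" if "f \<in> balanced" for f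
    using that by (rule transport_greatest) (rule cost_nonneg[OF assms(2)])
  show "transport p c (f + g) \<le> transport p c f + transport p c g"
    if "f \<in> balanced" "g \<in> balanced" for f g
  proof (rule field_le_epsilon)
    fix e :: real assume "0 < e"
    then have "0 < e / 2" by simp
    from transport_less[OF that(1) this] transport_less[OF that(2) this] obtain l l' where
      "combination l = f" "cost p c l < transport p c f + e / 2"
      "combination l' = g" "cost p c l' < transport p c g + e / 2" by metis
    then show "transport p c (f + g) \<le> transport p c f + transport p c g + e"
      using transport_le[where c = c and l = "l @ l'", OF assms(2), of p] by simp
  qed
  have le: "transport p c (t *\<^sub>R f) \<le> \<bar>t\<bar> powr p * transport p c f" if "f \<in> balanced" for f t
  proof (cases "t = 0")
    case True
    then show ?thesis using transport_le[where c = c and l = "[]", OF assms(2), of p] by simp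
  next
    case False
    have "transport p c (t *\<^sub>R f) / \<bar>t\<bar> powr p \<le> transport p c f"
    proof (rule transport_greatest[OF that])
      fix l assume "combination l = f"
      then show "transport p c (t *\<^sub>R f) / \<bar>t\<bar> powr p \<le> cost p c l"
        using transport_le[where c = c and l = "map (\<lambda>(a, x, y). (t * a, x, y)) l", OF assms(2), of p] False
        unfolding combination_map_scale cost_map_scale by (simp add: field_simps)
    qed
    then show ?thesis using False by (simp add: field_simps)
  qed
  show "transport p c (t *\<^sub>R f) = \<bar>t\<bar> powr p * transport p c f" if "f \<in> balanced" for f t
  \<comment> \<open>The reverse inequality is \<open>le\<close> for the inverse factor.\<close>
  proof (rule antisym[OF le[OF that]])
    show "\<bar>t\<bar> powr p * transport p c f \<le> transport p c (t *\<^sub>R f)"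
    proof (cases "t = 0")
      case True
      have "0 \<le> transport p c (0 :: 'a \<Rightarrow> real)"
        by (rule transport_greatest) (auto intro: cost_nonneg assms(2) balanced_0)
      then show ?thesis using True by simp
    next
      case False
      have "transport p c ((1 / t) *\<^sub>R (t *\<^sub>R f)) \<le> \<bar>1 / t\<bar> powr p * transport p c (t *\<^sub>R f)"
        by (rule le) (rule balanced_scale[OF that])
      then show ?thesis using False by (simp add: powr_divide field_simps)
    qed
  qed
qed (use assms subspace_balanced in auto)

lemma transport_mono:
  assumes "f \<in> balanced" "\<And>x y. 0 \<le> c x y" "\<And>x y. c x y \<le> c' x y"
  shows "transport p c f \<le> transport p c' f"
proof (rule transport_greatest[OF assms(1)])
  fix l assume "combination l = f"
  then show "transport p c f \<le> cost p c' l"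
    using transport_le[where c = c and l = l, OF assms(2), of p] cost_mono[of c c' p l] assms(3) by (metis order_trans)
qed

lemma transport_scale_cost_le:
  assumes "f \<in> balanced" "\<And>x y. 0 \<le> c x y" "\<And>x y. c x y \<le> t * c' x y" "0 < t"
  shows "transport p c f \<le> t * transport p c' f"
proof -
  have "transport p c f / t \<le> transport p c' f"
  proof (rule transport_greatest[OF assms(1)])
    fix l assume "combination l = f"
    then have "transport p c f \<le> cost p (\<lambda>x y. t * c' x y) l"
      using transport_le[where c = c and l = l, OF assms(2), of p] cost_mono[of c "\<lambda>x y. t * c' x y" p l] assms(3)
      by (metis order_trans)
    then show "transport p c f / t \<le> cost p c' l"
      using assms(4) by (simp add: cost_scale field_simps)
  qed
  then show ?thesis using assms(4) by (simp add: field_simps)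
qed

section \<open>Linear extensions and pushforwards\<close>

lemma lift_eq_sum:
  assumes "finite S" "{x. f x \<noteq> 0} \<subseteq> S"
  shows "lift F f = (\<Sum>x\<in>S. f x *\<^sub>R F x)"
  unfolding lift_def using assms by (intro sum.mono_neutral_left) auto

lemma finite_support_dipole: "finite {z. dipole x y z \<noteq> 0}"
  by (rule finite_subset[of _ "{x, y}"]) (auto simp: dipole_def point_mass_def)

lemma finite_support:
  assumes "f \<in> balanced"
  shows "finite {x. f x \<noteq> 0}"
proof -
  have "finite {x. combination l x \<noteq> 0}" for l :: "(real \<times> 'a \<times> 'a) list"
  proof (induction l)
    case (Cons e l)
    obtain a x y where "e = (a, x, y)" by (cases e)
    then have "{z. combination (e # l) z \<noteq> 0} \<subseteq> {z. dipole x y z \<noteq> 0} \<union> {z. combination l z \<noteq> 0}"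
      by (auto simp: scaleR_fun_def)
    then show ?case using Cons finite_support_dipole by (metis finite_UnI finite_subset)
  qed simp
  then show ?thesis using assms by (auto simp: balanced_def)
qed

lemma lift_add:
  assumes "finite {x. f x \<noteq> 0}" "finite {x. g x \<noteq> 0}"
  shows "lift F (f + g) = lift F f + lift F g"
proof -
  let ?S = "{x. f x \<noteq> 0} \<union> {x. g x \<noteq> 0}"
  have S: "finite ?S" "{x. f x \<noteq> 0} \<subseteq> ?S" "{x. g x \<noteq> 0} \<subseteq> ?S" "{x. (f + g) x \<noteq> 0} \<subseteq> ?S"
    using assms by auto
  show ?thesis
    unfolding lift_eq_sum[OF S(1,2)] lift_eq_sum[OF S(1,3)] lift_eq_sum[OF S(1,4)]
    by (simp add: scaleR_add_left sum.distrib)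
qed

lemma lift_scale: "lift F (t *\<^sub>R f) = t *\<^sub>R lift F f"
  by (cases "t = 0") (auto simp: lift_def scaleR_fun_def scaleR_sum_right)

lemma lift_zero: "lift F 0 = 0"
  by (simp add: lift_def)

lemma lift_dipole: "lift F (dipole x y) = F x - F y"
proof (cases "x = y")
  case False
  have "lift F (dipole x y) = (\<Sum>z\<in>{x, y}. dipole x y z *\<^sub>R F z)"
    by (rule lift_eq_sum) (auto simp: dipole_def point_mass_def)
  also have "\<dots> = F x - F y" using False by (auto simp: dipole_def point_mass_def)
  finally show ?thesis .
qed (simp add: dipole_def lift_def)

lemma lift_combination:
  "lift F (combination l) = (\<Sum>(a, x, y)\<leftarrow>l. a *\<^sub>R (F x - F y))"
proof (induction l)
  case (Cons e l)
  obtain a x y where "e = (a, x, y)" by (cases e)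
  moreover have "finite {z. (a *\<^sub>R dipole x y) z \<noteq> 0}"
    by (rule finite_subset[OF _ finite_support_dipole[of x y]]) (auto simp: scaleR_fun_def)
  ultimately show ?case
    using Cons finite_support[OF combination_balanced[of l]]
    by (simp add: lift_add lift_scale lift_dipole del: pointwise)
qed (simp add: lift_def)

lemma lift_const:
  assumes "f \<in> balanced"
  shows "lift (\<lambda>_. c) f = 0"
proof -
  have "lift (\<lambda>_. c) (combination l) = 0" for l :: "(real \<times> 'a \<times> 'a) list"
    unfolding lift_combination by (induction l) auto
  then show ?thesis using assms by (auto simp: balanced_def)
qed

lemma lift_diff_fun:
  "lift (\<lambda>x. F x - G x) f = lift F f - lift G f"
  by (simp add: lift_def scaleR_diff_right sum_subtractf)

lemma sum_apply_fun: "(\<Sum>x\<in>S. F x) y = (\<Sum>x\<in>S. F x y)" for F :: "'a \<Rightarrow> 'b \<Rightarrow> real"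
  by (induction S rule: infinite_finite_induct) auto

lemma lift_point_mass:
  assumes "finite {x. f x \<noteq> 0}"
  shows "lift point_mass f = f"
proof
  fix y
  have "lift point_mass f y = (\<Sum>x | f x \<noteq> 0. if x = y then f x else 0)"
    unfolding lift_def sum_apply_fun by (intro sum.cong) (auto simp: scaleR_fun_def point_mass_def)
  then show "lift point_mass f y = f y" using assms by simp
qed

lemma push_combination:
  "push r (combination l) = combination (map (\<lambda>(a, x, y). (a, r x, r y)) l)"
proof -
  have "(\<Sum>(a, x, y)\<leftarrow>l. a *\<^sub>R (point_mass (r x) - point_mass (r y)))
      = combination (map (\<lambda>(a, x, y). (a, r x, r y)) l)"
    by (induction l) (auto simp: dipole_def simp del: pointwise)
  then show ?thesis unfolding push_def lift_combination .
qed

lemma push_balanced: "f \<in> balanced \<Longrightarrow> push r f \<in> balanced"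
  by (auto simp: balanced_def push_combination)

lemma push_add: "f \<in> balanced \<Longrightarrow> g \<in> balanced \<Longrightarrow> push r (f + g) = push r f + push r g"
  by (simp add: push_def lift_add finite_support)

lemma push_scale: "push r (t *\<^sub>R f) = t *\<^sub>R push r f"
  by (simp add: push_def lift_scale)

lemma push_sum:
  assumes "\<And>i. i \<in> I \<Longrightarrow> f i \<in> balanced"
  shows "push r (\<Sum>i\<in>I. a i *\<^sub>R f i) = (\<Sum>i\<in>I. a i *\<^sub>R push r (f i))"
  using assms
proof (induction I rule: infinite_finite_induct)
  case (insert i I)
  have "(\<Sum>i\<in>I. a i *\<^sub>R f i) \<in> balanced" "a i *\<^sub>R f i \<in> balanced"
    using insert by (auto intro!: balanced_sum balanced_scale)
  then show ?case using insert by (simp add: push_add push_scale del: pointwise)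
qed (auto simp: push_def lift_zero simp del: pointwise)

lemma push_cong:
  "(\<And>x. f x \<noteq> 0 \<Longrightarrow> r x = r' x) \<Longrightarrow> push r f = push r' f"
  unfolding push_def lift_def by (intro sum.cong) auto

lemma push_diff:
  assumes "f \<in> balanced"
  shows "push r' f - push r f = (\<Sum>x | f x \<noteq> 0. f x *\<^sub>R dipole (r' x) (r x))"
  unfolding push_def lift_diff_fun[symmetric] by (simp add: lift_def dipole_def)

lemma push_id: "f \<in> balanced \<Longrightarrow> push (\<lambda>x. x) f = f"
  by (simp add: push_def lift_point_mass finite_support)

lemma push_const: "f \<in> balanced \<Longrightarrow> push (\<lambda>x. e) f = 0"
  by (simp add: push_def lift_const)

text \<open>The plan moves every point mass separately from \<open>r x\<close> to
  \<open>r' x\<close>. All later estimates of rounding errors use this plan.\<close>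

lemma transport_push_diff_le:
  assumes "f \<in> balanced" "0 < p" "\<And>x y. 0 \<le> c x y"
  shows "transport p c (push r' f - push r f) \<le> (\<Sum>x | f x \<noteq> 0. \<bar>f x\<bar> powr p * c (r' x) (r x))"
proof -
  interpret p_seminorm p balanced "transport p c" by (rule p_seminorm_transport[OF assms(2,3)])
  have "transport p c (push r' f - push r f)
      \<le> (\<Sum>x | f x \<noteq> 0. \<bar>f x\<bar> powr p * transport p c (dipole (r' x) (r x)))"
    unfolding push_diff[OF assms(1)] by (rule sum_le) simp
  also have "\<dots> \<le> (\<Sum>x | f x \<noteq> 0. \<bar>f x\<bar> powr p * c (r' x) (r x))"
    by (intro sum_mono mult_left_mono transport_dipole_le assms(3)) auto
  finally show ?thesis .
qed

lemma transport_diff_push_le: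
  assumes "f \<in> balanced" "0 < p" "\<And>x y. 0 \<le> c x y"
  shows "transport p c (f - push r f) \<le> (\<Sum>x | f x \<noteq> 0. \<bar>f x\<bar> powr p * c x (r x))"
  using transport_push_diff_le[where c = c and r' = "\<lambda>x. x" and r = r, OF assms] by (simp add: push_id[OF assms(1)])

section \<open>The mass seminorm\<close>

lemma mass_eq_sum:
  assumes "finite S" "{x. f x \<noteq> 0} \<subseteq> S"
  shows "mass p f = (\<Sum>x\<in>S. \<bar>f x\<bar> powr p)"
  unfolding mass_def using assms by (intro sum.mono_neutral_left) auto

lemma mass_nonneg: "0 \<le> mass p f"
  by (simp add: mass_def sum_nonneg)

lemma p_seminorm_mass:
  assumes "0 < p" "p \<le> 1"
  shows "p_seminorm p balanced (mass p)"
proof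
  show "mass p (f + g) \<le> mass p f + mass p g" if "f \<in> balanced" "g \<in> balanced" for f g :: "'a \<Rightarrow> real"
  proof -
    let ?S = "{x. f x \<noteq> 0} \<union> {x. g x \<noteq> 0}"
    have S: "finite ?S" "{x. f x \<noteq> 0} \<subseteq> ?S" "{x. g x \<noteq> 0} \<subseteq> ?S" "{x. (f + g) x \<noteq> 0} \<subseteq> ?S"
      using that finite_support by auto
    have "\<bar>f x + g x\<bar> powr p \<le> \<bar>f x\<bar> powr p + \<bar>g x\<bar> powr p" for x
    proof -
      have "\<bar>f x + g x\<bar> powr p \<le> (\<bar>f x\<bar> + \<bar>g x\<bar>) powr p"
        using assms by (intro powr_mono2) auto
      also have "\<dots> \<le> \<bar>f x\<bar> powr p + \<bar>g x\<bar> powr p"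
        using assms by (intro powr_add_le_add_powr) auto
      finally show ?thesis .
    qed
    then show ?thesis
      unfolding mass_eq_sum[OF S(1,2)] mass_eq_sum[OF S(1,3)] mass_eq_sum[OF S(1,4)]
        sum.distrib[symmetric] by (intro sum_mono) simp
  qed
  show "mass p (t *\<^sub>R f) = \<bar>t\<bar> powr p * mass p f" for f :: "'a \<Rightarrow> real" and t
    using assms by (cases "t = 0") (auto simp: mass_def scaleR_fun_def sum_distrib_left abs_mult powr_mult)
qed (use assms subspace_balanced mass_nonneg in auto)

lemma mass_dipole_le: "mass p (dipole x y) \<le> 2"
proof (cases "x = y")
  case False
  have "mass p (dipole x y) = (\<Sum>z\<in>{x, y}. \<bar>dipole x y z\<bar> powr p)"
    by (rule mass_eq_sum) (auto simp: dipole_def point_mass_def)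
  also have "\<dots> = 2" using False by (auto simp: dipole_def point_mass_def)
  finally show ?thesis by simp
qed (simp add: dipole_def mass_def)

text \<open>A dipole has mass at most 2, and mass is subadditive. The cost with constant 1 counts
  the weighted edges.\<close>

lemma mass_combination_le:
  assumes "0 < p" "p \<le> 1"
  shows "mass p (combination l) \<le> 2 * cost p (\<lambda>x y. 1) l"
proof (induction l)
  case (Cons e l)
  obtain a x y where e: "e = (a, x, y)" by (cases e)
  interpret p_seminorm p balanced "mass p :: ('a \<Rightarrow> real) \<Rightarrow> real" by (rule p_seminorm_mass[OF assms])
  have "mass p (combination (e # l)) \<le> mass p (a *\<^sub>R dipole x y) + mass p (combination l)"
    using triangle[OF balanced_scale[OF dipole_balanced] combination_balanced]
    by (simp add: e)
  also have "mass p (a *\<^sub>R dipole x y) \<le> \<bar>a\<bar> powr p * 2"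
    unfolding scale[OF dipole_balanced] by (intro mult_left_mono mass_dipole_le) auto
  finally show ?case using Cons by (simp add: e del: pointwise)
qed (simp add: mass_def)

lemma transport_le_mass:
  assumes "f \<in> balanced" "0 < p" "\<And>x y. 0 \<le> c x y" "\<And>x y. c x y \<le> 1"
  shows "transport p c f \<le> mass p f"
proof -
  \<comment> \<open>Everything is sent to one arbitrary point, where a function of total sum 0
    cancels.\<close>
  have "transport p c (f - push (\<lambda>_. undefined) f) \<le> (\<Sum>x | f x \<noteq> 0. \<bar>f x\<bar> powr p * c x undefined)"
    by (rule transport_diff_push_le[OF assms(1-3)])
  also have "\<dots> \<le> (\<Sum>x | f x \<noteq> 0. \<bar>f x\<bar> powr p * 1)"
    using assms(4) by (intro sum_mono mult_left_mono) auto
  finally show ?thesis by (simp add: push_const[OF assms(1)] mass_def)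
qed

text \<open>Averaging over \<open>\<theta>\<close>: the \<open>i\<close>-th condition holds with probability at most \<open>d i / (B - A)\<close>.\<close>
lemma exists_below_average:
  fixes l d w :: "'i \<Rightarrow> real"
  assumes "finite I" "\<And>i. i \<in> I \<Longrightarrow> 0 \<le> w i" "\<And>i. i \<in> I \<Longrightarrow> 0 \<le> d i" "A < B" "0 < e"
  shows "\<exists>\<theta>\<in>{A..B}. (\<Sum>i\<in>I. w i * of_bool (l i \<le> \<theta> \<and> \<theta> \<le> l i + d i))
    \<le> (\<Sum>i\<in>I. w i * d i) / (B - A) + e"
\<comment> \<open>The pointwise inequality is integrated over \<open>{A..B}\<close>; the slack
  \<open>e\<close> makes the resulting inequality between integrals contradictory.\<close>
proof (rule ccontr)
  define m where "m = (\<Sum>i\<in>I. w i * d i) / (B - A) + e"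
  define J where "J i = {A..B} \<inter> {l i..l i + d i}" for i
  assume "\<not> ?thesis"
  then have gt: "m < (\<Sum>i\<in>I. w i * of_bool (l i \<le> \<theta> \<and> \<theta> \<le> l i + d i))" if "\<theta> \<in> {A..B}" for \<theta>
    using that by (auto simp: m_def not_le)
  have fin: "emeasure lborel (J i) < \<infinity>" for i
    unfolding J_def using emeasure_compact_finite[of "{A..B} \<inter> {l i..l i + d i}"] by (simp add: compact_Int)
  have [measurable]: "J i \<in> sets lborel" for i by (auto simp: J_def)
  have int: "integrable lborel (\<lambda>\<theta>. w i * indicator (J i) \<theta>)" for i
    using fin by (intro integrable_mult_right) (auto simp: J_def)
  have "m * (B - A) = (\<integral>\<theta>. m * indicator {A..B} \<theta> \<partial>lborel)" using assms(4) by simp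
  also have "\<dots> \<le> (\<integral>\<theta>. (\<Sum>i\<in>I. w i * indicator (J i) \<theta>) \<partial>lborel)"
  proof (rule integral_mono)
    show "m * indicator {A..B} \<theta> \<le> (\<Sum>i\<in>I. w i * indicator (J i) \<theta>)" for \<theta>
    proof (cases "\<theta> \<in> {A..B}")
      case True
      then have "(\<Sum>i\<in>I. w i * indicator (J i) \<theta>)
          = (\<Sum>i\<in>I. w i * of_bool (l i \<le> \<theta> \<and> \<theta> \<le> l i + d i))"
        by (intro sum.cong) (auto simp: J_def indicator_def)
      then show ?thesis using gt[OF True] True by simp
    qed (auto simp: J_def)
    show "integrable lborel (\<lambda>\<theta>. \<Sum>i\<in>I. w i * indicator (J i) \<theta>)"
      using int by (intro Bochner_Integration.integrable_sum)
    show "integrable lborel (\<lambda>\<theta>. m * indicator {A..B} \<theta>)"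
      by (intro integrable_mult_right integrable_real_indicator) (auto simp: emeasure_lborel_Icc_eq)
  qed
  also have "\<dots> = (\<Sum>i\<in>I. w i * measure lborel (J i))"
    using int by (subst Bochner_Integration.integral_sum) auto
  also have "\<dots> \<le> (\<Sum>i\<in>I. w i * d i)"
  proof (intro sum_mono mult_left_mono assms(2))
    fix i assume "i \<in> I"
    have "measure lborel (J i) \<le> measure lborel {l i..l i + d i}"
      by (rule measure_mono_fmeasurable) (auto simp: J_def fmeasurable_def emeasure_lborel_Icc_eq)
    then show "measure lborel (J i) \<le> d i" using assms(3)[OF \<open>i \<in> I\<close>] by simp
  qed
  finally have "m * (B - A) \<le> (\<Sum>i\<in>I. w i * d i)" .
  moreover have "m * (B - A) = (\<Sum>i\<in>I. w i * d i) + e * (B - A)"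
    using assms(4) by (simp add: m_def distrib_right)
  moreover have "0 < e * (B - A)" using assms(4,5) by simp
  ultimately show False by linarith
qed

section \<open>Plans supported on forests\<close>

text \<open>The graph of a concave function lies below its tangent; Young's inequality with weights
  \<open>p\<close> and \<open>1 - p\<close> for \<open>1 + x\<close> and 1 gives this
  directly.\<close>

lemma one_plus_powr_le:
  fixes x p :: real
  assumes "0 < p" "p \<le> 1" "- 1 \<le> x"
  shows "(1 + x) powr p \<le> 1 + p * x"
proof (cases "x = - 1")
  case False
  then show ?thesis
    using Youngs_inequality_0[of p "1 - p" "1 + x" 1] assms by (simp add: algebra_simps)
qed (use assms in auto)

text \<open>Independence of an indexed family, not of a set: loops and parallel edges are excluded
  as well, so the graph is a forest.\<close>

definition independent_edges :: "'i set \<Rightarrow> ('i \<Rightarrow> 'a) \<Rightarrow> ('i \<Rightarrow> 'a) \<Rightarrow> bool"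
  where "independent_edges I x y \<longleftrightarrow>
    (\<forall>\<theta>. (\<Sum>i\<in>I. \<theta> i *\<^sub>R dipole (x i) (y i)) = 0 \<longrightarrow> (\<forall>i\<in>I. \<theta> i = 0))"

lemma independent_edges_subset:
  assumes "independent_edges I x y" "J \<subseteq> I" "finite I"
  shows "independent_edges J x y"
  unfolding independent_edges_def
proof (intro allI impI ballI)
  fix \<theta> :: "_ \<Rightarrow> real" and i
  assume 0: "(\<Sum>i\<in>J. \<theta> i *\<^sub>R dipole (x i) (y i)) = 0" and i: "i \<in> J"
  define \<theta>' where "\<theta>' i = (if i \<in> J then \<theta> i else 0)" for i
  have "(\<Sum>i\<in>I. \<theta>' i *\<^sub>R dipole (x i) (y i)) = (\<Sum>i\<in>J. \<theta> i *\<^sub>R dipole (x i) (y i))"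
    using assms(2,3) by (intro sum.mono_neutral_cong_right) (auto simp: \<theta>'_def)
  then have "(\<Sum>i\<in>I. \<theta>' i *\<^sub>R dipole (x i) (y i)) = 0" using 0 by simp
  then have "\<forall>i\<in>I. \<theta>' i = 0" using assms(1) unfolding independent_edges_def by blast
  then have "\<theta>' i = 0" using i assms(2) by blast
  then show "\<theta> i = 0" using i by (simp add: \<theta>'_def)
qed

lemma combination_eq_sum:
  "combination l = (\<Sum>i<length l. fst (l ! i) *\<^sub>R dipole (fst (snd (l ! i))) (snd (snd (l ! i))))"
  unfolding combination_def by (simp add: sum_list_sum_nth lessThan_atLeast0 case_prod_beta)

lemma cost_eq_sum:
  "cost p c l = (\<Sum>i<length l. \<bar>fst (l ! i)\<bar> powr p * c (fst (snd (l ! i))) (snd (snd (l ! i))))"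
  unfolding cost_def by (simp add: sum_list_sum_nth lessThan_atLeast0 case_prod_beta)

text \<open>
  Moving the coefficients along a linear dependency of the edges, in the direction in which the
  derivative of the cost is nonpositive, does not increase the cost because \<open>t \<mapsto> t powr p\<close> is
  concave. The motion is stopped when a coefficient vanishes. Hence a plan with a minimal number
  of edges is linearly independent, that is, a forest.
\<close>
lemma exists_independent_plan:
  fixes f :: "'a \<Rightarrow> real"
  assumes p: "0 < p" "p \<le> 1" and c: "\<And>x y. 0 \<le> c x y" and l: "combination l = f"
  obtains I :: "nat set" and a x y where "finite I" "f = (\<Sum>i\<in>I. a i *\<^sub>R dipole (x i) (y i))"
    "(\<Sum>i\<in>I. \<bar>a i\<bar> powr p * c (x i) (y i)) \<le> cost p c l" "independent_edges I x y"
proof -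
  define P where "P n \<longleftrightarrow> (\<exists>(I :: nat set) a x y. finite I \<and> card I = n \<and>
      f = (\<Sum>i\<in>I. a i *\<^sub>R dipole (x i) (y i)) \<and>
      (\<Sum>i\<in>I. \<bar>a i\<bar> powr p * c (x i) (y i)) \<le> cost p c l)" for n
  have "P (length l)"
    unfolding P_def using l
    by (intro exI[of _ "{..<length l}"] exI[of _ "\<lambda>i. fst (l ! i)"]
        exI[of _ "\<lambda>i. fst (snd (l ! i))"] exI[of _ "\<lambda>i. snd (snd (l ! i))"])
      (simp add: combination_eq_sum cost_eq_sum)
  then have "P (LEAST n. P n)" by (rule LeastI)
  then obtain I :: "nat set" and a x y where I: "finite I" "card I = (LEAST n. P n)"
      "f = (\<Sum>i\<in>I. a i *\<^sub>R dipole (x i) (y i))"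
      "(\<Sum>i\<in>I. \<bar>a i\<bar> powr p * c (x i) (y i)) \<le> cost p c l"
    unfolding P_def by blast
  have minimal: False if j: "j \<in> I" "a' j = 0" "f = (\<Sum>i\<in>I. a' i *\<^sub>R dipole (x i) (y i))"
      "(\<Sum>i\<in>I. \<bar>a' i\<bar> powr p * c (x i) (y i)) \<le> cost p c l" for a' j
  proof -
    have "f = (\<Sum>i\<in>I - {j}. a' i *\<^sub>R dipole (x i) (y i))"
      using j(2,3) I(1) by (subst j(3)) (intro sum.mono_neutral_right; auto)
    moreover have "(\<Sum>i\<in>I - {j}. \<bar>a' i\<bar> powr p * c (x i) (y i)) \<le> cost p c l"
    proof -
      have "(\<Sum>i\<in>I - {j}. \<bar>a' i\<bar> powr p * c (x i) (y i)) \<le> (\<Sum>i\<in>I. \<bar>a' i\<bar> powr p * c (x i) (y i))"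
        using I(1) c by (intro sum_mono2) auto
      then show ?thesis using j(4) by simp
    qed
    ultimately have "P (card (I - {j}))" unfolding P_def using I(1) by blast
    then have "card I \<le> card (I - {j})" unfolding I(2) by (rule Least_le)
    then show False using card_Diff1_less[OF I(1) j(1)] by simp
  qed
  have a0: "a i \<noteq> 0" if "i \<in> I" for i using minimal[OF that _ I(3,4)] by blast
  have "independent_edges I x y"
  proof (rule ccontr)
    assume "\<not> ?thesis"
    then obtain \<theta>0 i0 where \<theta>0: "(\<Sum>i\<in>I. \<theta>0 i *\<^sub>R dipole (x i) (y i)) = 0" "i0 \<in> I" "\<theta>0 i0 \<noteq> 0"
      by (auto simp: independent_edges_def)
    \<comment> \<open>Up to the factor \<open>p\<close>, this is the derivative of the cost at
      \<open>a\<close> in the direction \<open>\<theta>\<close>.\<close>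
    define D where "D \<theta> = (\<Sum>i\<in>I. \<bar>a i\<bar> powr p * c (x i) (y i) * (\<theta> i / a i))" for \<theta>
    have D_neg: "D (\<lambda>i. - \<theta> i) = - D \<theta>" for \<theta> by (simp add: D_def sum_negf)
    \<comment> \<open>The sign of the dependency is chosen such that the cost does not grow to first
      order and some coefficient moves towards 0.\<close>
    have "\<exists>\<theta>. (\<Sum>i\<in>I. \<theta> i *\<^sub>R dipole (x i) (y i)) = 0 \<and> D \<theta> \<le> 0 \<and> (\<exists>i\<in>I. \<theta> i / a i < 0)"
    proof -
      have neg: "\<exists>i\<in>I. \<theta> i / a i < 0" if "D \<theta> < 0" for \<theta>
      proof (rule ccontr)
        assume "\<not> ?thesis"
        then have "0 \<le> D \<theta>" unfolding D_def using c by (intro sum_nonneg mult_nonneg_nonneg) auto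
        then show False using that by simp
      qed
      have 2: "(\<Sum>i\<in>I. (- \<theta>0 i) *\<^sub>R dipole (x i) (y i)) = 0"
        using \<theta>0(1) by (simp add: sum_negf)
      have "\<theta>0 i0 / a i0 \<noteq> 0" using \<theta>0(3) a0[OF \<theta>0(2)] by simp
      then consider "D \<theta>0 < 0" | "D \<theta>0 > 0" | "D \<theta>0 = 0" "\<theta>0 i0 / a i0 < 0"
        | "D \<theta>0 = 0" "- \<theta>0 i0 / a i0 < 0" by fastforce
      then show ?thesis
      proof cases
        case 1 then show ?thesis using neg[OF 1] \<theta>0(1) by (intro exI[of _ \<theta>0]) auto
      next
        case c2: 2
        then have "D (\<lambda>i. - \<theta>0 i) < 0" by (simp add: D_neg)
        from neg[OF this] show ?thesis
          using 2 less_imp_le[OF \<open>D (\<lambda>i. - \<theta>0 i) < 0\<close>] by (intro exI[of _ "\<lambda>i. - \<theta>0 i"] conjI)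
      next
        case 3 then show ?thesis using \<theta>0 by (intro exI[of _ \<theta>0]) auto
      next
        case 4
        then have "D (\<lambda>i. - \<theta>0 i) \<le> 0" by (simp add: D_neg)
        then show ?thesis using 2 4 \<theta>0(2) by (intro exI[of _ "\<lambda>i. - \<theta>0 i"]) auto
      qed
    qed
    then obtain \<theta> i1 where \<theta>: "(\<Sum>i\<in>I. \<theta> i *\<^sub>R dipole (x i) (y i)) = 0" "D \<theta> \<le> 0"
      and i1: "i1 \<in> I" "\<theta> i1 / a i1 < 0" by blast
    \<comment> \<open>The largest relative speed towards 0. At time \<open>1 / m\<close> the fastest
      coefficient vanishes, and no coefficient has changed sign before.\<close>
    define m where "m = Max ((\<lambda>i. - (\<theta> i / a i)) ` I)"
    have m_ge: "- (\<theta> i / a i) \<le> m" if "i \<in> I" for i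
      unfolding m_def using I(1) that by (intro Max_ge) auto
    have m0: "0 < m" using m_ge[OF i1(1)] i1(2) by linarith
    have "m \<in> (\<lambda>i. - (\<theta> i / a i)) ` I" unfolding m_def using I(1) i1 by (intro Max_in) auto
    then obtain j where j: "j \<in> I" "m = - (\<theta> j / a j)" by auto
    define a' where "a' i = a i + \<theta> i / m" for i
    have a'_eq: "a' i = a i * (1 + (\<theta> i / a i) / m)" if "i \<in> I" for i
      using a0[OF that] m0 by (simp add: a'_def field_simps)
    have ge: "- 1 \<le> (\<theta> i / a i) / m" if "i \<in> I" for i
      using m_ge[OF that] m0 unfolding pos_le_divide_eq[OF m0] by simp
    show False
    proof (rule minimal[OF j(1), of a'])
      have "\<theta> j / a j = - m" using j(2) by simp
      then show "a' j = 0" using a'_eq[OF j(1)] m0 by simp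
      have "(\<Sum>i\<in>I. a' i *\<^sub>R dipole (x i) (y i))
          = f + (1 / m) *\<^sub>R (\<Sum>i\<in>I. \<theta> i *\<^sub>R dipole (x i) (y i))"
        unfolding I(3) scaleR_sum_right sum.distrib[symmetric]
        by (intro sum.cong) (auto simp: a'_def scaleR_add_left)
      then show "f = (\<Sum>i\<in>I. a' i *\<^sub>R dipole (x i) (y i))" using \<theta>(1) by simp
      have "(\<Sum>i\<in>I. \<bar>a' i\<bar> powr p * c (x i) (y i))
          \<le> (\<Sum>i\<in>I. \<bar>a i\<bar> powr p * c (x i) (y i)
              + (p / m) * (\<bar>a i\<bar> powr p * c (x i) (y i) * (\<theta> i / a i)))"
      proof (rule sum_mono)
        fix i assume i: "i \<in> I"
        have "\<bar>a' i\<bar> powr p = \<bar>a i\<bar> powr p * (1 + (\<theta> i / a i) / m) powr p"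
          unfolding a'_eq[OF i] using ge[OF i] by (simp add: abs_mult powr_mult)
        also have "\<dots> \<le> \<bar>a i\<bar> powr p * (1 + p * ((\<theta> i / a i) / m))"
          using one_plus_powr_le[OF p ge[OF i]] by (intro mult_left_mono) auto
        finally have "\<bar>a' i\<bar> powr p * c (x i) (y i)
            \<le> \<bar>a i\<bar> powr p * (1 + p * ((\<theta> i / a i) / m)) * c (x i) (y i)"
          by (rule mult_right_mono) (rule c)
        then show "\<bar>a' i\<bar> powr p * c (x i) (y i) \<le> \<bar>a i\<bar> powr p * c (x i) (y i)
            + (p / m) * (\<bar>a i\<bar> powr p * c (x i) (y i) * (\<theta> i / a i))"
          by (simp add: algebra_simps)
      qed
      also have "\<dots> = (\<Sum>i\<in>I. \<bar>a i\<bar> powr p * c (x i) (y i)) + (p / m) * D \<theta>"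
        by (simp add: sum.distrib D_def sum_distrib_left)
      also have "\<dots> \<le> (\<Sum>i\<in>I. \<bar>a i\<bar> powr p * c (x i) (y i))"
        using mult_nonneg_nonpos[OF _ \<theta>(2), of "p / m"] p m0 by simp
      finally show "(\<Sum>i\<in>I. \<bar>a' i\<bar> powr p * c (x i) (y i)) \<le> cost p c l" using I(4) by simp
    qed
  qed
  then show ?thesis using that I by blast
qed

text \<open>All dipoles lie in the span of the dipoles to one fixed vertex, so independence forces
  fewer edges than vertices. The degrees add up to twice the number of edges, hence some vertex has
  degree 1.\<close>

lemma independent_edges_leaf:
  assumes ind: "independent_edges I x y" and I: "finite I" "I \<noteq> {}"
  obtains j v w where "j \<in> I" "v \<noteq> w" "x j = v \<and> y j = w \<or> x j = w \<and> y j = v"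
    "\<And>i. i \<in> I \<Longrightarrow> i \<noteq> j \<Longrightarrow> x i \<noteq> v \<and> y i \<noteq> v"
proof -
  define b where "b i = dipole (x i) (y i)" for i
  have ind': "\<theta> i = 0" if "(\<Sum>i\<in>I. \<theta> i *\<^sub>R b i) = 0" "i \<in> I" for \<theta> i
    using ind that unfolding independent_edges_def b_def by blast
  have xy: "x i \<noteq> y i" if i: "i \<in> I" for i
  proof
    assume "x i = y i"
    then have "(\<Sum>k\<in>I. (if k = i then 1 else 0) *\<^sub>R b k) = 0"
      using I(1) i by (subst sum.remove[OF _ i]) (auto simp: b_def dipole_def)
    from ind'[OF this i] show False by simp
  qed
  have inj: "inj_on b I"
  proof (rule inj_onI, rule ccontr)
    fix i k assume ik: "i \<in> I" "k \<in> I" "b i = b k" "i \<noteq> k"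
    define \<theta> where "\<theta> j = (if j = i then 1 else if j = k then - 1 else 0 :: real)" for j
    have "(\<Sum>j\<in>I. \<theta> j *\<^sub>R b j) = (\<Sum>j\<in>{i, k}. \<theta> j *\<^sub>R b j)"
      using ik I(1) by (intro sum.mono_neutral_right) (auto simp: \<theta>_def)
    also have "\<dots> = 0" using ik by (simp add: \<theta>_def)
    finally have "\<theta> i = 0" using ind' ik(1) by blast
    then show False by (simp add: \<theta>_def)
  qed
  have indep: "independent (b ` I)"
  proof
    assume "dependent (b ` I)"
    then obtain u v where u: "v \<in> b ` I" "u v \<noteq> 0" "(\<Sum>v\<in>b ` I. u v *\<^sub>R v) = 0"
      using I(1) by (auto simp: dependent_finite)
    then have "(\<Sum>i\<in>I. u (b i) *\<^sub>R b i) = 0" by (simp add: sum.reindex[OF inj])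
    from ind'[OF this] u(1,2) show False by auto
  qed
  define S where "S = x ` I \<union> y ` I"
  have S: "finite S" using I by (simp add: S_def)
  obtain v0 where v0: "v0 \<in> S" using I(2) by (auto simp: S_def)
  have "b ` I \<subseteq> span ((\<lambda>v. dipole v v0) ` (S - {v0}))"
  proof
    have sp: "dipole v v0 \<in> span ((\<lambda>v. dipole v v0) ` (S - {v0}))" if "v \<in> S" for v
    proof (cases "v = v0")
      case True
      then have "dipole v v0 = 0" by (simp add: dipole_def)
      then show ?thesis by (simp only: span_zero)
    qed (use that in \<open>auto intro!: span_base\<close>)
    fix u assume "u \<in> b ` I"
    then obtain i where i: "i \<in> I" "u = dipole (x i) v0 - dipole (y i) v0"
      by (auto simp: b_def dipole_def)
    show "u \<in> span ((\<lambda>v. dipole v v0) ` (S - {v0}))"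
      unfolding i(2) using i(1) by (intro span_diff sp) (auto simp: S_def)
  qed
  from independent_span_bound[OF _ indep this] have "card (b ` I) \<le> card ((\<lambda>v. dipole v v0) ` (S - {v0}))"
    using S by blast
  also have "\<dots> \<le> card (S - {v0})" using S by (intro card_image_le) auto
  also have "\<dots> < card S" using S v0 by (intro card_Diff1_less)
  finally have less: "card I < card S" by (simp add: card_image[OF inj])
  define E where "E v = {i\<in>I. x i = v \<or> y i = v}" for v
  have E: "finite (E v)" for v using I(1) by (simp add: E_def)
  have "(\<Sum>v\<in>S. card (E v)) = (\<Sum>v\<in>S. \<Sum>i\<in>I. of_bool (x i = v \<or> y i = v))"
  proof (rule sum.cong[OF refl])
    fix v
    have "E v = I \<inter> {i. x i = v \<or> y i = v}" by (auto simp: E_def)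
    then show "card (E v) = (\<Sum>i\<in>I. of_bool (x i = v \<or> y i = v))"
      by (simp only: sum_of_bool_eq[OF I(1) I(1)] of_nat_id)
  qed
  also have "\<dots> = (\<Sum>i\<in>I. \<Sum>v\<in>S. of_bool (x i = v \<or> y i = v))" by (rule sum.swap)
  also have "\<dots> = (\<Sum>i\<in>I. 2)"
  proof (rule sum.cong[OF refl])
    fix i assume i: "i \<in> I"
    have "(\<Sum>v\<in>S. of_bool (x i = v \<or> y i = v)) = (\<Sum>v\<in>{x i, y i}. (1::nat))"
      using i S by (intro sum.mono_neutral_cong_right) (auto simp: S_def)
    then show "(\<Sum>v\<in>S. of_bool (x i = v \<or> y i = v)) = (2::nat)" using xy[OF i] by simp
  qed
  finally have deg: "(\<Sum>v\<in>S. card (E v)) = 2 * card I" by simp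
  have "\<exists>v\<in>S. card (E v) < 2"
  proof (rule ccontr)
    assume "\<not> ?thesis"
    then have "(\<Sum>v\<in>S. 2) \<le> (\<Sum>v\<in>S. card (E v))" by (intro sum_mono) auto
    then show False using deg less by simp
  qed
  then obtain v where v: "v \<in> S" "card (E v) < 2" by blast
  have "E v \<noteq> {}" using v(1) by (auto simp: S_def E_def)
  then have "card (E v) = 1" using v(2) E[of v] by (simp add: less_2_cases_iff)
  then obtain j where j: "E v = {j}" by (auto simp: card_1_singleton_iff)
  then have jI: "j \<in> I" "x j = v \<or> y j = v" by (auto simp: E_def)
  have other: "x i \<noteq> v \<and> y i \<noteq> v" if "i \<in> I" "i \<noteq> j" for i
    using j that by (auto simp: E_def)
  show ?thesis
  proof (cases "x j = v")
    case True then show ?thesis using that[of j v "y j"] jI(1) xy[OF jI(1)] other by auto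
  next
    case False then show ?thesis using that[of j v "x j"] jI xy[OF jI(1)] other by auto
  qed
qed

section \<open>Interpolation\<close>

locale pseudometric =
  fixes \<rho> :: "'a \<Rightarrow> 'a \<Rightarrow> real"
  assumes self [simp]: "\<rho> x x = 0"
    and commute: "\<rho> x y = \<rho> y x"
    and triangle: "\<rho> x z \<le> \<rho> x y + \<rho> y z"
begin

lemma nonneg [simp]: "0 \<le> \<rho> x y"
  using triangle[of x x y] commute[of x y] by simp

text \<open>
  Root the forest, let \<open>h\<close> be the height and cut it at the heights \<open>U + k * s\<close>; then \<open>r\<close> collapses
  every piece to its lowest vertex. The forest metric dominates \<open>\<rho>\<close>.
\<close>
lemma forest_collapse:
  assumes "finite I" "independent_edges I x y" "0 < s"
  shows "\<exists>h. \<forall>U. \<exists>r. (\<forall>v. \<rho> v (r v) \<le> s * frac ((h v - U) / s)) \<and>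
    (\<forall>i\<in>I. r (x i) = r (y i) \<or>
      \<lfloor>(h (x i) - U) / s\<rfloor> \<noteq> \<lfloor>(h (y i) - U) / s\<rfloor> \<and> \<bar>h (x i) - h (y i)\<bar> = \<rho> (x i) (y i))"
  using assms(1,2)
proof (induction "card I" arbitrary: I)
  case 0
  then have "I = {}" by simp
  then show ?case using assms(3) by (auto intro!: exI[of _ "\<lambda>v. v"])
next
  case (Suc n)
  then have "I \<noteq> {}" by auto
  then obtain j v w where j: "j \<in> I" "v \<noteq> w" "x j = v \<and> y j = w \<or> x j = w \<and> y j = v"
      "\<And>i. i \<in> I \<Longrightarrow> i \<noteq> j \<Longrightarrow> x i \<noteq> v \<and> y i \<noteq> v"
    by (rule independent_edges_leaf[OF Suc.prems(2,1)]) blast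
  have "n = card (I - {j})" using Suc.hyps(2) j(1) Suc.prems(1) by simp
  from Suc.hyps(1)[OF this _ independent_edges_subset[OF Suc.prems(2)]] Suc.prems(1)
  obtain h where h: "\<And>U. \<exists>r. (\<forall>v. \<rho> v (r v) \<le> s * frac ((h v - U) / s)) \<and>
    (\<forall>i\<in>I - {j}. r (x i) = r (y i) \<or>
      \<lfloor>(h (x i) - U) / s\<rfloor> \<noteq> \<lfloor>(h (y i) - U) / s\<rfloor> \<and> \<bar>h (x i) - h (y i)\<bar> = \<rho> (x i) (y i))"
    by blast
  \<comment> \<open>The leaf \<open>v\<close> is attached above its neighbour \<open>w\<close>, at
    the distance given by \<open>\<rho>\<close>.\<close>
  define h' where "h' = h(v := h w + \<rho> v w)"
  have "\<exists>r. (\<forall>v. \<rho> v (r v) \<le> s * frac ((h' v - U) / s)) \<and>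
    (\<forall>i\<in>I. r (x i) = r (y i) \<or>
      \<lfloor>(h' (x i) - U) / s\<rfloor> \<noteq> \<lfloor>(h' (y i) - U) / s\<rfloor> \<and> \<bar>h' (x i) - h' (y i)\<bar> = \<rho> (x i) (y i))" for U
  proof -
    obtain r where r: "\<And>v. \<rho> v (r v) \<le> s * frac ((h v - U) / s)"
      "\<And>i. i \<in> I - {j} \<Longrightarrow> r (x i) = r (y i) \<or>
      \<lfloor>(h (x i) - U) / s\<rfloor> \<noteq> \<lfloor>(h (y i) - U) / s\<rfloor> \<and> \<bar>h (x i) - h (y i)\<bar> = \<rho> (x i) (y i)"
      using h[of U] by blast
    \<comment> \<open>If no cut separates \<open>v\<close> from \<open>w\<close>, then
      \<open>v\<close> inherits the representative of \<open>w\<close>; otherwise \<open>v\<close>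
      starts a new piece and represents itself. Bounding the distance to the representative by the
      height above the last cut, rather than by \<open>s\<close>, makes the induction work: without
      a cut, both sides grow by \<open>\<rho> v w\<close>.\<close>
    define same where "same \<longleftrightarrow> \<lfloor>(h w + \<rho> v w - U) / s\<rfloor> = \<lfloor>(h w - U) / s\<rfloor>"
    define r' where "r' = r(v := if same then r w else v)"
    have "\<rho> u (r' u) \<le> s * frac ((h' u - U) / s)" for u
    proof (cases "u = v \<and> same")
      case True
      have "\<rho> v (r w) \<le> \<rho> v w + s * frac ((h w - U) / s)" using triangle[of v "r w" w] r(1)[of w] by simp
      also have "\<dots> = s * frac ((h w + \<rho> v w - U) / s)"
        using True assms(3) unfolding same_def frac_def by (simp add: field_simps)
      finally show ?thesis using True by (simp add: r'_def h'_def)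
    next
      case False
      then show ?thesis using r(1)[of u] assms(3) frac_ge_0 by (auto simp: r'_def h'_def)
    qed
    moreover have "r' (x i) = r' (y i) \<or>
      \<lfloor>(h' (x i) - U) / s\<rfloor> \<noteq> \<lfloor>(h' (y i) - U) / s\<rfloor> \<and> \<bar>h' (x i) - h' (y i)\<bar> = \<rho> (x i) (y i)"
      if "i \<in> I" for i
    proof (cases "i = j")
      case False
      then show ?thesis using r(2)[of i] j(4)[OF that] that by (simp add: r'_def h'_def)
    next
      case True
      then show ?thesis using j(2,3) commute[of v w]
        by (auto simp: r'_def h'_def same_def)
    qed
    ultimately show ?thesis by (intro exI[of _ r']) blast
  qed
  then show ?case by blast
qed

text \<open>A cut between \<open>lo\<close> and \<open>hi\<close> at \<open>U + k * s\<close> means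
  that \<open>U\<close> lies in an interval of length \<open>hi - lo\<close>. As \<open>U\<close>
  ranges over one period and \<open>hi - lo < s\<close>, only two values of \<open>k\<close> are
  possible. This is the form that averaging over \<open>U\<close> needs.\<close>

lemma floor_shift_neq:
  fixes lo hi U s :: real
  assumes "0 < s" "lo \<le> hi" "hi < lo + s" "0 \<le> U" "U \<le> s" "\<lfloor>(lo - U) / s\<rfloor> \<noteq> \<lfloor>(hi - U) / s\<rfloor>"
  shows "\<exists>b\<in>{0, 1 :: int}. lo - (\<lfloor>lo / s\<rfloor> + b) * s \<le> U \<and> U \<le> lo - (\<lfloor>lo / s\<rfloor> + b) * s + (hi - lo)"
proof -
  define k where "k = \<lfloor>(hi - U) / s\<rfloor>"
  have "\<lfloor>(lo - U) / s\<rfloor> \<le> k"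
    unfolding k_def using assms(1,2) by (intro floor_mono divide_right_mono) auto
  then have "\<lfloor>(lo - U) / s\<rfloor> < k" using assms(6) by (simp add: k_def)
  then have "(lo - U) / s < k" by (simp add: floor_less_iff)
  then have 1: "lo - U < k * s" using assms(1) by (simp add: pos_divide_less_eq)
  have "k \<le> (hi - U) / s" by (simp add: k_def)
  then have 2: "k * s \<le> hi - U" using assms(1) by (simp add: pos_le_divide_eq)
  have "\<lfloor>lo / s\<rfloor> \<le> lo / s" by simp
  then have 3: "\<lfloor>lo / s\<rfloor> * s \<le> lo" using assms(1) by (simp only: pos_le_divide_eq)
  have "lo / s < \<lfloor>lo / s\<rfloor> + 1" by linarith
  then have 4: "lo < (\<lfloor>lo / s\<rfloor> + 1) * s" using assms(1) by (simp only: pos_divide_less_eq)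
  have "(\<lfloor>lo / s\<rfloor> - 1) * s < k * s" using 1 3 assms(5) by (simp add: algebra_simps)
  then have "real_of_int (\<lfloor>lo / s\<rfloor> - 1) < k" using assms(1) by (simp add: mult_less_cancel_right)
  then have k1: "\<lfloor>lo / s\<rfloor> \<le> k" by linarith
  have "k * s < (\<lfloor>lo / s\<rfloor> + 2) * s" using 2 4 assms(3,4) by (simp add: algebra_simps)
  then have "k < real_of_int (\<lfloor>lo / s\<rfloor> + 2)" using assms(1) by (simp add: mult_less_cancel_right)
  then have k2: "k \<le> \<lfloor>lo / s\<rfloor> + 1" by linarith
  have "k - \<lfloor>lo / s\<rfloor> \<in> {0, 1}" using k1 k2 by auto
  moreover have "lo - (\<lfloor>lo / s\<rfloor> + (k - \<lfloor>lo / s\<rfloor>)) * s \<le> U \<and>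
      U \<le> lo - (\<lfloor>lo / s\<rfloor> + (k - \<lfloor>lo / s\<rfloor>)) * s + (hi - lo)" using 1 2 by simp
  ultimately show ?thesis by blast
qed

text \<open>Collapsing the pieces moves every point by at most \<open>s\<close>, which costs
  \<open>s powr \<alpha>\<close> per unit of mass. Afterwards a short edge of length
  \<open>d\<close> costs at most \<open>(3 * s) powr \<alpha>\<close>, and only if it is cut, which
  has probability at most \<open>2 * d / s\<close>; this is the origin of \<open>6 = 2 * 3\<close>.
  A long edge costs at most
  \<open>(3 * d) powr \<alpha> \<le> 3 * s powr (\<alpha> - 1) * d\<close>, cut or not.\<close>

theorem transport_powr_le:
  assumes p: "0 < p" "p \<le> 1" and \<alpha>: "0 < \<alpha>" "\<alpha> \<le> 1" and s: "0 < s" and f: "f \<in> balanced"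
  shows "transport p (\<lambda>x y. \<rho> x y powr \<alpha>) f
    \<le> s powr \<alpha> * mass p f + 6 * s powr (\<alpha> - 1) * transport p \<rho> f"
proof (rule field_le_epsilon)
  fix e :: real assume e: "0 < e"
  define C where "C = 6 * s powr (\<alpha> - 1)"
  have C: "0 < C" using s by (simp add: C_def)
  interpret P: p_seminorm p balanced "transport p (\<lambda>x y. \<rho> x y powr \<alpha>)"
    by (rule p_seminorm_transport[OF p(1)]) simp
  have "0 < e / 2 / C" using e C by simp
  from transport_less[OF f this, of p \<rho>]
  obtain l where l: "combination l = f" "cost p \<rho> l < transport p \<rho> f + e / 2 / C" by blast
  obtain I :: "nat set" and a x y where I: "finite I" "f = (\<Sum>i\<in>I. a i *\<^sub>R dipole (x i) (y i))"
    "(\<Sum>i\<in>I. \<bar>a i\<bar> powr p * \<rho> (x i) (y i)) \<le> cost p \<rho> l" "independent_edges I x y"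
    by (rule exists_independent_plan[where c = \<rho>, OF p nonneg l(1)])
  obtain h where h: "\<And>U. \<exists>r. (\<forall>v. \<rho> v (r v) \<le> s * frac ((h v - U) / s)) \<and>
    (\<forall>i\<in>I. r (x i) = r (y i) \<or>
      \<lfloor>(h (x i) - U) / s\<rfloor> \<noteq> \<lfloor>(h (y i) - U) / s\<rfloor> \<and> \<bar>h (x i) - h (y i)\<bar> = \<rho> (x i) (y i))"
    using forest_collapse[OF I(1,4) s] by blast
  define d where "d i = \<rho> (x i) (y i)" for i
  define lo where "lo i = min (h (x i)) (h (y i))" for i
  define l' where "l' i b = lo i - (\<lfloor>lo i / s\<rfloor> + b) * s" for i and b :: int
  define A where "A i = \<bar>a i\<bar> powr p" for i
  define J where "J = {i\<in>I. d i < s}"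
  have J: "finite J" using I(1) by (simp add: J_def)
  have A: "0 \<le> A i" for i by (simp add: A_def)
  have d: "0 \<le> d i" for i by (simp add: d_def)
  \<comment> \<open>The second component of \<open>q\<close> selects one of the two intervals of
    \<open>floor_shift_neq\<close>.\<close>
  have "\<exists>U\<in>{0..s}. (\<Sum>q\<in>J \<times> {0, 1 :: int}. (A (fst q) * (3 * s powr \<alpha>)) *
        of_bool (l' (fst q) (snd q) \<le> U \<and> U \<le> l' (fst q) (snd q) + d (fst q)))
      \<le> (\<Sum>q\<in>J \<times> {0, 1 :: int}. (A (fst q) * (3 * s powr \<alpha>)) * d (fst q)) / (s - 0) + e / 2"
    by (rule exists_below_average) (use J A d s e in auto)
  then obtain U where U: "0 \<le> U" "U \<le> s" and "(\<Sum>q\<in>J \<times> {0, 1 :: int}. (A (fst q) * (3 * s powr \<alpha>)) *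
        of_bool (l' (fst q) (snd q) \<le> U \<and> U \<le> l' (fst q) (snd q) + d (fst q)))
      \<le> (\<Sum>q\<in>J \<times> {0, 1 :: int}. (A (fst q) * (3 * s powr \<alpha>)) * d (fst q)) / s + e / 2"
    by auto
  then have avg: "(\<Sum>i\<in>J. \<Sum>b\<in>{0, 1}. (A i * (3 * s powr \<alpha>)) * of_bool (l' i b \<le> U \<and> U \<le> l' i b + d i))
      \<le> (\<Sum>i\<in>J. \<Sum>b\<in>{0, 1 :: int}. (A i * (3 * s powr \<alpha>)) * d i) / s + e / 2"
    unfolding sum.cartesian_product case_prod_beta by simp
  obtain r where r: "\<And>v. \<rho> v (r v) \<le> s * frac ((h v - U) / s)"
    "\<And>i. i \<in> I \<Longrightarrow> r (x i) = r (y i) \<or>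
      \<lfloor>(h (x i) - U) / s\<rfloor> \<noteq> \<lfloor>(h (y i) - U) / s\<rfloor> \<and> \<bar>h (x i) - h (y i)\<bar> = \<rho> (x i) (y i)"
    using h[of U] by blast
  have rs: "\<rho> v (r v) \<le> s" for v
  proof -
    have "s * frac ((h v - U) / s) \<le> s * 1"
      using frac_lt_1 s by (intro mult_left_mono less_imp_le) auto
    then show ?thesis using r(1)[of v] by simp
  qed
  have split: "t powr \<alpha> = t powr (\<alpha> - 1) * t" if "0 < t" for t
    using powr_mult_base[of t "\<alpha> - 1"] that by (simp add: mult.commute)
  have three: "3 powr \<alpha> \<le> (3 :: real)" using powr_mono[of \<alpha> 1 "3 :: real"] \<alpha> by simp
  have edge: "A i * \<rho> (r (x i)) (r (y i)) powr \<alpha> \<le> (if i \<in> J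
      then \<Sum>b\<in>{0, 1}. (A i * (3 * s powr \<alpha>)) * of_bool (l' i b \<le> U \<and> U \<le> l' i b + d i)
      else A i * (3 * s powr (\<alpha> - 1) * d i))" if i: "i \<in> I" for i
  proof -
    have le: "\<rho> (r (x i)) (r (y i)) \<le> d i + 2 * s"
      using triangle[of "r (x i)" "r (y i)" "x i"] triangle[of "x i" "r (y i)" "y i"]
        rs[of "x i"] rs[of "y i"] commute[of "r (x i)" "x i"] by (simp add: d_def)
    show ?thesis
    proof (cases "i \<in> J")
      case True
      then have di: "d i < s" by (simp add: J_def)
      show ?thesis
      proof (cases "r (x i) = r (y i)")
        case eq: True
        have "0 \<le> (\<Sum>b\<in>{0, 1}. (A i * (3 * s powr \<alpha>)) * of_bool (l' i b \<le> U \<and> U \<le> l' i b + d i))"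
          using A by (intro sum_nonneg mult_nonneg_nonneg) auto
        then show ?thesis using True eq by simp
      next
        case False
        then have cut: "\<lfloor>(h (x i) - U) / s\<rfloor> \<noteq> \<lfloor>(h (y i) - U) / s\<rfloor>" "\<bar>h (x i) - h (y i)\<bar> = d i"
          using r(2)[OF i] by (auto simp: d_def)
        have hi: "lo i + d i = max (h (x i)) (h (y i))" using cut(2) by (auto simp: lo_def)
        have "\<lfloor>(lo i - U) / s\<rfloor> \<noteq> \<lfloor>(lo i + d i - U) / s\<rfloor>"
          unfolding hi using cut(1) by (auto simp: lo_def min_def max_def)
        then have "\<exists>b\<in>{0, 1}. l' i b \<le> U \<and> U \<le> l' i b + (lo i + d i - lo i)"
          unfolding l'_def by (intro floor_shift_neq[OF s]) (use di d[of i] U in auto)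
        then obtain b where b: "b \<in> {0, 1 :: int}" "l' i b \<le> U \<and> U \<le> l' i b + d i"
          unfolding add_diff_cancel_left' by blast
        have "\<rho> (r (x i)) (r (y i)) powr \<alpha> \<le> (3 * s) powr \<alpha>"
          using le di \<alpha> by (intro powr_mono2) auto
        also have "\<dots> \<le> 3 * s powr \<alpha>" using s three by (simp add: powr_mult)
        finally have "A i * \<rho> (r (x i)) (r (y i)) powr \<alpha> \<le> A i * (3 * s powr \<alpha>)"
          using A by (intro mult_left_mono) auto
        also have "\<dots> = (A i * (3 * s powr \<alpha>)) * of_bool (l' i b \<le> U \<and> U \<le> l' i b + d i)"
          using b(2) by simp
        also have "\<dots> \<le> (\<Sum>b\<in>{0, 1}. (A i * (3 * s powr \<alpha>)) * of_bool (l' i b \<le> U \<and> U \<le> l' i b + d i))"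
          using b(1) A by (intro member_le_sum) auto
        finally show ?thesis using True by simp
      qed
    next
      case False
      then have di: "s \<le> d i" using i by (auto simp: J_def)
      have "\<rho> (r (x i)) (r (y i)) powr \<alpha> \<le> (3 * d i) powr \<alpha>"
        using le di \<alpha> by (intro powr_mono2) auto
      also have "\<dots> \<le> 3 * d i powr \<alpha>"
        using three d[of i] by (simp add: powr_mult mult_right_mono)
      also have "d i powr \<alpha> = d i powr (\<alpha> - 1) * d i" using di s by (intro split) auto
      also have "\<dots> \<le> s powr (\<alpha> - 1) * d i"
        using di s \<alpha> by (intro mult_right_mono powr_mono2') auto
      finally show ?thesis using False A by (auto intro!: mult_left_mono simp: mult.assoc)
    qed
  qed
  have pf: "push r f = (\<Sum>i\<in>I. a i *\<^sub>R dipole (r (x i)) (r (y i)))"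
  proof -
    have "push r (dipole u v) = dipole (r u) (r v)" for u v
      using push_combination[of r "[(1, u, v)]"] by simp
    then show ?thesis unfolding I(2) by (subst push_sum) auto
  qed
  have "transport p (\<lambda>x y. \<rho> x y powr \<alpha>) (push r f)
      \<le> (\<Sum>i\<in>I. A i * transport p (\<lambda>x y. \<rho> x y powr \<alpha>) (dipole (r (x i)) (r (y i))))"
    unfolding pf A_def by (rule P.sum_le) simp
  also have "\<dots> \<le> (\<Sum>i\<in>I. A i * \<rho> (r (x i)) (r (y i)) powr \<alpha>)"
    using A by (intro sum_mono mult_left_mono transport_dipole_le) auto
  also have "\<dots> \<le> (\<Sum>i\<in>I. if i \<in> J
      then \<Sum>b\<in>{0, 1}. (A i * (3 * s powr \<alpha>)) * of_bool (l' i b \<le> U \<and> U \<le> l' i b + d i)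
      else A i * (3 * s powr (\<alpha> - 1) * d i))" by (intro sum_mono edge)
  also have "\<dots> = (\<Sum>i\<in>J. \<Sum>b\<in>{0, 1}. (A i * (3 * s powr \<alpha>)) * of_bool (l' i b \<le> U \<and> U \<le> l' i b + d i))
      + (\<Sum>i\<in>I - J. A i * (3 * s powr (\<alpha> - 1) * d i))"
  proof -
    have "I \<inter> J = J" "I \<inter> - J = I - J" by (auto simp: J_def)
    then show ?thesis by (simp only: sum.If_cases[OF I(1)] Collect_mem_eq Compl_eq[symmetric])
  qed
  also have "\<dots> \<le> (\<Sum>i\<in>J. \<Sum>b\<in>{0, 1 :: int}. (A i * (3 * s powr \<alpha>)) * d i) / s + e / 2
      + (\<Sum>i\<in>I - J. C * (A i * d i))"
  proof (rule add_mono[OF avg sum_mono])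
    fix i
    have "3 * s powr (\<alpha> - 1) * (A i * d i) \<le> C * (A i * d i)"
      unfolding C_def using A d by (intro mult_right_mono) auto
    then show "A i * (3 * s powr (\<alpha> - 1) * d i) \<le> C * (A i * d i)" by (simp add: algebra_simps)
  qed
  also have "(\<Sum>i\<in>J. \<Sum>b\<in>{0, 1 :: int}. (A i * (3 * s powr \<alpha>)) * d i) / s = (\<Sum>i\<in>J. C * (A i * d i))"
    unfolding sum_divide_distrib using s
    by (intro sum.cong) (simp_all add: split[OF s] C_def)
  also have "(\<Sum>i\<in>J. C * (A i * d i)) + e / 2 + (\<Sum>i\<in>I - J. C * (A i * d i))
      = C * (\<Sum>i\<in>I. A i * d i) + e / 2"
    using sum.subset_diff[of J I "\<lambda>i. C * (A i * d i)"] I(1) by (simp add: J_def sum_distrib_left)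
  also have "\<dots> \<le> C * (transport p \<rho> f + e / 2 / C) + e / 2"
    using I(3) l(2) C unfolding A_def d_def by (intro add_mono mult_left_mono) auto
  also have "\<dots> = C * transport p \<rho> f + e" using C by (simp add: field_simps)
  finally have 1: "transport p (\<lambda>x y. \<rho> x y powr \<alpha>) (push r f) \<le> C * transport p \<rho> f + e" .
  have "transport p (\<lambda>x y. \<rho> x y powr \<alpha>) (f - push r f)
      \<le> (\<Sum>x | f x \<noteq> 0. \<bar>f x\<bar> powr p * \<rho> x (r x) powr \<alpha>)"
    by (rule transport_diff_push_le[OF f p(1)]) simp
  also have "\<dots> \<le> (\<Sum>x | f x \<noteq> 0. \<bar>f x\<bar> powr p * s powr \<alpha>)"
    using rs \<alpha> by (intro sum_mono mult_left_mono powr_mono2) auto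
  also have "\<dots> = s powr \<alpha> * mass p f" by (simp add: mass_def sum_distrib_left mult.commute)
  finally have 2: "transport p (\<lambda>x y. \<rho> x y powr \<alpha>) (f - push r f) \<le> s powr \<alpha> * mass p f" .
  have "transport p (\<lambda>x y. \<rho> x y powr \<alpha>) f
      \<le> transport p (\<lambda>x y. \<rho> x y powr \<alpha>) (f - push r f) + transport p (\<lambda>x y. \<rho> x y powr \<alpha>) (push r f)"
    using P.triangle[OF balanced_diff[OF f push_balanced[OF f, of r]] push_balanced[OF f, of r]] by simp
  then show "transport p (\<lambda>x y. \<rho> x y powr \<alpha>) f
    \<le> s powr \<alpha> * mass p f + 6 * s powr (\<alpha> - 1) * transport p \<rho> f + e"
    using 1 2 by (simp add: C_def)
qed

end

section \<open>Decomposition into scales\<close>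

lemma combination_filter:
  "combination (filter Q l) + combination (filter (\<lambda>e. \<not> Q e) l) = combination l"
  by (induction l) (auto simp: algebra_simps simp del: pointwise)

lemma cost_filter:
  "cost p c (filter Q l) + cost p c (filter (\<lambda>e. \<not> Q e) l) = cost p c l"
  by (induction l) auto

lemma cost_cong_set:
  "(\<And>a x y. (a, x, y) \<in> set l \<Longrightarrow> c x y = c' x y) \<Longrightarrow> cost p c l = cost p c' l"
  by (induction l) (auto, metis+)

lemma sum_power_inj_le:
  fixes q :: real
  assumes "finite K" "inj_on g K" "0 \<le> q" "q < 1"
  shows "(\<Sum>k\<in>K. q ^ g k) \<le> 1 / (1 - q)"
proof -
  have "(\<Sum>k\<in>K. q ^ g k) = (\<Sum>n\<in>g ` K. q ^ n)" using assms(2) by (simp add: sum.reindex)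
  also have "\<dots> \<le> (\<Sum>n. q ^ n)"
    using assms by (intro sum_le_suminf) (auto intro: summable_geometric)
  also have "\<dots> = 1 / (1 - q)" using assms by (intro suminf_geometric) auto
  finally show ?thesis .
qed

locale snowflake = pseudometric \<rho> for \<rho> :: "'a \<Rightarrow> 'a \<Rightarrow> real" +
  fixes p \<alpha> :: real
  assumes p: "0 < p" "p \<le> 1" and \<alpha>: "0 < \<alpha>" "\<alpha> < 1"
begin

text \<open>The distance truncated at \<open>t\<close>, normalised to agree with
  \<open>\<rho> x y powr \<alpha>\<close> when \<open>\<rho> x y = t\<close>. Its transport seminorm
  is equivalent to the weighted K-functional at \<open>t\<close> of the couple formed by mass and
  transport along \<open>\<rho>\<close>.\<close>

definition window :: "real \<Rightarrow> 'a \<Rightarrow> 'a \<Rightarrow> real"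
  where "window t x y = min (t powr (\<alpha> - 1) * \<rho> x y) (t powr \<alpha>)"

definition scale_norm :: "int \<Rightarrow> ('a \<Rightarrow> real) \<Rightarrow> real"
  where "scale_norm k = transport p (window (2 powr k))"

abbreviation snow_norm :: "('a \<Rightarrow> real) \<Rightarrow> real"
  where "snow_norm \<equiv> transport p (\<lambda>x y. \<rho> x y powr \<alpha>)"

lemma window_nonneg [simp]: "0 \<le> window t x y"
  by (simp add: window_def)

lemma p_seminorm_scale: "p_seminorm p balanced (scale_norm k)"
  unfolding scale_norm_def by (rule p_seminorm_transport[OF p(1)]) simp

lemma p_seminorm_snow: "p_seminorm p balanced snow_norm"
  by (rule p_seminorm_transport[OF p(1)]) simp

definition window_const :: real
  where "window_const = 1 / (1 - 2 powr (- \<alpha>)) + 1 / (1 - 2 powr (\<alpha> - 1))"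

lemma two_powr_less_1: "2 powr (- \<alpha>) < (1 :: real)" "2 powr (\<alpha> - 1) < (1 :: real)"
  using powr_less_mono[of "- \<alpha>" 0 "2 :: real"] powr_less_mono[of "\<alpha> - 1" 0 "2 :: real"] \<alpha> by auto

lemma window_const_pos: "0 < window_const"
  unfolding window_const_def using two_powr_less_1 by (intro add_pos_pos) auto

text \<open>Away from the scale of \<open>\<rho> x y\<close> the windows decay geometrically, with
  ratio \<open>2 powr (- \<alpha>)\<close> towards small scales and
  \<open>2 powr (\<alpha> - 1)\<close> towards large ones. Both ratios are below 1 because
  \<open>0 < \<alpha> < 1\<close>.\<close>

lemma sum_window_le:
  assumes "finite K"
  shows "(\<Sum>k\<in>K. window (2 powr real_of_int k) x y) \<le> window_const * \<rho> x y powr \<alpha>"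
proof (cases "\<rho> x y = 0")
  case True
  then show ?thesis by (simp add: window_def)
next
  case False
  define r where "r = \<rho> x y"
  have r: "0 < r" using False nonneg[of x y] unfolding r_def by linarith
  define m where "m = \<lfloor>log 2 r\<rfloor>"
  have "2 powr m \<le> 2 powr (log 2 r)" by (intro powr_mono) (auto simp: m_def)
  then have m1: "2 powr m \<le> r" using r by simp
  have "2 powr (log 2 r) \<le> 2 powr (m + 1)" using real_of_int_floor_add_one_ge[of "log 2 r"] by (intro powr_mono) (auto simp: m_def)
  then have m2: "r \<le> 2 powr (m + 1)" using r by simp
  define K1 K2 where "K1 = {k\<in>K. k \<le> m}" and "K2 = {k\<in>K. m < k}"
  have K: "K = K1 \<union> K2" "K1 \<inter> K2 = {}" "finite K1" "finite K2"
    using assms by (auto simp: K1_def K2_def)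
  have 1: "window (2 powr k) x y \<le> r powr \<alpha> * (2 powr (- \<alpha>)) ^ nat (m - k)" if "k \<in> K1" for k
  proof -
    have km: "k \<le> m" using that by (simp add: K1_def)
    have "window (2 powr k) x y \<le> (2 powr k) powr \<alpha>" by (simp add: window_def)
    also have "\<dots> = (2 powr m) powr \<alpha> * (2 powr (- \<alpha>)) ^ nat (m - k)"
      using km by (simp add: powr_powr powr_power powr_add[symmetric] algebra_simps)
    also have "\<dots> \<le> r powr \<alpha> * (2 powr (- \<alpha>)) ^ nat (m - k)"
      using m1 \<alpha> by (intro mult_right_mono powr_mono2) auto
    finally show ?thesis .
  qed
  have 2: "window (2 powr k) x y \<le> r powr \<alpha> * (2 powr (\<alpha> - 1)) ^ nat (k - m - 1)" if "k \<in> K2" for k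
  proof -
    have km: "m + 1 \<le> k" using that by (simp add: K2_def)
    have "window (2 powr k) x y \<le> (2 powr k) powr (\<alpha> - 1) * r" by (simp add: window_def r_def)
    also have "(2 powr k) powr (\<alpha> - 1) = (2 powr (m + 1)) powr (\<alpha> - 1) * (2 powr (\<alpha> - 1)) ^ nat (k - m - 1)"
      using km by (simp add: powr_powr powr_power powr_add[symmetric] algebra_simps)
    also have "(2 powr (m + 1)) powr (\<alpha> - 1) * (2 powr (\<alpha> - 1)) ^ nat (k - m - 1) * r
        \<le> r powr (\<alpha> - 1) * (2 powr (\<alpha> - 1)) ^ nat (k - m - 1) * r"
      using m2 \<alpha> r by (intro mult_right_mono powr_mono2') auto
    also have "\<dots> = (r * r powr (\<alpha> - 1)) * (2 powr (\<alpha> - 1)) ^ nat (k - m - 1)" by simp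
    also have "r * r powr (\<alpha> - 1) = r powr \<alpha>" using r powr_mult_base[of r "\<alpha> - 1"] by simp
    finally show ?thesis .
  qed
  have "(\<Sum>k\<in>K. window (2 powr k) x y)
      = (\<Sum>k\<in>K1. window (2 powr k) x y) + (\<Sum>k\<in>K2. window (2 powr k) x y)"
    unfolding K(1) using K(2-4) by (intro sum.union_disjoint)
  also have "\<dots> \<le> (\<Sum>k\<in>K1. r powr \<alpha> * (2 powr (- \<alpha>)) ^ nat (m - k))
      + (\<Sum>k\<in>K2. r powr \<alpha> * (2 powr (\<alpha> - 1)) ^ nat (k - m - 1))"
    by (intro add_mono sum_mono 1 2)
  also have "\<dots> = r powr \<alpha> * ((\<Sum>k\<in>K1. (2 powr (- \<alpha>)) ^ nat (m - k))
      + (\<Sum>k\<in>K2. (2 powr (\<alpha> - 1)) ^ nat (k - m - 1)))"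
    by (simp add: sum_distrib_left distrib_left)
  also have "\<dots> \<le> r powr \<alpha> * window_const"
    unfolding window_const_def using K(3,4) two_powr_less_1
    by (intro mult_left_mono add_mono sum_power_inj_le) (auto simp: inj_on_def K1_def K2_def)
  finally show ?thesis by (simp add: r_def mult.commute)
qed

text \<open>A single plan for the snowflake cost serves all scales at once.\<close>

lemma sum_scale_norm_le:
  assumes "f \<in> balanced" "finite K"
  shows "(\<Sum>k\<in>K. scale_norm k f) \<le> window_const * snow_norm f"
proof -
  have "(\<Sum>k\<in>K. scale_norm k f) / window_const \<le> snow_norm f"
  proof (rule transport_greatest[OF assms(1)])
    fix l assume l: "combination l = f"
    have "(\<Sum>k\<in>K. scale_norm k f) \<le> (\<Sum>k\<in>K. cost p (window (2 powr k)) l)"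
      unfolding scale_norm_def l[symmetric] by (intro sum_mono transport_le) simp
    also have "\<dots> \<le> cost p (\<lambda>x y. window_const * \<rho> x y powr \<alpha>) l"
      unfolding cost_sum[symmetric] by (intro cost_mono sum_window_le assms(2))
    also have "\<dots> = window_const * cost p (\<lambda>x y. \<rho> x y powr \<alpha>) l" by (rule cost_scale)
    finally show "(\<Sum>k\<in>K. scale_norm k f) / window_const \<le> cost p (\<lambda>x y. \<rho> x y powr \<alpha>) l"
      using window_const_pos by (simp add: pos_divide_le_eq mult.commute)
  qed
  then show ?thesis using window_const_pos by (simp add: pos_divide_le_eq mult.commute)
qed

text \<open>A nearly optimal plan is split into short and long edges. On long edges the window is
  constant, so that it controls mass; on short edges it is proportional to
  \<open>\<rho>\<close>.\<close>

lemma split_at_scale: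
  assumes f: "f \<in> balanced" and t: "0 < t" and e: "0 < e"
  obtains u w where "u \<in> balanced" "w \<in> balanced" "f = u + w"
    "mass p w \<le> 2 * (t powr - \<alpha> * (transport p (window t) f + e))"
    "transport p \<rho> u \<le> t powr (1 - \<alpha>) * (transport p (window t) f + e)"
proof -
  obtain l where l: "combination l = f" "cost p (window t) l < transport p (window t) f + e"
    using transport_less[OF f e] by blast
  define Q where "Q = (\<lambda>(a :: real, x, y). \<rho> x y \<le> t)"
  define ls ll where "ls = filter Q l" and "ll = filter (\<lambda>e. \<not> Q e) l"
  have split: "f = combination ls + combination ll"
    "cost p (window t) ls + cost p (window t) ll = cost p (window t) l"
    unfolding ls_def ll_def cost_filter combination_filter using l(1) by auto
  have nn: "0 \<le> cost p (window t) l'" for l' by (rule cost_nonneg) simp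
  have tt: "t powr \<alpha> = t powr (\<alpha> - 1) * t"
    using powr_mult_base[of t "\<alpha> - 1"] t by (simp add: mult.commute)
  have "cost p (window t) ll = cost p (\<lambda>x y. t powr \<alpha> * 1) ll"
  proof (rule cost_cong_set)
    fix a x y assume "(a, x, y) \<in> set ll"
    then have "t \<le> \<rho> x y" by (auto simp: ll_def Q_def)
    then have "t powr \<alpha> \<le> t powr (\<alpha> - 1) * \<rho> x y" unfolding tt by (intro mult_left_mono) auto
    then show "window t x y = t powr \<alpha> * 1" by (simp add: window_def)
  qed
  then have long: "cost p (window t) ll = t powr \<alpha> * cost p (\<lambda>x y. 1) ll" by (simp only: cost_scale)
  have "cost p (window t) ls = cost p (\<lambda>x y. t powr (\<alpha> - 1) * \<rho> x y) ls"
  proof (rule cost_cong_set)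
    fix a x y assume "(a, x, y) \<in> set ls"
    then have "\<rho> x y \<le> t" by (auto simp: ls_def Q_def)
    then have "t powr (\<alpha> - 1) * \<rho> x y \<le> t powr \<alpha>" unfolding tt by (intro mult_left_mono) auto
    then show "window t x y = t powr (\<alpha> - 1) * \<rho> x y" by (simp add: window_def)
  qed
  then have short: "cost p (window t) ls = t powr (\<alpha> - 1) * cost p \<rho> ls" by (simp only: cost_scale)
  have "mass p (combination ll) \<le> 2 * cost p (\<lambda>x y. 1) ll" by (rule mass_combination_le[OF p])
  also have "cost p (\<lambda>x y. 1) ll = t powr - \<alpha> * cost p (window t) ll"
    unfolding long using t by (simp add: powr_minus field_simps)
  also have "\<dots> \<le> t powr - \<alpha> * (transport p (window t) f + e)"
    using split(2) nn[of ls] l(2) by (intro mult_left_mono) auto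
  finally have 1: "mass p (combination ll) \<le> 2 * (t powr - \<alpha> * (transport p (window t) f + e))" by simp
  have "transport p \<rho> (combination ls) \<le> cost p \<rho> ls" by (rule transport_le) simp
  also have "cost p \<rho> ls = t powr (1 - \<alpha>) * cost p (window t) ls"
    unfolding short using t by (simp add: powr_add[symmetric] mult.assoc[symmetric])
  also have "\<dots> \<le> t powr (1 - \<alpha>) * (transport p (window t) f + e)"
    using split(2) nn[of ll] l(2) by (intro mult_left_mono) auto
  finally have 2: "transport p \<rho> (combination ls) \<le> t powr (1 - \<alpha>) * (transport p (window t) f + e)" .
  show ?thesis using that[of "combination ls" "combination ll"] split(1) 1 2 by simp
qed

text \<open>Interpolation at \<open>s = t\<close>, where all powers of \<open>t\<close>
  cancel.\<close>

lemma snow_norm_le_scale: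
  assumes "v \<in> balanced" "0 < t" "mass p v \<le> t powr - \<alpha> * a" "transport p \<rho> v \<le> t powr (1 - \<alpha>) * b"
  shows "snow_norm v \<le> a + 6 * b"
proof -
  have "snow_norm v \<le> t powr \<alpha> * mass p v + 6 * t powr (\<alpha> - 1) * transport p \<rho> v"
    using p \<alpha> assms(1,2) by (intro transport_powr_le) auto
  also have "\<dots> \<le> t powr \<alpha> * (t powr - \<alpha> * a) + 6 * t powr (\<alpha> - 1) * (t powr (1 - \<alpha>) * b)"
    using assms(3,4) by (intro add_mono mult_left_mono) auto
  also have "t powr \<alpha> * (t powr - \<alpha> * a) = a"
    using assms(2) by (simp add: mult.assoc[symmetric] powr_add[symmetric])
  also have "6 * t powr (\<alpha> - 1) * (t powr (1 - \<alpha>) * b) = 6 * b"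
    using assms(2) by (simp add: mult.assoc[symmetric] powr_add[symmetric])
  finally show ?thesis .
qed

text \<open>
  The fundamental lemma of real interpolation: with \<open>f = u k + w k\<close> split at scale \<open>2 ^ k\<close>, one has
  \<open>w k - w (k + 1) = u (k + 1) - u k\<close>, and this difference has small mass and small transport cost.
\<close>
lemma snow_norm_le_partial:
  assumes f: "f \<in> balanced"
  shows "snow_norm f \<le> 28 * (\<Sum>j\<le>2 * N. scale_norm (int j - int N) f)
    + (2 powr - real N) powr \<alpha> * mass p f + 6 * (2 powr real N) powr (\<alpha> - 1) * transport p \<rho> f"
proof (rule field_le_epsilon)
  fix e' :: real assume e': "0 < e'"
  interpret S: p_seminorm p balanced snow_norm by (rule p_seminorm_snow)
  interpret R: p_seminorm p balanced "transport p \<rho>" by (rule p_seminorm_transport[OF p(1)]) simp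
  interpret M: p_seminorm p balanced "mass p :: ('a \<Rightarrow> real) \<Rightarrow> real" by (rule p_seminorm_mass[OF p])
  \<comment> \<open>The errors of the \<open>2 * N + 1\<close> splittings, multiplied by the final
    factor 28, add up to \<open>e'\<close>.\<close>
  define e where "e = e' / (28 * (2 * N + 1))"
  have e: "0 < e" using e' by (simp add: e_def)
  define k where "k j = int j - int N" for j
  define t where "t j = 2 powr real_of_int (k j)" for j
  have t: "0 < t j" for j by (simp add: t_def)
  define W where "W j = scale_norm (k j) f + e" for j
  have "\<exists>u w. u \<in> balanced \<and> w \<in> balanced \<and> f = u + w \<and> mass p w \<le> 2 * (t j powr - \<alpha> * W j) \<and>
      transport p \<rho> u \<le> t j powr (1 - \<alpha>) * W j" for j
    using split_at_scale[OF f t[of j] e] unfolding W_def scale_norm_def t_def by metis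
  then obtain u w where uw: "\<And>j. u j \<in> balanced" "\<And>j. w j \<in> balanced" "\<And>j. f = u j + w j"
    "\<And>j. mass p (w j) \<le> 2 * (t j powr - \<alpha> * W j)"
    "\<And>j. transport p \<rho> (u j) \<le> t j powr (1 - \<alpha>) * W j" by metis
  have W: "0 \<le> W j" for j
    using p_seminorm.nonneg[OF p_seminorm_scale f, of "k j"] e by (simp add: W_def)
  have bal: "w j - w (Suc j) \<in> balanced" for j by (intro balanced_diff uw)
  \<comment> \<open>The mass is estimated through the two \<open>w\<close>, the transport cost
    through the two \<open>u\<close>. Both bounds have the factor 2, hence
    \<open>14 = 2 + 6 * 2\<close>.\<close>
  have step: "snow_norm (w j - w (Suc j)) \<le> 14 * (W j + W (Suc j))" for j
  proof -
    have tS: "t (Suc j) = 2 * t j" by (simp add: t_def k_def powr_mult_base add_diff_eq)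
    have a1: "t (Suc j) powr - \<alpha> \<le> t j powr - \<alpha>"
      unfolding tS using t[of j] \<alpha> by (intro powr_mono2') auto
    have "t (Suc j) powr (1 - \<alpha>) = 2 powr (1 - \<alpha>) * t j powr (1 - \<alpha>)"
      unfolding tS using t[of j] by (simp add: powr_mult)
    also have "\<dots> \<le> 2 * t j powr (1 - \<alpha>)"
      using powr_mono[of "1 - \<alpha>" 1 "2 :: real"] \<alpha> by (intro mult_right_mono) auto
    finally have a2: "t (Suc j) powr (1 - \<alpha>) \<le> 2 * t j powr (1 - \<alpha>)" .
    have "mass p (w j - w (Suc j)) \<le> mass p (w j) + mass p (w (Suc j))" by (rule M.diff_le[OF uw(2) uw(2)])
    also have "\<dots> \<le> 2 * (t j powr - \<alpha> * W j) + 2 * (t (Suc j) powr - \<alpha> * W (Suc j))"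
      by (intro add_mono uw(4))
    also have "\<dots> \<le> 2 * (t j powr - \<alpha> * W j) + 2 * (t j powr - \<alpha> * W (Suc j))"
      using a1 W by (intro add_mono mult_left_mono mult_right_mono order_refl) auto
    finally have m: "mass p (w j - w (Suc j)) \<le> t j powr - \<alpha> * (2 * (W j + W (Suc j)))"
      by (simp add: algebra_simps)
    have "w j - w (Suc j) = u (Suc j) - u j"
      using uw(3)[of j] uw(3)[of "Suc j"] by (metis add_diff_cancel_left add.commute add_diff_eq diff_eq_eq)
    then have "transport p \<rho> (w j - w (Suc j)) \<le> transport p \<rho> (u (Suc j)) + transport p \<rho> (u j)"
      using R.diff_le[OF uw(1) uw(1), of "Suc j" j] by simp
    also have "\<dots> \<le> t (Suc j) powr (1 - \<alpha>) * W (Suc j) + t j powr (1 - \<alpha>) * W j"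
      by (intro add_mono uw(5))
    also have "\<dots> \<le> (2 * t j powr (1 - \<alpha>)) * W (Suc j) + (2 * t j powr (1 - \<alpha>)) * W j"
      using a2 W by (intro add_mono mult_right_mono) auto
    finally have r: "transport p \<rho> (w j - w (Suc j)) \<le> t j powr (1 - \<alpha>) * (2 * (W j + W (Suc j)))"
      by (simp add: algebra_simps)
    show ?thesis using snow_norm_le_scale[OF bal t m r] by simp
  qed
  have first: "snow_norm (u 0) \<le> t 0 powr \<alpha> * mass p f + 8 * W 0"
  proof -
    have "u 0 = f - w 0" using uw(3)[of 0] by (metis add_diff_cancel_right')
    then have "mass p (u 0) \<le> mass p f + mass p (w 0)" using M.diff_le[OF f uw(2)[of 0]] by simp
    also have "\<dots> \<le> mass p f + 2 * (t 0 powr - \<alpha> * W 0)" by (intro add_mono order_refl uw(4))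
    also have "\<dots> = t 0 powr - \<alpha> * (t 0 powr \<alpha> * mass p f + 2 * W 0)"
      using t[of 0] by (simp add: distrib_left mult.assoc[symmetric] powr_add[symmetric])
    finally have "mass p (u 0) \<le> t 0 powr - \<alpha> * (t 0 powr \<alpha> * mass p f + 2 * W 0)" .
    from snow_norm_le_scale[OF uw(1) t this uw(5)] show ?thesis by simp
  qed
  have last: "snow_norm (w (2 * N)) \<le> 6 * t (2 * N) powr (\<alpha> - 1) * transport p \<rho> f + 8 * W (2 * N)"
  proof -
    let ?n = "2 * N"
    have "w ?n = f - u ?n" using uw(3)[of ?n] by (metis add_diff_cancel_left')
    then have "transport p \<rho> (w ?n) \<le> transport p \<rho> f + transport p \<rho> (u ?n)"
      using R.diff_le[OF f uw(1)[of ?n]] by simp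
    also have "\<dots> \<le> transport p \<rho> f + t ?n powr (1 - \<alpha>) * W ?n" by (intro add_mono order_refl uw(5))
    also have "\<dots> = t ?n powr (1 - \<alpha>) * (t ?n powr (\<alpha> - 1) * transport p \<rho> f + W ?n)"
      using t[of ?n] by (simp add: distrib_left mult.assoc[symmetric] powr_add[symmetric])
    finally have r: "transport p \<rho> (w ?n) \<le> t ?n powr (1 - \<alpha>) * (t ?n powr (\<alpha> - 1) * transport p \<rho> f + W ?n)" .
    have m: "mass p (w ?n) \<le> t ?n powr - \<alpha> * (2 * W ?n)" using uw(4)[of ?n] by simp
    from snow_norm_le_scale[OF uw(2) t m r] show ?thesis by simp
  qed
  have tele: "snow_norm (w 0) \<le> (\<Sum>j<n. 14 * (W j + W (Suc j))) + snow_norm (w n)" for n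
  proof (induction n)
    case (Suc n)
    have "snow_norm (w n) = snow_norm ((w n - w (Suc n)) + w (Suc n))" by simp
    also have "\<dots> \<le> snow_norm (w n - w (Suc n)) + snow_norm (w (Suc n))" by (rule S.triangle[OF bal uw(2)])
    finally show ?case using Suc step[of n] by simp
  qed simp
  \<comment> \<open>Interior terms occur twice in the telescoping sum. Rounding the end terms up to
    28 leaves a surplus of 14 each, which absorbs the \<open>8 * W 0\<close> of \<open>first\<close>
    and the \<open>8 * W (2 * N)\<close> of \<open>last\<close>.\<close>
  have sumW: "(\<Sum>j<n. 14 * (W j + W (Suc j))) + 14 * (W 0 + W n) = 28 * (\<Sum>j\<le>n. W j)" for n
    by (induction n) (auto simp: algebra_simps)
  have "snow_norm f \<le> snow_norm (u 0) + snow_norm (w 0)"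
    using S.triangle[OF uw(1,2), of 0 0] uw(3)[of 0] by simp
  also have "\<dots> \<le> t 0 powr \<alpha> * mass p f + 8 * W 0 + ((\<Sum>j<2 * N. 14 * (W j + W (Suc j)))
      + (6 * t (2 * N) powr (\<alpha> - 1) * transport p \<rho> f + 8 * W (2 * N)))"
    using first last tele[of "2 * N"] by simp
  also have "\<dots> \<le> 28 * (\<Sum>j\<le>2 * N. W j) + t 0 powr \<alpha> * mass p f
      + 6 * t (2 * N) powr (\<alpha> - 1) * transport p \<rho> f"
    using sumW[of "2 * N"] W[of 0] W[of "2 * N"] by simp
  also have "(\<Sum>j\<le>2 * N. W j) = (\<Sum>j\<le>2 * N. scale_norm (k j) f) + (2 * N + 1) * e"
    by (simp add: W_def sum.distrib algebra_simps)
  also have "28 * ((\<Sum>j\<le>2 * N. scale_norm (k j) f) + (2 * N + 1) * e)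
      = 28 * (\<Sum>j\<le>2 * N. scale_norm (k j) f) + e'" by (simp add: e_def field_simps)
  finally show "snow_norm f \<le> 28 * (\<Sum>j\<le>2 * N. scale_norm (int j - int N) f)
    + (2 powr - real N) powr \<alpha> * mass p f + 6 * (2 powr real N) powr (\<alpha> - 1) * transport p \<rho> f + e'"
    by (simp add: t_def k_def)
qed

text \<open>The decoding enumerates all integers, so that the scales become the index set
  \<open>nat\<close> of \<open>gliding_hump\<close>.\<close>

lemma summable_scale_norm:
  assumes "f \<in> balanced"
  shows "summable (\<lambda>n. scale_norm (int_decode n) f)"
    and "(\<Sum>n. scale_norm (int_decode n) f) \<le> window_const * snow_norm f"
proof -
  have le: "(\<Sum>n<m. scale_norm (int_decode n) f) \<le> window_const * snow_norm f" for m
    using sum_scale_norm_le[OF assms, of "int_decode ` {..<m}"]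
    by (simp add: sum.reindex inj_int_decode)
  have nn: "0 \<le> scale_norm (int_decode n) f" for n
    by (rule p_seminorm.nonneg[OF p_seminorm_scale assms])
  show sm: "summable (\<lambda>n. scale_norm (int_decode n) f)"
    by (rule summableI_nonneg_bounded[OF nn le])
  show "(\<Sum>n. scale_norm (int_decode n) f) \<le> window_const * snow_norm f"
    by (rule suminf_le_const[OF sm le])
qed

text \<open>The two end terms of the finite version decay like
  \<open>2 powr (- \<alpha> * N)\<close> and \<open>2 powr ((\<alpha> - 1) * N)\<close>.\<close>

theorem snow_norm_le_suminf:
  assumes f: "f \<in> balanced"
  shows "snow_norm f \<le> 28 * (\<Sum>n. scale_norm (int_decode n) f)"
proof (rule LIMSEQ_le_const)
  let ?S = "28 * (\<Sum>n. scale_norm (int_decode n) f)"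
  have "(\<lambda>N. ?S + (2 powr - real N) powr \<alpha> * mass p f + 6 * (2 powr real N) powr (\<alpha> - 1) * transport p \<rho> f)
      \<longlonglongrightarrow> ?S + 0 * mass p f + 6 * 0 * transport p \<rho> f"
  proof (intro tendsto_intros)
    have "(\<lambda>N. (2 powr - \<alpha>) ^ N) \<longlonglongrightarrow> (0 :: real)"
      using two_powr_less_1 by (intro LIMSEQ_realpow_zero) auto
    then show "(\<lambda>N. (2 powr - real N) powr \<alpha>) \<longlonglongrightarrow> 0"
      by (simp add: powr_powr powr_power mult.commute)
    have "(\<lambda>N. (2 powr (\<alpha> - 1)) ^ N) \<longlonglongrightarrow> (0 :: real)"
      using two_powr_less_1 by (intro LIMSEQ_realpow_zero) auto
    then show "(\<lambda>N. (2 powr real N) powr (\<alpha> - 1)) \<longlonglongrightarrow> 0"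
      by (simp add: powr_powr powr_power mult.commute)
  qed
  then show "(\<lambda>N. ?S + (2 powr - real N) powr \<alpha> * mass p f
      + 6 * (2 powr real N) powr (\<alpha> - 1) * transport p \<rho> f) \<longlonglongrightarrow> ?S" by simp
  have "snow_norm f \<le> ?S + (2 powr - real N) powr \<alpha> * mass p f
      + 6 * (2 powr real N) powr (\<alpha> - 1) * transport p \<rho> f" for N
  proof -
    have "(\<Sum>j\<le>2 * N. scale_norm (int j - int N) f)
        = (\<Sum>n\<in>(\<lambda>j. int_encode (int j - int N)) ` {..2 * N}. scale_norm (int_decode n) f)"
      by (subst sum.reindex) (auto simp: inj_on_def int_encode_eq)
    also have "\<dots> \<le> (\<Sum>n. scale_norm (int_decode n) f)"
      by (intro sum_le_suminf summable_scale_norm[OF f] p_seminorm.nonneg[OF p_seminorm_scale f]) auto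
    finally show ?thesis using snow_norm_le_partial[OF f, of N] by simp
  qed
  then show "\<exists>N0. \<forall>N\<ge>N0. snow_norm f \<le> ?S + (2 powr - real N) powr \<alpha> * mass p f
      + 6 * (2 powr real N) powr (\<alpha> - 1) * transport p \<rho> f" by blast
qed

end

section \<open>Sequences separated at one scale\<close>

lemma sum_of_bool_le_of_bool:
  assumes "finite I" "\<And>i j. i \<in> I \<Longrightarrow> j \<in> I \<Longrightarrow> Q i \<Longrightarrow> Q j \<Longrightarrow> i = j"
  shows "(\<Sum>i\<in>I. of_bool (Q i) :: real) \<le> of_bool (\<exists>i\<in>I. Q i)"
proof (cases "\<exists>i\<in>I. Q i")
  case True
  then obtain i where i: "i \<in> I" "Q i" by blast
  then have "(\<Sum>i\<in>I. of_bool (Q i) :: real) = (\<Sum>j\<in>{i}. 1)"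
    using assms by (intro sum.mono_neutral_cong_right) auto
  then show ?thesis using True by simp
next
  case False
  then have "(\<Sum>i\<in>I. of_bool (Q i) :: real) = 0" by (intro sum.neutral) auto
  then show ?thesis by simp
qed

lemma push_push: "f \<in> balanced \<Longrightarrow> push R (push r f) = push (\<lambda>x. R (r x)) f"
proof -
  have "map (\<lambda>(a, x, y). (a, R x, R y)) (map (\<lambda>(a, x, y). (a, r x, r y)) l)
      = map (\<lambda>(a, x, y). (a, R (r x), R (r y))) l" for l :: "(real \<times> 'a \<times> 'a) list"
    by (induction l) auto
  then show "f \<in> balanced \<Longrightarrow> push R (push r f) = push (\<lambda>x. R (r x)) f"
    unfolding balanced_def by (elim rangeE) (simp only: push_combination)
qed

lemma cost_map_push:
  "cost p c (map (\<lambda>(a, x, y). (a, r x, r y)) l) = cost p (\<lambda>x y. c (r x) (r y)) l"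
  by (induction l) auto

section \<open>Quotients of a bounded pseudometric space by finite sets\<close>

locale bounded_pseudometric = pseudometric \<omega> for \<omega> :: "'a \<Rightarrow> 'a \<Rightarrow> real" +
  fixes p :: real
  assumes p: "0 < p" "p \<le> 1" and le_1: "\<omega> x y \<le> 1"
begin

definition dist_to :: "'a set \<Rightarrow> 'a \<Rightarrow> real"
  where "dist_to E x = Min (\<omega> x ` E)"

text \<open>Transport in the quotient of the space by \<open>E\<close>: mass may vanish at the points of \<open>E\<close>.\<close>
definition quotient_cost :: "'a set \<Rightarrow> 'a \<Rightarrow> 'a \<Rightarrow> real"
  where "quotient_cost E x y = min (\<omega> x y) (dist_to E x + dist_to E y)"

lemma dist_to_le: "finite E \<Longrightarrow> e \<in> E \<Longrightarrow> dist_to E x \<le> \<omega> x e"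
  by (simp add: dist_to_def)

lemma dist_to_attained:
  assumes "finite E" "E \<noteq> {}"
  obtains e where "e \<in> E" "dist_to E x = \<omega> x e"
proof -
  have "Min (\<omega> x ` E) \<in> \<omega> x ` E" using assms by (intro Min_in) auto
  then show ?thesis using that by (auto simp: dist_to_def)
qed

lemma dist_to_nonneg: "finite E \<Longrightarrow> E \<noteq> {} \<Longrightarrow> 0 \<le> dist_to E x"
  by (simp add: dist_to_def)

lemma dist_to_le_1: "finite E \<Longrightarrow> E \<noteq> {} \<Longrightarrow> dist_to E x \<le> 1"
  using dist_to_le le_1 by (meson ex_in_conv order_trans)

lemma dist_to_triangle:
  assumes "finite E" "E \<noteq> {}"
  shows "dist_to E x \<le> \<omega> x y + dist_to E y"
proof -
  obtain e where "e \<in> E" "dist_to E y = \<omega> y e" using dist_to_attained[OF assms] .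
  then show ?thesis using dist_to_le[OF assms(1), of e x] triangle[of x e y] by simp
qed

lemma dist_to_antimono: "finite E' \<Longrightarrow> E \<noteq> {} \<Longrightarrow> E \<subseteq> E' \<Longrightarrow> dist_to E' x \<le> dist_to E x"
  unfolding dist_to_def by (intro Min_antimono) auto

lemma dist_to_self: "finite E \<Longrightarrow> e \<in> E \<Longrightarrow> dist_to E e = 0"
  using dist_to_le[of E e e] dist_to_nonneg[of E e] by auto

lemma quotient_cost_nonneg: "finite E \<Longrightarrow> E \<noteq> {} \<Longrightarrow> 0 \<le> quotient_cost E x y"
  by (simp add: quotient_cost_def dist_to_nonneg)

lemma p_seminorm_quotient:
  "finite E \<Longrightarrow> E \<noteq> {} \<Longrightarrow> p_seminorm p balanced (transport p (quotient_cost E))"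
  by (intro p_seminorm_transport p quotient_cost_nonneg)

lemma p_seminorm_transport_metric: "p_seminorm p balanced (transport p \<omega>)"
  by (intro p_seminorm_transport p nonneg)

text \<open>An edge that is cheaper through \<open>E\<close> is replaced by two edges ending in
  \<open>E\<close> and a dipole inside \<open>E\<close>. The latter costs nothing in the quotient
  and contributes only to a fixed finite-dimensional space.\<close>

lemma quotient_split:
  assumes E: "finite E" "E \<noteq> {}"
  shows "\<exists>g\<in>balanced. \<exists>v\<in>span ((\<lambda>(a, b). dipole a b) ` (E \<times> E)).
    combination l = g + v \<and> transport p \<omega> g \<le> cost p (quotient_cost E) l"
proof (induction l)
  case Nil
  interpret T: p_seminorm p balanced "transport p \<omega>" by (rule p_seminorm_transport_metric)
  show ?case
    using T.zero by (intro bexI[of _ 0]) (auto intro: span_zero balanced_0 simp del: pointwise)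
next
  case (Cons e l)
  interpret T: p_seminorm p balanced "transport p \<omega>" by (rule p_seminorm_transport_metric)
  let ?S = "(\<lambda>(a, b). dipole a b) ` (E \<times> E)"
  obtain a x y where e: "e = (a, x, y)" by (cases e)
  obtain g v where gv: "g \<in> balanced" "v \<in> span ?S" "combination l = g + v"
    "transport p \<omega> g \<le> cost p (quotient_cost E) l" using Cons by blast
  have "\<exists>g'\<in>balanced. \<exists>v'\<in>span ?S. dipole x y = g' + v' \<and> transport p \<omega> g' \<le> quotient_cost E x y"
  proof (cases "\<omega> x y \<le> dist_to E x + dist_to E y")
    case True
    then show ?thesis
      using transport_dipole_le[of \<omega> p x y]
      by (intro bexI[of _ "dipole x y"] bexI[of _ 0]) (auto simp: quotient_cost_def span_zero simp del: pointwise)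
  next
    case False
    obtain ex ey where ex: "ex \<in> E" "dist_to E x = \<omega> x ex" and ey: "ey \<in> E" "dist_to E y = \<omega> y ey"
      using dist_to_attained[OF E] by metis
    have "transport p \<omega> (dipole x ex + dipole ey y) \<le> transport p \<omega> (dipole x ex) + transport p \<omega> (dipole ey y)"
      by (rule T.triangle) simp_all
    also have "\<dots> \<le> \<omega> x ex + \<omega> ey y" by (intro add_mono transport_dipole_le) simp_all
    also have "\<dots> = quotient_cost E x y" using False ex ey commute[of ey y] by (simp add: quotient_cost_def)
    finally have "transport p \<omega> (dipole x ex + dipole ey y) \<le> quotient_cost E x y" .
    moreover have "dipole x y = (dipole x ex + dipole ey y) + dipole ex ey" by (simp add: dipole_def)
    moreover have "dipole ex ey \<in> span ?S" using ex ey by (intro span_base) auto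
    moreover have "dipole x ex + dipole ey y \<in> balanced"
      by (intro balanced_add dipole_balanced)
    ultimately show ?thesis by blast
  qed
  then obtain g' v' where g'v': "g' \<in> balanced" "v' \<in> span ?S" "dipole x y = g' + v'"
    "transport p \<omega> g' \<le> quotient_cost E x y" by blast
  have "transport p \<omega> (a *\<^sub>R g' + g) \<le> \<bar>a\<bar> powr p * transport p \<omega> g' + transport p \<omega> g"
    using T.triangle[OF balanced_scale[OF g'v'(1)] gv(1), of a] T.scale[OF g'v'(1)] by simp
  also have "\<dots> \<le> \<bar>a\<bar> powr p * quotient_cost E x y + cost p (quotient_cost E) l"
    using g'v'(4) gv(4) by (intro add_mono mult_left_mono) auto
  finally have "transport p \<omega> (a *\<^sub>R g' + g) \<le> cost p (quotient_cost E) (e # l)" by (simp add: e)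
  moreover have "combination (e # l) = (a *\<^sub>R g' + g) + (a *\<^sub>R v' + v)"
    unfolding e combination_simps gv(3) g'v'(3) by (simp add: algebra_simps)
  moreover have "a *\<^sub>R v' + v \<in> span ?S" by (intro span_add span_scale gv g'v')
  moreover have "a *\<^sub>R g' + g \<in> balanced"
    by (intro balanced_add balanced_scale gv g'v')
  ultimately show ?case by blast
qed

end

locale separated_sequence = bounded_pseudometric +
  fixes w :: "nat \<Rightarrow> 'a \<Rightarrow> real" and A r :: real
  assumes w: "w n \<in> balanced"
    and mass: "mass p (w n) \<le> A"
    and separated: "i \<noteq> j \<Longrightarrow> r \<le> transport p \<omega> (w i - w j)"
    and r_pos: "0 < r"
begin

text \<open>Otherwise infinitely many elements are the sum of a part below \<open>r / 3\<close> and
  a bounded part in a fixed finite-dimensional space. Two of the latter are closer than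
  \<open>r / 3\<close>, which contradicts the separation by \<open>r\<close>.\<close>

lemma finite_close_to_finite_set:
  assumes E: "finite E" "E \<noteq> {}"
  shows "finite {n. transport p (quotient_cost E) (w n) < r / 3}"
proof (rule ccontr)
  interpret T: p_seminorm p balanced "transport p \<omega>" by (rule p_seminorm_transport_metric)
  let ?S = "(\<lambda>(a, b). dipole a b) ` (E \<times> E)"
  assume inf: "infinite {n. transport p (quotient_cost E) (w n) < r / 3}"
  define \<sigma> where "\<sigma> = enumerate {n. transport p (quotient_cost E) (w n) < r / 3}"
  have \<sigma>: "strict_mono \<sigma>" "\<And>n. transport p (quotient_cost E) (w (\<sigma> n)) < r / 3"
    using strict_mono_enumerate[OF inf] enumerate_in_set[OF inf] by (auto simp: \<sigma>_def)
  have "\<exists>g\<in>balanced. \<exists>v\<in>span ?S. w (\<sigma> n) = g + v \<and> transport p \<omega> g < r / 3" for n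
  proof -
    have "0 < r / 3 - transport p (quotient_cost E) (w (\<sigma> n))" using \<sigma>(2)[of n] by simp
    from transport_less[where p = p and c = "quotient_cost E", OF w[of "\<sigma> n"] this] obtain l where
      l: "combination l = w (\<sigma> n)" "cost p (quotient_cost E) l < r / 3" by auto
    obtain g v where "g \<in> balanced" "v \<in> span ?S" "combination l = g + v"
      "transport p \<omega> g \<le> cost p (quotient_cost E) l" using quotient_split[OF E, of l] by blast
    then show ?thesis using l by (intro bexI[of _ g] bexI[of _ v]) auto
  qed
  then obtain g v where gv: "\<And>n. g n \<in> balanced" "\<And>n. v n \<in> span ?S" "\<And>n. w (\<sigma> n) = g n + v n"
    "\<And>n. transport p \<omega> (g n) < r / 3" by metis
  have S: "?S \<subseteq> balanced" by auto
  have v: "v n \<in> balanced" for n using gv(2) span_minimal[OF S subspace_balanced] by auto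
  have "transport p \<omega> (v n) \<le> A + r / 3" for n
  proof -
    have "v n = w (\<sigma> n) - g n" using gv(3) by simp
    then have "transport p \<omega> (v n) \<le> transport p \<omega> (w (\<sigma> n)) + transport p \<omega> (g n)"
      using T.diff_le[OF w gv(1), of "\<sigma> n" n] by simp
    also have "transport p \<omega> (w (\<sigma> n)) \<le> mass p (w (\<sigma> n))"
      by (rule transport_le_mass[OF w p(1) nonneg le_1])
    finally show ?thesis using mass[of "\<sigma> n"] gv(4)[of n] by simp
  qed
  then obtain i j where ij: "i < j" "transport p \<omega> (v i - v j) < r / 3"
    using T.finite_dimensional_close_pair[where v = v and R = "A + r / 3" and e = "r / 3", OF _ S gv(2)] E r_pos
    by auto
  have "w (\<sigma> i) - w (\<sigma> j) = (g i - g j) + (v i - v j)" by (simp add: gv(3))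
  then have "transport p \<omega> (w (\<sigma> i) - w (\<sigma> j)) \<le> transport p \<omega> (g i - g j) + transport p \<omega> (v i - v j)"
    using T.triangle[OF balanced_diff[OF gv(1) gv(1)] balanced_diff[OF v v]]
    by metis
  also have "\<dots> \<le> transport p \<omega> (g i) + transport p \<omega> (g j) + transport p \<omega> (v i - v j)"
    using T.diff_le[OF gv(1) gv(1)] by simp
  also have "\<dots> < r" using gv(4)[of i] gv(4)[of j] ij(2) by simp
  finally show False using separated[of "\<sigma> i" "\<sigma> j"] strict_mono_eq[OF \<sigma>(1)] ij(1) by simp
qed

definition supp :: "nat \<Rightarrow> 'a set"
  where "supp n = {x. w n x \<noteq> 0}"

lemma finite_supp: "finite (supp n)"
  unfolding supp_def by (rule finite_support[OF w])

definition spread :: "nat \<Rightarrow> 'a set \<Rightarrow> real"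
  where "spread n E = (\<Sum>x\<in>supp n. \<bar>w n x\<bar> powr p * dist_to E x)"

lemma spread_nonneg: "finite E \<Longrightarrow> E \<noteq> {} \<Longrightarrow> 0 \<le> spread n E"
  unfolding spread_def by (intro sum_nonneg mult_nonneg_nonneg dist_to_nonneg) auto

lemma spread_le: "finite E \<Longrightarrow> E \<noteq> {} \<Longrightarrow> spread n E \<le> A"
proof -
  assume E: "finite E" "E \<noteq> {}"
  have "spread n E \<le> (\<Sum>x\<in>supp n. \<bar>w n x\<bar> powr p * 1)"
    unfolding spread_def by (intro sum_mono mult_left_mono dist_to_le_1 E) auto
  then show ?thesis using mass[of n] by (simp add: mass_def supp_def)
qed

text \<open>
  Choosing \<open>E\<close> almost minimal for the limit inferior of \<open>spread n E\<close> forces the later elements of a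
  subsequence to put little mass near the supports of the earlier ones.
\<close>
lemma exists_spread_subsequence:
  assumes e: "0 < e"
  shows "\<exists>E \<sigma>. finite E \<and> E \<noteq> {} \<and> strict_mono (\<sigma> :: nat \<Rightarrow> nat) \<and>
    (\<forall>j. r / 3 \<le> transport p (quotient_cost E) (w (\<sigma> j)) \<and>
      spread (\<sigma> j) E - spread (\<sigma> j) (E \<union> (\<Union>i<j. supp (\<sigma> i))) \<le> e)"
proof -
  \<comment> \<open>Its infimum is the infimum, over finite nonempty sets \<open>E\<close>, of the
    limit inferior of \<open>spread m E\<close>.\<close>
  define T where "T = {t. 0 \<le> t \<and> (\<exists>E. finite E \<and> E \<noteq> {} \<and> infinite {m. spread m E < t})}"
  have "spread m {undefined} < A + 1" for m using spread_le[of "{undefined}" m] by simp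
  moreover have "0 \<le> A" using spread_le[of "{undefined}" 0] spread_nonneg[of "{undefined}" 0] by simp
  ultimately have "A + 1 \<in> T"
    by (auto simp: T_def intro!: exI[of _ "{undefined}"])
  then have T: "T \<noteq> {}" "bdd_below T" by (auto simp: T_def bdd_below_def)
  have "Inf T < Inf T + e / 2" using e by simp
  then obtain t where t: "t \<in> T" "t < Inf T + e / 2" using cInf_lessD[OF T(1)] by blast
  then obtain E where E: "finite E" "E \<noteq> {}" "infinite {m. spread m E < t}" by (auto simp: T_def)
  define S where "S = {m. spread m E < t}"
  \<comment> \<open>No finite set can lower the spread below this value infinitely often. As
    \<open>spread m E < Inf T + e / 2\<close> on \<open>S\<close>, enlarging \<open>E\<close> lowers
    the spread by at most \<open>e\<close> there, once the index is large.\<close>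
  have fin: "finite {m. spread m F < Inf T - e / 2}" if F: "finite F" "F \<noteq> {}" for F
  proof (cases "0 \<le> Inf T - e / 2")
    case True
    show ?thesis
    proof (rule ccontr)
      assume "infinite {m. spread m F < Inf T - e / 2}"
      then have "Inf T - e / 2 \<in> T" using True F by (auto simp: T_def)
      from cInf_lower[OF this T(2)] show False using e by simp
    qed
  next
    case False
    then have "\<not> spread m F < Inf T - e / 2" for m using spread_nonneg[OF F, of m] by linarith
    then have "{m. spread m F < Inf T - e / 2} = {}" by blast
    then show ?thesis by simp
  qed
  have pick: "\<exists>n'>n. n' \<in> S \<and> r / 3 \<le> transport p (quotient_cost E) (w n') \<and> Inf T - e / 2 \<le> spread n' F"
    if F: "finite F" "F \<noteq> {}" for n F
  proof -
    have "infinite (S - {..n} - {n. transport p (quotient_cost E) (w n) < r / 3} - {m. spread m F < Inf T - e / 2})"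
      using E(3) fin[OF F] finite_close_to_finite_set[OF E(1,2)] by (simp add: S_def)
    from infinite_imp_nonempty[OF this] obtain n' where
      "n' \<in> S - {..n} - {n. transport p (quotient_cost E) (w n) < r / 3} - {m. spread m F < Inf T - e / 2}"
      by blast
    then show ?thesis by (intro exI[of _ n']) auto
  qed
  \<comment> \<open>The set \<open>F\<close> collects \<open>E\<close> and the supports chosen so
    far. The relation \<open>R\<close> determines it from the previous state, so it has to be
    prescribed only for \<open>j = 0\<close>.\<close>
  define P where "P j s \<longleftrightarrow> (case s of (n, F) \<Rightarrow> finite F \<and> F \<noteq> {} \<and> n \<in> S \<and>
      r / 3 \<le> transport p (quotient_cost E) (w n) \<and> Inf T - e / 2 \<le> spread n F \<and> (j = 0 \<longrightarrow> F = E))"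
    for j :: nat and s :: "nat \<times> 'a set"
  define R where "R s s' \<longleftrightarrow> fst s < fst s' \<and> snd s' = snd s \<union> supp (fst s)" for s s' :: "nat \<times> 'a set"
  have "\<exists>f. \<forall>j. P j (f j) \<and> R (f j) (f (Suc j))"
  proof (rule dependent_nat_choice)
    show "\<exists>s. P 0 s" using pick[OF E(1,2), of 0] E(1,2) by (auto simp: P_def)
    fix s j assume s: "P j s"
    define F where "F = snd s \<union> supp (fst s)"
    have F: "finite F" "F \<noteq> {}" using s finite_supp by (auto simp: P_def F_def)
    from pick[OF this, of "fst s"] show "\<exists>s'. P (Suc j) s' \<and> R s s'"
      using F by (auto simp: P_def R_def F_def)
  qed
  then obtain f where f: "\<And>j. P j (f j)" "\<And>j. R (f j) (f (Suc j))" by blast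
  define \<sigma> where "\<sigma> j = fst (f j)" for j
  have snd: "snd (f j) = E \<union> (\<Union>i<j. supp (\<sigma> i))" for j
  proof (induction j)
    case 0
    then show ?case using f(1)[of 0] by (auto simp: P_def)
  next
    case (Suc j)
    then show ?case using f(2)[of j] by (auto simp: R_def \<sigma>_def lessThan_Suc)
  qed
  have "strict_mono \<sigma>" using f(2) by (auto simp: strict_mono_Suc_iff R_def \<sigma>_def)
  moreover have "r / 3 \<le> transport p (quotient_cost E) (w (\<sigma> j))" for j
    using f(1)[of j] by (auto simp: P_def \<sigma>_def split: prod.splits)
  moreover have "spread (\<sigma> j) E - spread (\<sigma> j) (E \<union> (\<Union>i<j. supp (\<sigma> i))) \<le> e" for j
  proof -
    have "spread (\<sigma> j) E < t" "Inf T - e / 2 \<le> spread (\<sigma> j) (snd (f j))"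
      using f(1)[of j] by (auto simp: P_def \<sigma>_def S_def split: prod.splits)
    then show ?thesis using t(2) by (simp add: snd)
  qed
  ultimately show ?thesis using E by blast
qed

theorem lp_lower_bound:
  "\<exists>\<sigma> :: nat \<Rightarrow> nat. strict_mono \<sigma> \<and>
    (\<forall>J a. r / 200 * (\<Sum>j<J. \<bar>a j\<bar> powr p) \<le> transport p \<omega> (\<Sum>j<J. a j *\<^sub>R w (\<sigma> j)))"
proof -
  \<comment> \<open>Removing the bad points will cost \<open>2 * (r / 400) = r / 200\<close>, which
    leaves at least \<open>r / 4\<close> per element. The loss of a factor 25 turns this into
    \<open>r / 100\<close>, and the removed parts take away another \<open>r / 200\<close>.\<close>
  have "0 < r / 400" using r_pos by simp
  from exists_spread_subsequence[OF this] obtain E and \<sigma> :: "nat \<Rightarrow> nat" where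
    E: "finite E" "E \<noteq> {}" and \<sigma>: "strict_mono \<sigma>"
    and far: "\<And>j. r / 3 \<le> transport p (quotient_cost E) (w (\<sigma> j))"
    and spread: "\<And>j. spread (\<sigma> j) E - spread (\<sigma> j) (E \<union> (\<Union>i<j. supp (\<sigma> i))) \<le> r / 400"
    by blast
  obtain e0 where e0: "e0 \<in> E" using E(2) by blast
  let ?q = "quotient_cost E"
  define h where "h = dist_to E"
  define F where "F j = E \<union> (\<Union>i<j. supp (\<sigma> i))" for j
  have F: "finite (F j)" "F j \<noteq> {}" "E \<subseteq> F j" for j using E finite_supp by (auto simp: F_def)
  interpret Q: p_seminorm p balanced "transport p ?q" by (rule p_seminorm_quotient[OF E])
  have q0: "0 \<le> ?q x y" for x y by (rule quotient_cost_nonneg[OF E])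
  have h0: "0 \<le> h x" for x unfolding h_def by (rule dist_to_nonneg[OF E])
  have h_tri: "h x \<le> \<omega> x y + h y" for x y unfolding h_def by (rule dist_to_triangle[OF E])
  have he0: "h e0 = 0" unfolding h_def by (rule dist_to_self[OF E(1) e0])
  have q_e0: "?q x e0 \<le> h x" "?q e0 x \<le> h x" for x using he0 by (auto simp: quotient_cost_def h_def)
  have q_e00: "?q e0 e0 = 0" using he0 by (simp add: quotient_cost_def h_def)
  \<comment> \<open>A point is good if the earlier supports do not come closer than half its
    distance from \<open>E\<close>. For a bad point \<open>h x\<close> is at most twice the drop of
    its distance, so returning all bad points to \<open>E\<close> costs at most twice the drop of
    the spread.\<close>
  define good where "good j x \<longleftrightarrow> h x / 2 < dist_to (F j) x" for j x
  define ret where "ret j x = (if good j x then x else e0)" for j x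
  define w' where "w' j = push (ret j) (w (\<sigma> j))" for j
  have w': "w' j \<in> balanced" for j unfolding w'_def by (rule push_balanced[OF w])
  have DF: "dist_to (F j) x \<le> h x" for j x
    unfolding h_def using F E by (intro dist_to_antimono) auto
  have loss: "transport p ?q (w (\<sigma> j) - w' j) \<le> r / 200" for j
  proof -
    have "transport p ?q (w (\<sigma> j) - w' j) \<le> (\<Sum>x\<in>supp (\<sigma> j). \<bar>w (\<sigma> j) x\<bar> powr p * ?q x (ret j x))"
      unfolding w'_def supp_def by (rule transport_diff_push_le[OF w p(1) q0])
    also have "\<dots> \<le> (\<Sum>x\<in>supp (\<sigma> j). 2 * (\<bar>w (\<sigma> j) x\<bar> powr p * dist_to E x - \<bar>w (\<sigma> j) x\<bar> powr p * dist_to (F j) x))"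
    proof (rule sum_mono)
      fix x
      have "?q x (ret j x) \<le> 2 * (h x - dist_to (F j) x)"
      proof (cases "good j x")
        case True
        then show ?thesis using DF[of j x] dist_to_nonneg[OF E, of x] by (simp add: ret_def quotient_cost_def)
      next
        case False
        then show ?thesis using q_e0(1)[of x] by (simp add: ret_def good_def)
      qed
      then have "\<bar>w (\<sigma> j) x\<bar> powr p * ?q x (ret j x) \<le> \<bar>w (\<sigma> j) x\<bar> powr p * (2 * (h x - dist_to (F j) x))"
        by (rule mult_left_mono) simp
      then show "\<bar>w (\<sigma> j) x\<bar> powr p * ?q x (ret j x)
          \<le> 2 * (\<bar>w (\<sigma> j) x\<bar> powr p * dist_to E x - \<bar>w (\<sigma> j) x\<bar> powr p * dist_to (F j) x)"
        by (simp add: h_def algebra_simps)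
    qed
    also have "\<dots> = 2 * (spread (\<sigma> j) E - spread (\<sigma> j) (F j))"
      by (simp add: spread_def sum_distrib_left[symmetric] sum_subtractf)
    finally show ?thesis using spread[of j] by (simp add: F_def)
  qed
  define G where "G j = {x \<in> supp (\<sigma> j). good j x}" for j
  have hG: "0 < h g" if "g \<in> G j" for g j
    using that h0[of g] DF[of j g] by (auto simp: G_def good_def)
  have sepG: "h x / 2 < \<omega> x y" if "x \<in> G j" "y \<in> supp (\<sigma> i)" "i < j" for x y i j
  proof -
    have "y \<in> F j" using that by (auto simp: F_def)
    from dist_to_le[OF F(1) this, of x] that(1) show ?thesis by (auto simp: G_def good_def)
  qed
  \<comment> \<open>The Whitney-type neighbourhoods: the radius at \<open>g\<close> is proportional
    to its distance from \<open>E\<close>, and \<open>\<theta>\<close> will be random.\<close>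
  define V where "V \<theta> j = {x. \<exists>g\<in>G j. \<omega> x g < \<theta> * h g}" for \<theta> j
  have h_near: "h g \<le> 5 / 4 * h x" "h x \<le> 6 / 5 * h g"
    if "\<omega> x g < \<theta> * h g" "\<theta> \<le> 1 / 5" for x g \<theta>
  proof -
    have "\<theta> * h g \<le> 1 / 5 * h g" using that(2) h0 by (intro mult_right_mono) auto
    then show "h g \<le> 5 / 4 * h x" "h x \<le> 6 / 5 * h g"
      using that(1) h_tri[of x g] h_tri[of g x] commute[of g x] by auto
  qed
  \<comment> \<open>The bound \<open>1 / 5\<close> is what makes this work: a common point gives
    \<open>\<omega> g' g < (h g + h g') / 5\<close>, and with
    \<open>h g \<le> \<omega> g' g + h g'\<close> this yields
    \<open>\<omega> g' g < h g' / 2\<close>, against \<open>sepG\<close>. Different parameters are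
    allowed so that the \<open>j\<close> belonging to a point does not depend on
    \<open>\<theta>\<close>.\<close>
  have disj: "i = j" if x: "x \<in> V \<theta> i" "x \<in> V \<theta>' j" and \<theta>: "\<theta> \<le> 1 / 5" "\<theta>' \<le> 1 / 5" for x i j \<theta> \<theta>'
  proof -
    have False if x: "x \<in> V \<theta> i" "x \<in> V \<theta>' j" and \<theta>: "\<theta> \<le> 1 / 5" "\<theta>' \<le> 1 / 5" and ij: "i < j" for i j \<theta> \<theta>'
    proof -
      obtain g g' where g: "g \<in> G i" "\<omega> x g < \<theta> * h g" and g': "g' \<in> G j" "\<omega> x g' < \<theta>' * h g'"
        using x by (auto simp: V_def)
      have 1: "h g' / 2 < \<omega> g' g" using sepG[OF g'(1) _ ij] g(1) by (auto simp: G_def)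
      have "\<theta> * h g \<le> 1 / 5 * h g" "\<theta>' * h g' \<le> 1 / 5 * h g'"
        by (rule mult_right_mono[OF \<theta>(1) h0], rule mult_right_mono[OF \<theta>(2) h0])
      then have "\<omega> g' g < 1 / 5 * h g + 1 / 5 * h g'"
        using triangle[of g' g x] commute[of g' x] g(2) g'(2) by linarith
      then show False using 1 h_tri[of g g'] commute[of g g'] by linarith
    qed
    from this[OF x \<theta>] this[OF x(2,1) \<theta>(2,1)] show ?thesis by (cases i j rule: linorder_cases) auto
  qed
  have e0V: "e0 \<notin> V \<theta> j" if "\<theta> \<le> 1 / 5" for \<theta> j
  proof
    assume "e0 \<in> V \<theta> j"
    then obtain g where g: "g \<in> G j" "\<omega> e0 g < \<theta> * h g" by (auto simp: V_def)
    from h_near(1)[OF g(2) that] he0 hG[OF g(1)] show False by simp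
  qed
  have GV: "g \<in> V \<theta> j" if "g \<in> G j" "0 < \<theta>" for g \<theta> j
    using that hG[OF that(1)] by (auto simp: V_def intro!: bexI[of _ g])
  text \<open>The random cut: an edge at \<open>x\<close> is cut only for \<open>\<theta>\<close> in a short interval starting at \<open>\<tau> x\<close>.\<close>
  have "\<exists>\<tau>. \<forall>\<theta> y j. \<theta> \<le> 1 / 5 \<longrightarrow> x \<in> V \<theta> j \<longrightarrow> y \<notin> V \<theta> j \<longrightarrow>
      0 < h x \<and> \<tau> \<le> \<theta> \<and> \<theta> \<le> \<tau> + (6 / 5) * ?q x y / h x" for x
  proof (cases "\<exists>j \<theta>. \<theta> \<le> 1 / 5 \<and> x \<in> V \<theta> j")
    case False
    then show ?thesis by blast
  next
    case True
    then obtain j0 \<theta>0 where j0: "\<theta>0 \<le> 1 / 5" "x \<in> V \<theta>0 j0" by blast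
    \<comment> \<open>The point \<open>x\<close> lies in \<open>V \<theta> j0\<close> precisely when
      \<open>\<tau> < \<theta>\<close>.\<close>
    define \<tau> where "\<tau> = Min ((\<lambda>g. \<omega> x g / h g) ` G j0)"
    have G: "finite (G j0)" "G j0 \<noteq> {}" using finite_supp j0(2) by (auto simp: G_def V_def)
    have "\<tau> \<in> (\<lambda>g. \<omega> x g / h g) ` G j0" unfolding \<tau>_def using G by (intro Min_in) auto
    then obtain g where g: "g \<in> G j0" "\<tau> = \<omega> x g / h g" by auto
    have \<tau>_le: "\<tau> \<le> \<omega> x g' / h g'" if "g' \<in> G j0" for g'
      unfolding \<tau>_def using G that by (intro Min_le) auto
    have "0 < h x \<and> \<tau> \<le> \<theta> \<and> \<theta> \<le> \<tau> + (6 / 5) * ?q x y / h x"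
      if \<theta>: "\<theta> \<le> 1 / 5" "x \<in> V \<theta> j" "y \<notin> V \<theta> j" for \<theta> y j
    proof -
      have jj: "j = j0" using disj[OF \<theta>(2) j0(2) \<theta>(1) j0(1)] .
      obtain g' where g': "g' \<in> G j0" "\<omega> x g' < \<theta> * h g'" using \<theta>(2) by (auto simp: V_def jj)
      have "\<omega> x g' / h g' < \<theta>" using g'(2) hG[OF g'(1)] by (simp add: pos_divide_less_eq)
      then have \<tau>: "\<tau> < \<theta>" using \<tau>_le[OF g'(1)] by simp
      then have near: "\<omega> x g < \<theta> * h g" using hG[OF g(1)] g(2) by (simp add: pos_divide_less_eq)
      have hg: "0 < h g" by (rule hG[OF g(1)])
      have hx: "0 < h x" using h_near(1)[OF near \<theta>(1)] hg by simp
      have \<tau>0: "0 \<le> \<tau>" using g(2) hg by simp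
      \<comment> \<open>If the edge is realised directly, leaving the neighbourhood needs length at
        least \<open>(\<theta> - \<tau>) * h g\<close>, and \<open>h x \<le> 6 / 5 * h g\<close>. If
        it passes through \<open>E\<close>, its cost is already at least \<open>h x\<close>, which
        exceeds \<open>\<theta> * h x\<close>.\<close>
      have "\<theta> * h x \<le> \<tau> * h x + 6 / 5 * ?q x y"
      proof (cases "\<omega> x y \<le> h x + h y")
        case True
        then have q: "?q x y = \<omega> x y" by (simp add: quotient_cost_def h_def)
        have "\<theta> * h g \<le> \<omega> y g" using \<theta>(3) g(1) by (auto simp: V_def jj not_less)
        also have "\<dots> \<le> \<omega> x y + \<tau> * h g" using triangle[of y g x] commute[of x y] g(2) hg by simp
        finally have "(\<theta> - \<tau>) * h g \<le> \<omega> x y" by (simp add: algebra_simps)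
        moreover have "(\<theta> - \<tau>) * h x \<le> (\<theta> - \<tau>) * (6 / 5 * h g)"
          using h_near(2)[OF near \<theta>(1)] \<tau> by (intro mult_left_mono) auto
        ultimately show ?thesis unfolding q by (simp add: algebra_simps)
      next
        case False
        then have "h x \<le> ?q x y" using h0[of y] by (simp add: quotient_cost_def h_def)
        moreover have "\<theta> * h x \<le> 1 / 5 * h x" using \<theta>(1) hx by (intro mult_right_mono) auto
        moreover have "0 \<le> \<tau> * h x" using \<tau>0 hx by simp
        ultimately show ?thesis using hx by linarith
      qed
      then have "\<theta> \<le> \<tau> + (6 / 5) * ?q x y / h x" using hx by (simp add: field_simps)
      then show ?thesis using hx \<tau> by simp
    qed
    then show ?thesis by blast
  qed
  then obtain \<tau> where \<tau>: "\<And>x \<theta> y j. \<theta> \<le> 1 / 5 \<Longrightarrow> x \<in> V \<theta> j \<Longrightarrow> y \<notin> V \<theta> j \<Longrightarrow>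
      0 < h x \<and> \<tau> x \<le> \<theta> \<and> \<theta> \<le> \<tau> x + (6 / 5) * ?q x y / h x" by metis
  \<comment> \<open>The factor is \<open>25 = 1 + 24\<close>: an edge inside a neighbourhood is kept
    once, and each of its two ends contributes \<open>6 / 5\<close> times its cost, divided by the
    length \<open>1 / 10\<close> of the range of \<open>\<theta>\<close>. The choice of
    \<open>e / 50\<close> for the plan makes the total error
    \<open>25 * (e / 50) + e / 2 = e\<close>.\<close>
  have main: "(\<Sum>j<J. \<bar>a j\<bar> powr p * transport p ?q (w' j)) \<le> 25 * transport p ?q (\<Sum>j<J. a j *\<^sub>R w' j)" for J a
  proof (rule field_le_epsilon)
    fix e :: real assume e: "0 < e"
    let ?f = "\<Sum>j<J. a j *\<^sub>R w' j"
    have fb: "?f \<in> balanced" by (intro balanced_sum balanced_scale w')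
    have "0 < e / 50" using e by simp
    from transport_less[OF fb this] obtain l where
      l: "combination l = ?f" "cost p ?q l < transport p ?q ?f + e / 50" by blast
    define c x y where "c i = \<bar>fst (l ! i)\<bar> powr p" and "x i = fst (snd (l ! i))" and "y i = snd (snd (l ! i))" for i
    define n where "n = length l"
    have c0: "0 \<le> c i" for i by (simp add: c_def)
    have costl: "cost p ?q l = (\<Sum>i<n. c i * ?q (x i) (y i))"
      by (simp add: cost_eq_sum c_def x_def y_def n_def)
    define l1 where "l1 k = (if snd k then \<tau> (x (fst k)) else \<tau> (y (fst k)))" for k :: "nat \<times> bool"
    \<comment> \<open>The boolean selects the end of the edge, \<open>True\<close> for
      \<open>x\<close>. If \<open>hh k = 0\<close>, the division in \<open>dd\<close> yields 0,
      which is harmless because the weight is 0 as well.\<close>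
    define hh where "hh k = (if snd k then h (x (fst k)) else h (y (fst k)))" for k :: "nat \<times> bool"
    define dd where "dd k = (6 / 5) * ?q (x (fst k)) (y (fst k)) / hh k" for k :: "nat \<times> bool"
    have "\<exists>\<theta>\<in>{1 / 10..1 / 5}. (\<Sum>k\<in>{..<n} \<times> UNIV. (c (fst k) * hh k) * of_bool (l1 k \<le> \<theta> \<and> \<theta> \<le> l1 k + dd k))
        \<le> (\<Sum>k\<in>{..<n} \<times> UNIV. (c (fst k) * hh k) * dd k) / (1 / 5 - 1 / 10) + e / 2"
      by (rule exists_below_average) (use e c0 h0 q0 in \<open>auto simp: hh_def dd_def\<close>)
    then obtain \<theta> where \<theta>: "1 / 10 \<le> \<theta>" "\<theta> \<le> 1 / 5"
      and avg: "(\<Sum>k\<in>{..<n} \<times> UNIV. (c (fst k) * hh k) * of_bool (l1 k \<le> \<theta> \<and> \<theta> \<le> l1 k + dd k))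
        \<le> (\<Sum>k\<in>{..<n} \<times> UNIV. (c (fst k) * hh k) * dd k) / (1 / 5 - 1 / 10) + e / 2" by auto
    have "(\<Sum>k\<in>{..<n} \<times> UNIV. (c (fst k) * hh k) * dd k) \<le> (\<Sum>k\<in>{..<n} \<times> (UNIV :: bool set). 6 / 5 * (c (fst k) * ?q (x (fst k)) (y (fst k))))"
    proof (rule sum_mono)
      fix k :: "nat \<times> bool"
      show "(c (fst k) * hh k) * dd k \<le> 6 / 5 * (c (fst k) * ?q (x (fst k)) (y (fst k)))"
        using c0[of "fst k"] q0[of "x (fst k)" "y (fst k)"] by (cases "hh k = 0") (auto simp: dd_def)
    qed
    also have "\<dots> = (\<Sum>i<n. \<Sum>b\<in>(UNIV :: bool set). 6 / 5 * (c i * ?q (x i) (y i)))"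
      unfolding sum.cartesian_product by (simp only: case_prod_unfold)
    also have "\<dots> = 12 / 5 * cost p ?q l"
      unfolding costl sum_distrib_left by (intro sum.cong) (simp_all add: UNIV_bool)
    finally have avg': "(\<Sum>k\<in>{..<n} \<times> UNIV. (c (fst k) * hh k) * of_bool (l1 k \<le> \<theta> \<and> \<theta> \<le> l1 k + dd k))
        \<le> 24 * cost p ?q l + e / 2" using avg by simp
    \<comment> \<open>Sending everything outside \<open>V \<theta> j\<close> to \<open>e0\<close>
      isolates the \<open>j\<close>-th term: the good points of \<open>w' j\<close> stay, and those
      of the other terms lie in other neighbourhoods.\<close>
    define R where "R j x = (if x \<in> V \<theta> j then x else e0)" for j x
    have push_R: "push (R j) ?f = a j *\<^sub>R w' j" if j: "j < J" for j
    proof -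
      have ww: "push (R j) (w' i) = (if i = j then w' j else 0)" for i
      proof -
        have eq: "push (R j) (w' i) = push (\<lambda>x. R j (ret i x)) (w (\<sigma> i))"
          unfolding w'_def by (rule push_push[OF w])
        show ?thesis
        proof (cases "i = j")
          case True
          have "push (\<lambda>x. R j (ret i x)) (w (\<sigma> i)) = push (ret j) (w (\<sigma> i))"
          proof (rule push_cong)
            fix x assume "w (\<sigma> i) x \<noteq> 0"
            then have "x \<in> G j" if "good j x" using that True by (auto simp: G_def supp_def)
            then have "x \<in> V \<theta> j" if "good j x" using that GV \<theta> by auto
            then show "R j (ret i x) = ret j x"
              using e0V[OF \<theta>(2)] True by (auto simp: R_def ret_def)
          qed
          then show ?thesis using True eq by (simp add: w'_def)
        next
          case False
          have "push (\<lambda>x. R j (ret i x)) (w (\<sigma> i)) = push (\<lambda>x. e0) (w (\<sigma> i))"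
          proof (rule push_cong)
            fix x assume "w (\<sigma> i) x \<noteq> 0"
            then have "x \<in> G i" if "good i x" using that by (auto simp: G_def supp_def)
            then have "x \<in> V \<theta> i" if "good i x" using that GV \<theta> by auto
            then have "x \<notin> V \<theta> j" if "good i x" using that disj[OF _ _ \<theta>(2,2), of x i j] False by blast
            then show "R j (ret i x) = e0"
              using e0V[OF \<theta>(2)] by (auto simp: R_def ret_def)
          qed
          then show ?thesis using False eq push_const[OF w] by simp
        qed
      qed
      have "push (R j) ?f = (\<Sum>i<J. a i *\<^sub>R push (R j) (w' i))" by (rule push_sum[OF w'])
      also have "\<dots> = (\<Sum>i<J. if i = j then a j *\<^sub>R w' j else 0)"
        by (intro sum.cong) (auto simp: ww simp del: pointwise)
      also have "\<dots> = a j *\<^sub>R w' j" using j by simp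
      finally show ?thesis .
    qed
    \<comment> \<open>The neighbourhoods are disjoint, so an edge lies inside at most one of them,
      and each of its ends is cut off by at most one. A cut edge then joins its inner end to
      \<open>e0\<close> and costs at most \<open>h\<close> of that end.\<close>
    have edge: "(\<Sum>j<J. ?q (R j (x i)) (R j (y i))) \<le> ?q (x i) (y i)
        + h (x i) * of_bool (l1 (i, True) \<le> \<theta> \<and> \<theta> \<le> l1 (i, True) + dd (i, True))
        + h (y i) * of_bool (l1 (i, False) \<le> \<theta> \<and> \<theta> \<le> l1 (i, False) + dd (i, False))" for i
    proof -
      define X Y where "X j \<longleftrightarrow> x i \<in> V \<theta> j" and "Y j \<longleftrightarrow> y i \<in> V \<theta> j" for j
      have uni: "j = k" if "X j" "X k" for j k using disj[OF _ _ \<theta>(2,2)] that unfolding X_def by blast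
      have uni': "j = k" if "Y j" "Y k" for j k using disj[OF _ _ \<theta>(2,2)] that unfolding Y_def by blast
      have "(\<Sum>j<J. ?q (R j (x i)) (R j (y i)))
          \<le> (\<Sum>j<J. ?q (x i) (y i) * of_bool (X j \<and> Y j) + h (x i) * of_bool (X j \<and> \<not> Y j)
            + h (y i) * of_bool (Y j \<and> \<not> X j))"
        by (intro sum_mono) (auto simp: R_def X_def Y_def q_e0 q_e00)
      also have "\<dots> = ?q (x i) (y i) * (\<Sum>j<J. of_bool (X j \<and> Y j)) + h (x i) * (\<Sum>j<J. of_bool (X j \<and> \<not> Y j))
            + h (y i) * (\<Sum>j<J. of_bool (Y j \<and> \<not> X j))"
        by (simp only: sum.distrib sum_distrib_left)
      also have "\<dots> \<le> ?q (x i) (y i) * of_bool (\<exists>j\<in>{..<J}. X j \<and> Y j)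
          + h (x i) * of_bool (\<exists>j\<in>{..<J}. X j \<and> \<not> Y j) + h (y i) * of_bool (\<exists>j\<in>{..<J}. Y j \<and> \<not> X j)"
        using uni uni' by (intro add_mono mult_left_mono q0 h0 sum_of_bool_le_of_bool) auto
      also have "\<dots> \<le> ?q (x i) (y i) * 1
          + h (x i) * of_bool (l1 (i, True) \<le> \<theta> \<and> \<theta> \<le> l1 (i, True) + dd (i, True))
          + h (y i) * of_bool (l1 (i, False) \<le> \<theta> \<and> \<theta> \<le> l1 (i, False) + dd (i, False))"
      proof -
        have qc: "?q (y i) (x i) = ?q (x i) (y i)" using commute[of "x i" "y i"] by (simp add: quotient_cost_def)
        have "l1 (i, True) \<le> \<theta> \<and> \<theta> \<le> l1 (i, True) + dd (i, True)" if "X j \<and> \<not> Y j" for j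
          using \<tau>[OF \<theta>(2), of "x i" j "y i"] that by (simp add: X_def Y_def l1_def dd_def hh_def)
        moreover have "l1 (i, False) \<le> \<theta> \<and> \<theta> \<le> l1 (i, False) + dd (i, False)" if "Y j \<and> \<not> X j" for j
          using \<tau>[OF \<theta>(2), of "y i" j "x i"] that by (simp add: X_def Y_def l1_def dd_def hh_def qc)
        ultimately show ?thesis
          by (intro add_mono mult_left_mono q0 h0) (auto simp only: of_bool_def split: if_splits)
      qed
      finally show ?thesis by simp
    qed
    have "(\<Sum>j<J. \<bar>a j\<bar> powr p * transport p ?q (w' j)) = (\<Sum>j<J. transport p ?q (push (R j) (combination l)))"
      using Q.scale[OF w'] push_R l(1) by (intro sum.cong) auto
    also have "\<dots> \<le> (\<Sum>j<J. cost p ?q (map (\<lambda>(a, x, y). (a, R j x, R j y)) l))"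
      unfolding push_combination by (intro sum_mono transport_le q0)
    also have "\<dots> = (\<Sum>j<J. \<Sum>i<n. c i * ?q (R j (x i)) (R j (y i)))"
      unfolding cost_map_push by (simp only: cost_eq_sum c_def x_def y_def n_def)
    also have "\<dots> = (\<Sum>i<n. \<Sum>j<J. c i * ?q (R j (x i)) (R j (y i)))" by (rule sum.swap)
    also have "\<dots> = (\<Sum>i<n. c i * (\<Sum>j<J. ?q (R j (x i)) (R j (y i))))" by (simp only: sum_distrib_left)
    also have "\<dots> \<le> (\<Sum>i<n. c i * (?q (x i) (y i)
        + h (x i) * of_bool (l1 (i, True) \<le> \<theta> \<and> \<theta> \<le> l1 (i, True) + dd (i, True))
        + h (y i) * of_bool (l1 (i, False) \<le> \<theta> \<and> \<theta> \<le> l1 (i, False) + dd (i, False))))"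
      by (intro sum_mono mult_left_mono edge c0)
    also have "\<dots> = cost p ?q l + (\<Sum>i<n. c i * h (x i) * of_bool (l1 (i, True) \<le> \<theta> \<and> \<theta> \<le> l1 (i, True) + dd (i, True))
        + c i * h (y i) * of_bool (l1 (i, False) \<le> \<theta> \<and> \<theta> \<le> l1 (i, False) + dd (i, False)))"
      unfolding costl sum.distrib[symmetric] by (intro sum.cong refl) (simp add: algebra_simps)
    also have "(\<Sum>i<n. c i * h (x i) * of_bool (l1 (i, True) \<le> \<theta> \<and> \<theta> \<le> l1 (i, True) + dd (i, True))
        + c i * h (y i) * of_bool (l1 (i, False) \<le> \<theta> \<and> \<theta> \<le> l1 (i, False) + dd (i, False)))
        = (\<Sum>i<n. \<Sum>b\<in>UNIV. (c i * hh (i, b)) * of_bool (l1 (i, b) \<le> \<theta> \<and> \<theta> \<le> l1 (i, b) + dd (i, b)))"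
      by (intro sum.cong refl) (simp add: UNIV_bool hh_def add.commute)
    also have "\<dots> = (\<Sum>k\<in>{..<n} \<times> UNIV. (c (fst k) * hh k) * of_bool (l1 k \<le> \<theta> \<and> \<theta> \<le> l1 k + dd k))"
      unfolding sum.cartesian_product by (simp only: case_prod_unfold prod.collapse)
    also have "\<dots> \<le> 24 * cost p ?q l + e / 2" by (rule avg')
    finally show "(\<Sum>j<J. \<bar>a j\<bar> powr p * transport p ?q (w' j)) \<le> 25 * transport p ?q ?f + e"
      using l(2) by simp
  qed
  have "r / 200 * (\<Sum>j<J. \<bar>a j\<bar> powr p) \<le> transport p \<omega> (\<Sum>j<J. a j *\<^sub>R w (\<sigma> j))" for J a
  proof -
    let ?s = "\<Sum>j<J. \<bar>a j\<bar> powr p"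
    let ?f = "\<Sum>j<J. a j *\<^sub>R w (\<sigma> j)" and ?f' = "\<Sum>j<J. a j *\<^sub>R w' j"
    have f: "?f \<in> balanced" "?f' \<in> balanced"
      by (intro balanced_sum balanced_scale w w')+
    have far': "r / 4 \<le> transport p ?q (w' j)" for j
      using far[of j] loss[of j] Q.diff_ge'[OF w w', of "\<sigma> j" j] Q.triangle[OF balanced_diff[OF w w'] w', of "\<sigma> j" j j] r_pos
      by simp
    have "?s * (r / 4) \<le> (\<Sum>j<J. \<bar>a j\<bar> powr p * transport p ?q (w' j))"
      unfolding sum_distrib_right by (intro sum_mono mult_left_mono far') auto
    then have 1: "?s * (r / 4) \<le> 25 * transport p ?q ?f'" using main[of a J] by simp
    have "transport p ?q (?f - ?f') = transport p ?q (\<Sum>j<J. a j *\<^sub>R (w (\<sigma> j) - w' j))"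
      by (simp only: scaleR_diff_right sum_subtractf)
    also have "\<dots> \<le> (\<Sum>j<J. \<bar>a j\<bar> powr p * transport p ?q (w (\<sigma> j) - w' j))"
      by (intro Q.sum_le balanced_diff w w')
    also have "\<dots> \<le> ?s * (r / 200)"
      unfolding sum_distrib_right by (intro sum_mono mult_left_mono loss) auto
    finally have 2: "transport p ?q (?f - ?f') \<le> ?s * (r / 200)" .
    have "transport p ?q ?f' \<le> transport p ?q ?f + transport p ?q (?f - ?f')"
      using Q.diff_ge'[OF f(2,1)] Q.diff_commute[OF f] by simp
    then have "?s * (r / 100) - ?s * (r / 200) \<le> transport p ?q ?f"
      using 1 2 unfolding times_divide_eq_right by linarith
    also have "\<dots> \<le> transport p \<omega> ?f"
      by (rule transport_mono[OF f(1) q0]) (simp add: quotient_cost_def)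
    finally show ?thesis by (simp add: mult.commute)
  qed
  then show ?thesis using \<sigma> by blast
qed

end

section \<open>From separation at one scale to functions of bounded mass\<close>

context snowflake
begin

text \<open>The elements are split again, at a scale \<open>s\<close> much smaller than the
  separating one. The short part is negligible for the cost truncated at the separating scale, and
  the long part has bounded mass because the snowflake norms are bounded.\<close>

theorem lp_lower_bound_of_scale_separated:
  assumes x: "\<And>n. x n \<in> balanced" and B: "\<And>n. snow_norm (x n) \<le> B" and r: "0 < r"
    and sep: "\<And>i j. i \<noteq> j \<Longrightarrow> r \<le> scale_norm k (x i - x j)"
  shows "\<exists>c>0. \<exists>\<sigma> :: nat \<Rightarrow> nat. strict_mono \<sigma> \<and>
    (\<forall>J a. c * (\<Sum>j<J. \<bar>a j\<bar> powr p) \<le> snow_norm (\<Sum>j<J. a j *\<^sub>R x (\<sigma> j)))"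
proof -
  define t where "t = 2 powr real_of_int k"
  have t: "0 < t" by (simp add: t_def)
  \<comment> \<open>Up to the factor \<open>t powr \<alpha>\<close> this is the window at
    \<open>t\<close>, in the form of a pseudometric bounded by 1.\<close>
  define \<omega> where "\<omega> x y = min (\<rho> x y / t) 1" for x y
  interpret O: bounded_pseudometric \<omega> p
  proof
    show "\<omega> x x = 0" "\<omega> x y = \<omega> y x" "\<omega> x y \<le> 1" for x y by (auto simp: \<omega>_def commute)
    show "\<omega> x z \<le> \<omega> x y + \<omega> y z" for x y z
    proof -
      have "\<rho> x z / t \<le> \<rho> x y / t + \<rho> y z / t"
        using triangle[of x z y] t by (simp add: add_divide_distrib[symmetric] divide_right_mono)
      moreover have "0 \<le> \<rho> x y / t" "0 \<le> \<rho> y z / t" using t by auto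
      ultimately show ?thesis unfolding \<omega>_def by linarith
    qed
  qed (use p in auto)
  interpret T: p_seminorm p balanced "transport p \<omega>" by (rule O.p_seminorm_transport_metric)
  have tt: "t powr \<alpha> = t powr (\<alpha> - 1) * t"
    using powr_mult_base[of t "\<alpha> - 1"] t by (simp add: mult.commute)
  have win: "window t x y = t powr \<alpha> * \<omega> x y" for x y
  proof -
    have "t powr \<alpha> * (\<rho> x y / t) = t powr (\<alpha> - 1) * \<rho> x y" using t by (simp add: tt)
    then show ?thesis using t by (simp add: window_def \<omega>_def min_mult_distrib_left)
  qed
  have W1: "scale_norm k f \<le> t powr \<alpha> * transport p \<omega> f" if "f \<in> balanced" for f
    unfolding scale_norm_def t_def[symmetric]
    by (rule transport_scale_cost_le[OF that]) (use t in \<open>auto simp: win\<close>)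
  have win_le: "window s x y \<le> \<rho> x y powr \<alpha>" if s: "0 < s" for s x y
  proof (cases "\<rho> x y \<le> s")
    case True
    show ?thesis
    proof (cases "\<rho> x y = 0")
      case False
      then have pos: "0 < \<rho> x y" using nonneg[of x y] by linarith
      have "window s x y \<le> s powr (\<alpha> - 1) * \<rho> x y" by (simp add: window_def)
      also have "\<dots> \<le> \<rho> x y powr (\<alpha> - 1) * \<rho> x y"
        using True pos \<alpha> by (intro mult_right_mono powr_mono2') auto
      also have "\<dots> = \<rho> x y powr \<alpha>"
        using powr_mult_base[of "\<rho> x y" "\<alpha> - 1"] pos by (simp add: mult.commute)
      finally show ?thesis .
    qed (simp add: window_def)
  next
    case False
    have "window s x y \<le> s powr \<alpha>" by (simp add: window_def)
    also have "\<dots> \<le> \<rho> x y powr \<alpha>" using False s \<alpha> by (intro powr_mono2) auto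
    finally show ?thesis .
  qed
  have W2: "t powr \<alpha> * transport p \<omega> f \<le> snow_norm f" if "f \<in> balanced" for f
  proof -
    have "transport p \<omega> f \<le> (1 / t powr \<alpha>) * snow_norm f"
    proof (rule transport_scale_cost_le[OF that])
      show "\<omega> x y \<le> 1 / t powr \<alpha> * \<rho> x y powr \<alpha>" for x y
        using win_le[OF t, of x y] t by (simp add: win field_simps)
    qed (use t in auto)
    then show ?thesis using t by (simp add: field_simps)
  qed
  define r' where "r' = r / t powr \<alpha>"
  have r': "0 < r'" using r t by (simp add: r'_def)
  have sep': "r' \<le> transport p \<omega> (x i - x j)" if "i \<noteq> j" for i j
  proof -
    have "r \<le> t powr \<alpha> * transport p \<omega> (x i - x j)"
      using sep[OF that] W1[OF balanced_diff[OF x x], of i j] by simp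
    then show ?thesis using t by (simp add: r'_def pos_divide_le_eq mult.commute)
  qed
  have B0: "0 \<le> B" using B[of 0] p_seminorm.nonneg[OF p_seminorm_snow x, of 0] by simp
  \<comment> \<open>Chosen such that \<open>s powr (1 - \<alpha>) * (B + 1) / t = r' / 1000\<close>.
    Subtracting the parts \<open>u\<close> costs at most \<open>2 * r' / 1000\<close> of the
    separation, which remains above \<open>r' / 2\<close>.\<close>
  define s where "s = (r' * t / (1000 * (B + 1))) powr (1 / (1 - \<alpha>))"
  have s: "0 < s" using r' t B0 by (simp add: s_def)
  have s_powr: "s powr (1 - \<alpha>) = r' * t / (1000 * (B + 1))"
    using r' t B0 \<alpha> by (simp add: s_def powr_powr)
  have "\<exists>u w. u \<in> balanced \<and> w \<in> balanced \<and> x n = u + w \<and> mass p w \<le> 2 * (s powr - \<alpha> * (B + 1)) \<and>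
      transport p \<omega> u \<le> r' / 1000" for n
  proof -
    obtain u w where uw: "u \<in> balanced" "w \<in> balanced" "x n = u + w"
      "mass p w \<le> 2 * (s powr - \<alpha> * (transport p (window s) (x n) + 1))"
      "transport p \<rho> u \<le> s powr (1 - \<alpha>) * (transport p (window s) (x n) + 1)"
      using split_at_scale[OF x s zero_less_one] .
    have le: "transport p (window s) (x n) + 1 \<le> B + 1"
      using transport_mono[OF x, of "window s" "\<lambda>x y. \<rho> x y powr \<alpha>" p n] win_le[OF s] B[of n] by simp
    have "mass p w \<le> 2 * (s powr - \<alpha> * (B + 1))"
      using uw(4) le by (smt (verit) mult_left_mono powr_ge_zero)
    moreover have "transport p \<omega> u \<le> r' / 1000"
    proof -
      have "transport p \<omega> u \<le> (1 / t) * transport p \<rho> u"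
        by (rule transport_scale_cost_le[OF uw(1)]) (use t in \<open>auto simp: \<omega>_def\<close>)
      also have "\<dots> \<le> (1 / t) * (s powr (1 - \<alpha>) * (B + 1))"
        using order_trans[OF uw(5) mult_left_mono[OF le]] t by (intro mult_left_mono) auto
      also have "\<dots> = r' / 1000"
      proof -
        have "1 / t * (r' * t / (1000 * b) * b) = r' / 1000" if "b \<noteq> 0" for b
          using t that by simp
        from this[of "B + 1"] show ?thesis using B0 unfolding s_powr by simp
      qed
      finally show ?thesis .
    qed
    ultimately show ?thesis using uw by blast
  qed
  then obtain u w where uw: "\<And>n. u n \<in> balanced" "\<And>n. w n \<in> balanced" "\<And>n. x n = u n + w n"
    "\<And>n. mass p (w n) \<le> 2 * (s powr - \<alpha> * (B + 1))" "\<And>n. transport p \<omega> (u n) \<le> r' / 1000" by metis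
  interpret S: separated_sequence \<omega> p w "2 * (s powr - \<alpha> * (B + 1))" "r' / 2"
  proof
    show "r' / 2 \<le> transport p \<omega> (w i - w j)" if "i \<noteq> j" for i j
    proof -
      have "x i - x j = (w i - w j) + (u i - u j)" by (simp add: uw(3))
      then have "transport p \<omega> (x i - x j) \<le> transport p \<omega> (w i - w j) + transport p \<omega> (u i - u j)"
        using T.triangle[OF balanced_diff[OF uw(2) uw(2)] balanced_diff[OF uw(1) uw(1)]]
        by metis
      then show ?thesis using sep'[OF that] T.diff_le[OF uw(1) uw(1), of i j] uw(5)[of i] uw(5)[of j] r' by simp
    qed
  qed (use uw r' in auto)
  obtain \<sigma> :: "nat \<Rightarrow> nat" where \<sigma>: "strict_mono \<sigma>"
    "\<And>J a. r' / 2 / 200 * (\<Sum>j<J. \<bar>a j\<bar> powr p) \<le> transport p \<omega> (\<Sum>j<J. a j *\<^sub>R w (\<sigma> j))"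
    using S.lp_lower_bound by blast
  \<comment> \<open>The long parts give \<open>r' / 400\<close>, the short parts take away
    \<open>r' / 1000\<close>, and the factor \<open>t powr \<alpha>\<close> turns \<open>r'\<close>
    back into \<open>r\<close>.\<close>
  have "r / 1000 * (\<Sum>j<J. \<bar>a j\<bar> powr p) \<le> snow_norm (\<Sum>j<J. a j *\<^sub>R x (\<sigma> j))" for J a
  proof -
    let ?s = "\<Sum>j<J. \<bar>a j\<bar> powr p"
    let ?w = "\<Sum>j<J. a j *\<^sub>R w (\<sigma> j)" and ?u = "\<Sum>j<J. a j *\<^sub>R u (\<sigma> j)" and ?x = "\<Sum>j<J. a j *\<^sub>R x (\<sigma> j)"
    have bal: "?w \<in> balanced" "?u \<in> balanced" "?x \<in> balanced"
      by (intro balanced_sum balanced_scale uw x)+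
    have eq: "?x = ?w + ?u" by (simp only: uw(3) scaleR_add_right sum.distrib add.commute)
    have "transport p \<omega> ?u \<le> (\<Sum>j<J. \<bar>a j\<bar> powr p * transport p \<omega> (u (\<sigma> j)))" by (rule T.sum_le[OF uw(1)])
    also have "\<dots> \<le> ?s * (r' / 1000)"
      unfolding sum_distrib_right by (intro sum_mono mult_left_mono uw) auto
    finally have 1: "transport p \<omega> ?u \<le> ?s * (r' / 1000)" .
    have s0: "0 \<le> ?s * r'" using r' by (intro mult_nonneg_nonneg sum_nonneg) auto
    have "transport p \<omega> ?w - transport p \<omega> ?u \<le> transport p \<omega> ?x"
      unfolding eq by (rule T.diff_ge[OF bal(1,2)])
    then have "?s * (r' / 1000) \<le> transport p \<omega> ?x" using \<sigma>(2)[of a J] 1 s0 by (simp add: mult.commute)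
    then have "t powr \<alpha> * (?s * (r' / 1000)) \<le> t powr \<alpha> * transport p \<omega> ?x" by (intro mult_left_mono) auto
    also have "\<dots> \<le> snow_norm ?x" by (rule W2[OF bal(3)])
    finally show ?thesis using t by (simp add: r'_def mult.commute)
  qed
  then show ?thesis using \<sigma>(1) r by (intro exI[of _ "r / 1000"] conjI exI[of _ \<sigma>]) auto
qed

end

section \<open>Completion of a \<open>p\<close>-seminorm\<close>

context p_seminorm
begin

definition cauchy_seqs :: "(nat \<Rightarrow> 'v) set"
  where "cauchy_seqs = {s. (\<forall>n. s n \<in> V) \<and> (\<forall>e>0. \<exists>k. \<forall>m\<ge>k. \<forall>n\<ge>k. P (s m - s n) < e)}"

definition lim_norm :: "(nat \<Rightarrow> 'v) \<Rightarrow> real"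
  where "lim_norm s = lim (\<lambda>n. P (s n))"

lemma tendsto_lim_norm:
  assumes "s \<in> cauchy_seqs"
  shows "(\<lambda>n. P (s n)) \<longlonglongrightarrow> lim_norm s"
proof -
  have s: "s n \<in> V" for n using assms by (simp add: cauchy_seqs_def)
  have "\<bar>P (s m) - P (s n)\<bar> \<le> P (s m - s n)" for m n
    using diff_ge'[OF s[of m] s[of n]] diff_ge'[OF s[of n] s[of m]] diff_commute[OF s[of m] s[of n]] by linarith
  then have "Cauchy (\<lambda>n. P (s n))"
    using assms unfolding Cauchy_def cauchy_seqs_def dist_real_def mem_Collect_eq by (meson order_le_less_trans)
  then show ?thesis
    unfolding lim_norm_def by (simp add: real_Cauchy_convergent convergent_LIMSEQ_iff[symmetric])
qed

lemma lim_norm_le: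
  assumes "s \<in> cauchy_seqs" "\<And>n. k \<le> n \<Longrightarrow> P (s n) \<le> t"
  shows "lim_norm s \<le> t"
  by (rule LIMSEQ_le_const2[OF tendsto_lim_norm[OF assms(1)]]) (use assms(2) in blast)

lemma const_cauchy: "v \<in> V \<Longrightarrow> (\<lambda>_. v) \<in> cauchy_seqs"
  by (auto simp: cauchy_seqs_def zero)

lemma lim_norm_const: "lim_norm (\<lambda>_. v) = P v"
  by (simp add: lim_norm_def)

lemma p_seminorm_lim_norm: "p_seminorm p cauchy_seqs lim_norm"
proof
  show sub: "subspace cauchy_seqs"
    unfolding subspace_def
  proof (intro conjI ballI allI)
    show "0 \<in> cauchy_seqs" using subspace_0[OF subspace] by (auto simp: cauchy_seqs_def zero)
    fix s s' assume s: "s \<in> cauchy_seqs" "s' \<in> cauchy_seqs"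
    then have V: "s n \<in> V" "s' n \<in> V" for n by (auto simp: cauchy_seqs_def)
    have "\<exists>k. \<forall>m\<ge>k. \<forall>n\<ge>k. P ((s + s') m - (s + s') n) < e" if "0 < e" for e
    proof -
      have "0 < e / 2" using that by simp
      then obtain k where k: "\<And>m n. k \<le> m \<Longrightarrow> k \<le> n \<Longrightarrow> P (s m - s n) < e / 2"
        using s(1) unfolding cauchy_seqs_def by blast
      obtain k' where k': "\<And>m n. k' \<le> m \<Longrightarrow> k' \<le> n \<Longrightarrow> P (s' m - s' n) < e / 2"
        using s(2) \<open>0 < e / 2\<close> unfolding cauchy_seqs_def by blast
      have "P ((s + s') m - (s + s') n) < e" if "max k k' \<le> m" "max k k' \<le> n" for m n
      proof -
        have "P ((s + s') m - (s + s') n) = P ((s m - s n) + (s' m - s' n))" by (simp add: algebra_simps)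
        also have "\<dots> \<le> P (s m - s n) + P (s' m - s' n)" by (intro triangle subspace_diff[OF subspace] V)
        also have "\<dots> < e" using k[of m n] k'[of m n] that by simp
        finally show ?thesis .
      qed
      then show ?thesis by blast
    qed
    moreover have "(s + s') n \<in> V" for n using subspace_add[OF subspace V, of n n] by simp
    ultimately show "s + s' \<in> cauchy_seqs" unfolding cauchy_seqs_def by blast
  next
    fix s :: "nat \<Rightarrow> 'v" and a :: real assume s: "s \<in> cauchy_seqs"
    then have V: "s n \<in> V" for n by (auto simp: cauchy_seqs_def)
    have "\<exists>k. \<forall>m\<ge>k. \<forall>n\<ge>k. P ((a *\<^sub>R s) m - (a *\<^sub>R s) n) < e" if "0 < e" for e
    proof -
      have pos: "0 < \<bar>a\<bar> powr p + 1" by (simp add: add_nonneg_pos)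
      then have "0 < e / (\<bar>a\<bar> powr p + 1)" using that by simp
      then obtain k where k: "\<And>m n. k \<le> m \<Longrightarrow> k \<le> n \<Longrightarrow> P (s m - s n) < e / (\<bar>a\<bar> powr p + 1)"
        using s unfolding cauchy_seqs_def by blast
      have "P ((a *\<^sub>R s) m - (a *\<^sub>R s) n) < e" if "k \<le> m" "k \<le> n" for m n
      proof -
        have "P ((a *\<^sub>R s) m - (a *\<^sub>R s) n) = \<bar>a\<bar> powr p * P (s m - s n)"
          using scale[OF subspace_diff[OF subspace V V]] by (simp add: scaleR_fun_def scaleR_diff_right[symmetric])
        also have "\<dots> \<le> (\<bar>a\<bar> powr p + 1) * P (s m - s n)"
          using nonneg[OF subspace_diff[OF subspace V V]] by (intro mult_right_mono) auto
        also have "\<dots> < e" using k[OF that] pos by (simp add: pos_less_divide_eq mult.commute)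
        finally show ?thesis .
      qed
      then show ?thesis by blast
    qed
    moreover have "(a *\<^sub>R s) n \<in> V" for n
      using subspace_scale[OF subspace V, of a n] by (simp add: scaleR_fun_def)
    ultimately show "a *\<^sub>R s \<in> cauchy_seqs" unfolding cauchy_seqs_def by blast
  qed
  show "0 \<le> lim_norm s" if "s \<in> cauchy_seqs" for s
    by (rule LIMSEQ_le_const[OF tendsto_lim_norm[OF that]]) (use that in \<open>auto simp: cauchy_seqs_def nonneg\<close>)
  show "lim_norm (s + s') \<le> lim_norm s + lim_norm s'" if "s \<in> cauchy_seqs" "s' \<in> cauchy_seqs" for s s'
  proof (rule LIMSEQ_le[OF tendsto_lim_norm tendsto_add[OF tendsto_lim_norm tendsto_lim_norm]])
    show "s + s' \<in> cauchy_seqs" by (rule subspace_add[OF sub that])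
    show "\<exists>N. \<forall>n\<ge>N. P ((s + s') n) \<le> P (s n) + P (s' n)"
      using that by (auto simp: cauchy_seqs_def intro!: triangle)
  qed (use that in auto)
  show "lim_norm (a *\<^sub>R s) = \<bar>a\<bar> powr p * lim_norm s" if "s \<in> cauchy_seqs" for s a
  proof (rule LIMSEQ_unique[OF tendsto_lim_norm[OF subspace_scale[OF sub that]]])
    have "(\<lambda>n. P ((a *\<^sub>R s) n)) = (\<lambda>n. \<bar>a\<bar> powr p * P (s n))"
      using that by (auto simp: cauchy_seqs_def scaleR_fun_def scale)
    then show "(\<lambda>n. P ((a *\<^sub>R s) n)) \<longlonglongrightarrow> \<bar>a\<bar> powr p * lim_norm s"
      using tendsto_mult_left[OF tendsto_lim_norm[OF that], of "\<bar>a\<bar> powr p"] by simp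
  qed
qed (rule p_pos)

text \<open>Diagonal argument: the \<open>j\<close>-th Cauchy sequence is approximated by one of its
  own entries, up to \<open>1 / (j + 1)\<close>, and these entries form the limit.\<close>

lemma cauchy_seqs_complete:
  assumes \<tau>: "\<And>j::nat. \<tau> j \<in> cauchy_seqs"
    and cauchy: "\<And>e. 0 < e \<Longrightarrow> \<exists>k. \<forall>m\<ge>k. \<forall>n\<ge>k. lim_norm (\<tau> m - \<tau> n) < e"
  shows "\<exists>F\<in>cauchy_seqs. (\<lambda>j. lim_norm (\<tau> j - F)) \<longlonglongrightarrow> 0"
proof -
  interpret L: p_seminorm p cauchy_seqs lim_norm by (rule p_seminorm_lim_norm)
  have "\<exists>v\<in>V. lim_norm (\<tau> j - (\<lambda>_. v)) \<le> 1 / (real j + 1)" for j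
  proof -
    have "0 < 1 / (real j + 1)" by simp
    then obtain k where k: "\<And>m n. k \<le> m \<Longrightarrow> k \<le> n \<Longrightarrow> P (\<tau> j m - \<tau> j n) < 1 / (real j + 1)"
      using \<tau>[of j] unfolding cauchy_seqs_def by blast
    have v: "\<tau> j k \<in> V" using \<tau>[of j] by (simp add: cauchy_seqs_def)
    have "lim_norm (\<tau> j - (\<lambda>_. \<tau> j k)) \<le> 1 / (real j + 1)"
      by (rule lim_norm_le[OF subspace_diff[OF L.subspace \<tau> const_cauchy[OF v]], of k])
        (use k[of _ k] in \<open>auto intro: less_imp_le\<close>)
    then show ?thesis using v by blast
  qed
  then obtain F where F: "\<And>j. F j \<in> V" "\<And>j. lim_norm (\<tau> j - (\<lambda>_. F j)) \<le> 1 / (real j + 1)" by metis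
  have small: "\<exists>k. \<forall>j\<ge>k. 1 / (real j + 1) < e" if e: "0 < e" for e :: real
  proof -
    obtain k where k: "1 / e < real k" using reals_Archimedean2 by blast
    have "1 / (real j + 1) < e" if "k \<le> j" for j
    proof -
      have "1 / e < real j + 1" using k that by linarith
      then show ?thesis using e by (simp add: field_simps)
    qed
    then show ?thesis by blast
  qed
  have diff: "P (F i - F j) \<le> 1 / (real i + 1) + lim_norm (\<tau> i - \<tau> j) + 1 / (real j + 1)" for i j
  proof -
    have c: "(\<lambda>_. F j) \<in> cauchy_seqs" for j by (rule const_cauchy[OF F(1)])
    have "P (F i - F j) = lim_norm ((\<lambda>_. F i) - (\<lambda>_. F j))"
      by (simp add: fun_diff_def lim_norm_const)
    also have "\<dots> \<le> lim_norm ((\<lambda>_. F i) - \<tau> i) + lim_norm (\<tau> i - (\<lambda>_. F j))"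
      by (rule L.diff_triangle[OF c \<tau> c])
    also have "lim_norm (\<tau> i - (\<lambda>_. F j)) \<le> lim_norm (\<tau> i - \<tau> j) + lim_norm (\<tau> j - (\<lambda>_. F j))"
      by (rule L.diff_triangle[OF \<tau> \<tau> c])
    also have "lim_norm ((\<lambda>_. F i) - \<tau> i) = lim_norm (\<tau> i - (\<lambda>_. F i))" by (rule L.diff_commute[OF c \<tau>])
    finally show ?thesis using F(2)[of i] F(2)[of j] by linarith
  qed
  have close: "\<exists>k. \<forall>i\<ge>k. \<forall>j\<ge>k. P (F i - F j) < e" if e: "0 < e" for e
  proof -
    have e3: "0 < e / 3" using e by simp
    obtain k k' where k: "\<And>j. k \<le> j \<Longrightarrow> 1 / (real j + 1) < e / 3"
      "\<And>i j. k' \<le> i \<Longrightarrow> k' \<le> j \<Longrightarrow> lim_norm (\<tau> i - \<tau> j) < e / 3"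
      using small[OF e3] cauchy[OF e3] by blast
    have "P (F i - F j) < e" if "max k k' \<le> i" "max k k' \<le> j" for i j
      using diff[of i j] k(1)[of i] k(1)[of j] k(2)[of i j] that by simp
    then show ?thesis by blast
  qed
  then have FC: "F \<in> cauchy_seqs" using F(1) by (simp add: cauchy_seqs_def)
  have "(\<lambda>j. lim_norm (\<tau> j - F)) \<longlonglongrightarrow> 0"
  proof (rule LIMSEQ_I)
    fix e :: real assume e: "0 < e"
    then have e3: "0 < e / 3" by simp
    obtain k k' where k: "\<And>j. k \<le> j \<Longrightarrow> 1 / (real j + 1) < e / 3"
      "\<And>i j. k' \<le> i \<Longrightarrow> k' \<le> j \<Longrightarrow> P (F i - F j) < e / 3"
      using small[OF e3] close[OF e3] by blast
    have "norm (lim_norm (\<tau> j - F) - 0) < e" if j: "max k k' \<le> j" for j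
    proof -
      have c: "(\<lambda>_. F j) \<in> cauchy_seqs" by (rule const_cauchy[OF F(1)])
      have tri: "lim_norm (\<tau> j - F) \<le> lim_norm (\<tau> j - (\<lambda>_. F j)) + lim_norm ((\<lambda>_. F j) - F)"
        by (rule L.diff_triangle[OF \<tau> c FC])
      have third: "lim_norm ((\<lambda>_. F j) - F) \<le> e / 3"
        by (rule lim_norm_le[OF subspace_diff[OF L.subspace c FC], of k'])
          (use k(2)[of j] j in \<open>auto intro: less_imp_le\<close>)
      have "1 / (real j + 1) < e / 3" using k(1) j by simp
      then have "1 / (real j + 1) + e / 3 < e" using e by linarith
      then have "lim_norm (\<tau> j - F) < e"
        by (rule order_le_less_trans[OF order_trans[OF tri add_mono[OF F(2) third]]])
      then show ?thesis using L.nonneg[OF subspace_diff[OF L.subspace \<tau> FC]] by simp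
    qed
    then show "\<exists>k. \<forall>j\<ge>k. norm (lim_norm (\<tau> j - F) - 0) < e" by blast
  qed
  then show ?thesis using FC by blast
qed

text \<open>A basis of the kernel is extended to one of \<open>V\<close>, and \<open>g\<close> kills
  the part from the kernel. Its image replaces the quotient by the kernel and stays inside the same
  type.\<close>

lemma exists_kernel_projection:
  obtains g where "linear g" "g ` V \<subseteq> V" "\<And>v. v \<in> V \<Longrightarrow> P (v - g v) = 0"
    "\<And>v. v \<in> V \<Longrightarrow> P (g v) = 0 \<Longrightarrow> g v = 0"
proof -
  define Z where "Z = {v \<in> V. P v = 0}"
  have Z: "subspace Z"
    unfolding subspace_def
  proof (intro conjI ballI allI)
    show "0 \<in> Z" using subspace_0[OF subspace] zero by (simp add: Z_def)
    show "x + y \<in> Z" if "x \<in> Z" "y \<in> Z" for x y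
    proof -
      have xy: "x \<in> V" "y \<in> V" "P x = 0" "P y = 0" using that by (auto simp: Z_def)
      have "x + y \<in> V" by (rule subspace_add[OF subspace xy(1,2)])
      then show ?thesis using triangle[OF xy(1,2)] nonneg[of "x + y"] xy by (simp add: Z_def)
    qed
    show "c *\<^sub>R x \<in> Z" if "x \<in> Z" for c x
      using that scale[of x c] subspace_scale[OF subspace, of x c] by (simp add: Z_def)
  qed
  obtain BZ where BZ: "BZ \<subseteq> Z" "independent BZ" "Z \<subseteq> span BZ" using maximal_independent_subset by blast
  have "BZ \<subseteq> V" using BZ(1) by (auto simp: Z_def)
  then obtain B where B: "BZ \<subseteq> B" "B \<subseteq> V" "independent B" "V \<subseteq> span B"
    using maximal_independent_subset_extend[OF _ BZ(2)] by blast
  obtain g where g: "linear g" "\<And>b. b \<in> B \<Longrightarrow> g b = (if b \<in> BZ then 0 else b)"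
    using linear_independent_extend[OF B(3), of "\<lambda>b. if b \<in> BZ then 0 else b"] by blast
  have gZ: "g z = 0" if "z \<in> Z" for z
  proof (rule linear_eq_0_on_span[OF g(1)])
    show "z \<in> span BZ" using BZ(3) that by blast
    show "g b = 0" if "b \<in> BZ" for b using g(2) B(1) that by auto
  qed
  have "linear (\<lambda>v. v - g v)" using g(1) by (intro linear_compose_sub linear_ident)
  then have sub: "subspace ((\<lambda>v. v - g v) -` Z)" using linear_subspace_vimage[of "\<lambda>v. v - g v"] Z by blast
  have "b - g b \<in> Z" if "b \<in> B" for b
    using that BZ(1) g(2) subspace_0[OF Z] by auto
  then have "span B \<subseteq> (\<lambda>v. v - g v) -` Z" by (intro span_minimal sub) auto
  then have diff: "v - g v \<in> Z" if "v \<in> V" for v using that B(4) by auto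
  show ?thesis
  proof
    show "linear g" by (rule g(1))
    show "g ` V \<subseteq> V"
    proof
      fix u assume "u \<in> g ` V"
      then obtain v where v: "v \<in> V" "u = g v" by auto
      have "v - (v - g v) \<in> V" using v(1) diff[OF v(1)] by (subst subspace_diff[OF subspace]) (auto simp: Z_def)
      then show "u \<in> V" unfolding v(2) by (simp only: diff_diff_eq2 add_diff_cancel_left')
    qed
    show "P (v - g v) = 0" if "v \<in> V" for v using diff[OF that] by (simp add: Z_def)
    show "g v = 0" if v: "v \<in> V" "P (g v) = 0" for v
    proof -
      have "g (v - g v) = 0" by (rule gZ[OF diff[OF v(1)]])
      then have "g v = g (g v)" using linear_diff[OF g(1), of v "g v"] by simp
      moreover have "g v \<in> V" using \<open>g ` V \<subseteq> V\<close> v(1) by blast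
      then have "g (g v) = 0" using v(2) by (intro gZ) (simp add: Z_def)
      ultimately show ?thesis by simp
    qed
  qed
qed

text \<open>The space is a complement of the null sequences among the Cauchy sequences. For
  functions \<open>'a \<Rightarrow> real\<close> it has the type that the universal property of the
  free space admits as a target.\<close>

theorem exists_completion:
  assumes p1: "p \<le> 1"
  obtains W :: "(nat \<Rightarrow> 'v) set" and N' and J where "s_banach_on p W N'" "J ` V \<subseteq> W" "linear J"
    "\<And>v. v \<in> V \<Longrightarrow> N' (J v) powr p = P v"
proof -
  interpret L: p_seminorm p cauchy_seqs lim_norm by (rule p_seminorm_lim_norm)
  obtain g where g: "linear g" "g ` cauchy_seqs \<subseteq> cauchy_seqs"
    "\<And>s. s \<in> cauchy_seqs \<Longrightarrow> lim_norm (s - g s) = 0"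
    "\<And>s. s \<in> cauchy_seqs \<Longrightarrow> lim_norm (g s) = 0 \<Longrightarrow> g s = 0"
    using L.exists_kernel_projection by blast
  define W where "W = g ` cauchy_seqs"
  define N' where "N' s = lim_norm s powr (1 / p)" for s
  define J where "J v = g (\<lambda>_. v)" for v
  have WC: "s \<in> cauchy_seqs" if "s \<in> W" for s using that g(2) by (auto simp: W_def)
  have W: "subspace W" unfolding W_def using g(1) L.subspace by (rule linear_subspace_image)
  \<comment> \<open>Projection does not change distances, so a limit found among all Cauchy
    sequences can be moved into \<open>W\<close>.\<close>
  have lim_g: "lim_norm (s - g t) = lim_norm (s - t)" if "s \<in> cauchy_seqs" "t \<in> cauchy_seqs" for s t
  proof -
    have gt: "g t \<in> cauchy_seqs" using g(2) that(2) by blast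
    show ?thesis
      using L.diff_triangle[OF that(1) gt that(2)] L.diff_triangle[OF that gt] g(3)[OF that(2)]
        L.diff_commute[OF that(2) gt] by simp
  qed
  have pw: "N' s powr p = lim_norm s" if "s \<in> cauchy_seqs" for s
    using L.nonneg[OF that] p_pos by (simp add: N'_def powr_powr)
  have mono: "N' s < e" if "lim_norm s < e powr p" "0 < e" "s \<in> cauchy_seqs" for s e
  proof -
    have "N' s < (e powr p) powr (1 / p)"
      unfolding N'_def using that L.nonneg[OF that(3)] p_pos by (intro powr_less_mono2) auto
    then show ?thesis using that(2) p_pos by (simp add: powr_powr)
  qed
  have "s_banach_on p W N'"
    unfolding s_banach_on_def
  proof (intro conjI ballI)
    show tri: "N' (x + y) powr p \<le> N' x powr p + N' y powr p" if "x \<in> W" "y \<in> W" for x y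
      using L.triangle[OF WC[OF that(1)] WC[OF that(2)]] subspace_add[OF W that] pw WC that by simp
    show "quasi_norm_on W N'"
      unfolding quasi_norm_on_def
    proof (intro conjI ballI allI W)
      fix x assume x: "x \<in> W"
      show "0 \<le> N' x" by (simp add: N'_def)
      show "N' x = 0 \<longleftrightarrow> x = 0"
      proof
        assume "N' x = 0"
        then have "lim_norm x = 0" by (simp add: N'_def)
        moreover obtain s where "s \<in> cauchy_seqs" "x = g s" using x by (auto simp: W_def)
        ultimately show "x = 0" using g(4) by blast
      next
        assume "x = 0"
        then show "N' x = 0" using L.zero by (simp add: N'_def)
      qed
      show "N' (a *\<^sub>R x) = \<bar>a\<bar> * N' x" for a
        using L.scale[OF WC[OF x]] L.nonneg[OF WC[OF x]] p_pos by (simp add: N'_def powr_mult powr_powr)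
    next
      show "\<exists>K\<ge>1. \<forall>x\<in>W. \<forall>y\<in>W. N' (x + y) \<le> K * (N' x + N' y)"
      \<comment> \<open>Each of \<open>N' x\<close> and \<open>N' y\<close> is at most their sum;
        the factor 2 obtained for the \<open>p\<close>-th powers becomes
        \<open>2 powr (1 / p)\<close>.\<close>
      proof (intro exI[of _ "2 powr (1 / p)"] conjI ballI)
        show "1 \<le> (2 :: real) powr (1 / p)" using p_pos by (intro ge_one_powr_ge_zero) auto
        fix x y assume xy: "x \<in> W" "y \<in> W"
        have n0: "0 \<le> N' x" "0 \<le> N' y" "0 \<le> N' (x + y)" by (auto simp: N'_def)
        have "N' (x + y) powr p \<le> (N' x + N' y) powr p + (N' x + N' y) powr p"
          using tri[OF xy] powr_mono2[of p "N' x" "N' x + N' y"] powr_mono2[of p "N' y" "N' x + N' y"] n0 p_pos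
          by simp
        then have "(N' (x + y) powr p) powr (1 / p) \<le> (2 * (N' x + N' y) powr p) powr (1 / p)"
          using p_pos by (intro powr_mono2) auto
        then show "N' (x + y) \<le> 2 powr (1 / p) * (N' x + N' y)"
          using n0 p_pos by (simp add: powr_mult powr_powr)
      qed
    qed
    show "complete_quasi_norm_on W N'"
      unfolding complete_quasi_norm_on_def
    proof (intro allI impI)
      fix \<tau> :: "nat \<Rightarrow> nat \<Rightarrow> 'v"
      assume "range \<tau> \<subseteq> W \<and> (\<forall>e>0. \<exists>k. \<forall>m\<ge>k. \<forall>n\<ge>k. N' (\<tau> m - \<tau> n) < e)"
      then have \<tau>: "\<And>j. \<tau> j \<in> W" and cauchy: "\<And>e. 0 < e \<Longrightarrow> \<exists>k. \<forall>m\<ge>k. \<forall>n\<ge>k. N' (\<tau> m - \<tau> n) < e"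
        by auto
      have \<tau>C: "\<tau> j \<in> cauchy_seqs" for j by (rule WC[OF \<tau>])
      have "\<exists>k. \<forall>m\<ge>k. \<forall>n\<ge>k. lim_norm (\<tau> m - \<tau> n) < e" if e: "0 < e" for e
      proof -
        have "0 < e powr (1 / p)" using e by simp
        from cauchy[OF this] obtain k where
          k: "\<And>m n. k \<le> m \<Longrightarrow> k \<le> n \<Longrightarrow> N' (\<tau> m - \<tau> n) < e powr (1 / p)" by blast
        have "lim_norm (\<tau> m - \<tau> n) < e" if "k \<le> m" "k \<le> n" for m n
        proof -
          have "N' (\<tau> m - \<tau> n) powr p < (e powr (1 / p)) powr p"
            using k[OF that] p_pos by (intro powr_less_mono2) (auto simp: N'_def)
          then show ?thesis
            using e p_pos pw[OF subspace_diff[OF L.subspace \<tau>C \<tau>C]] by (simp add: powr_powr)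
        qed
        then show ?thesis by blast
      qed
      then obtain F where F: "F \<in> cauchy_seqs" "(\<lambda>j. lim_norm (\<tau> j - F)) \<longlonglongrightarrow> 0"
        using cauchy_seqs_complete[of \<tau>] \<tau>C by blast
      have "(\<lambda>j. N' (\<tau> j - g F)) \<longlonglongrightarrow> 0"
      proof (rule LIMSEQ_I)
        fix e :: real assume e: "0 < e"
        have gF: "g F \<in> cauchy_seqs" using F(1) g(2) by blast
        have "0 < e powr p" using e by simp
        from LIMSEQ_D[OF F(2) this] obtain k where
          k: "\<And>j. k \<le> j \<Longrightarrow> norm (lim_norm (\<tau> j - F) - 0) < e powr p" by blast
        have "N' (\<tau> j - g F) < e" if "k \<le> j" for j
          using k[OF that] lim_g[OF \<tau>C F(1), of j] e
          by (intro mono subspace_diff[OF L.subspace \<tau>C gF]) auto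
        then have "norm (N' (\<tau> j - g F) - 0) < e" if "k \<le> j" for j
          using that by (simp add: N'_def)
        then show "\<exists>k. \<forall>j\<ge>k. norm (N' (\<tau> j - g F) - 0) < e" by blast
      qed
      moreover have "g F \<in> W" using F(1) by (simp add: W_def)
      ultimately show "\<exists>x\<in>W. (\<lambda>n. N' (\<tau> n - x)) \<longlonglongrightarrow> 0" by blast
    qed
  qed
  moreover have "J ` V \<subseteq> W" by (auto simp: J_def W_def const_cauchy)
  moreover have "linear J"
  proof (rule linearI)
    show "J (u + v) = J u + J v" for u v
      unfolding J_def linear_add[OF g(1), symmetric] by (rule arg_cong[where f = g]) auto
    show "J (a *\<^sub>R v) = a *\<^sub>R J v" for a v
      unfolding J_def linear_scale[OF g(1), symmetric] by (rule arg_cong[where f = g]) (auto simp: scaleR_fun_def)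
  qed
  moreover have "N' (J v) powr p = P v" if v: "v \<in> V" for v
  proof -
    have c: "(\<lambda>_. v) \<in> cauchy_seqs" by (rule const_cauchy[OF v])
    have "lim_norm (0 - g (\<lambda>_. v)) = lim_norm (0 - (\<lambda>_. v))"
      by (rule lim_g[OF subspace_0[OF L.subspace] c])
    then have "lim_norm (J v) = lim_norm (\<lambda>_. v)"
      using L.diff_commute[OF subspace_0[OF L.subspace] c] L.diff_commute[OF subspace_0[OF L.subspace], of "g (\<lambda>_. v)"] c g(2)
      by (auto simp: J_def simp del: pointwise)
    moreover have "J v \<in> cauchy_seqs" using c g(2) by (auto simp: J_def)
    ultimately show ?thesis using pw by (simp add: lim_norm_const)
  qed
  ultimately show ?thesis using that by blast
qed

end

section \<open>The norm of the Lipschitz-free space\<close>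

lemma p_seminorm_of_s_banach:
  assumes "s_banach_on p V N" "0 < p"
  shows "p_seminorm p V (\<lambda>v. N v powr p)"
proof
  have q: "quasi_norm_on V N" using assms(1) by (simp add: s_banach_on_def)
  show "subspace V" using q by (simp add: quasi_norm_on_def)
  show "N (x + y) powr p \<le> N x powr p + N y powr p" if "x \<in> V" "y \<in> V" for x y
    using assms(1) that by (simp add: s_banach_on_def)
  show "N (a *\<^sub>R x) powr p = \<bar>a\<bar> powr p * N x powr p" if "x \<in> V" for x a
    using q that by (simp add: quasi_norm_on_def powr_mult)
qed (use assms in auto)

lemma linear_lift: "linear J \<Longrightarrow> J (lift F f) = lift (\<lambda>x. J (F x)) f"
  by (simp add: lift_def linear_sum linear_scale)

text \<open>The free norm dominates every \<open>p\<close>-seminorm that is at most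
  \<open>d x y powr p\<close> on dipoles: sending \<open>x\<close> to the dipole of \<open>x\<close>
  and \<open>z\<close> in the completion of \<open>P\<close> is a pointed map with Lipschitz
  constant at most 1, and so is the norm of its linear extension. The map \<open>\<pi>\<close>
  allows functions that are not supported in \<open>M\<close>.\<close>

lemma le_lipschitz_free_norm:
  fixes M :: "'a set" and \<delta> :: "'a \<Rightarrow> 'b::real_vector"
  assumes p: "0 < p" "p \<le> 1" and d0: "\<And>x y. x \<in> M \<Longrightarrow> y \<in> M \<Longrightarrow> 0 \<le> d x y" and z: "z \<in> M"
    and free: "lipschitz_free p M d z V N \<delta>"
    and P: "p_seminorm p balanced P"
    and Pd: "\<And>x y. x \<in> M \<Longrightarrow> y \<in> M \<Longrightarrow> P (dipole x y) \<le> d x y powr p"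
    and f: "f \<in> balanced" and \<pi>: "\<And>x. \<pi> x \<in> M"
  shows "P (push \<pi> f) \<le> N (lift (\<lambda>x. \<delta> (\<pi> x)) f) powr p"
proof -
  interpret P: p_seminorm p balanced P by (rule P)
  have ban: "s_banach_on p V N" and \<delta>: "\<delta> ` M \<subseteq> V"
    and ext: "\<And>(W :: (nat \<Rightarrow> 'a \<Rightarrow> real) set) N'. s_banach_on p W N' \<Longrightarrow> extends_lipschitz_into M d z V N \<delta> W N'"
    using free by (auto simp: lipschitz_free_def)
  have q: "quasi_norm_on V N" using ban by (simp add: s_banach_on_def)
  then have V: "subspace V" by (simp add: quasi_norm_on_def)
  obtain W :: "(nat \<Rightarrow> 'a \<Rightarrow> real) set" and N' J where
    W: "s_banach_on p W N'" "J ` balanced \<subseteq> W" "linear J" "\<And>v. v \<in> balanced \<Longrightarrow> N' (J v) powr p = P v"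
    using P.exists_completion[OF p(2)] by blast
  have qW: "quasi_norm_on W N'" using W(1) by (simp add: s_banach_on_def)
  define F where "F x = J (dipole x z)" for x
  have FW: "F x \<in> W" for x using W(2) by (auto simp: F_def)
  have Fdiff: "F x - F y = J (dipole x y)" for x y
    unfolding F_def linear_diff[OF W(3), symmetric] by (simp add: dipole_def)
  have lip: "N' (F x - F y) \<le> 1 * d x y" if "x \<in> M" "y \<in> M" for x y
  proof -
    have "J (dipole x y) \<in> W" using W(2) by auto
    then have n0: "0 \<le> N' (J (dipole x y))" using qW by (simp add: quasi_norm_on_def)
    have "N' (J (dipole x y)) powr p \<le> d x y powr p" using W(4)[of "dipole x y"] Pd[OF that] by simp
    then have "N' (J (dipole x y)) \<le> d x y"
      using powr_less_mono2[OF p(1) d0[OF that], of "N' (J (dipole x y))"] by linarith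
    then show ?thesis by (simp add: Fdiff)
  qed
  have lipF: "lipschitz_into M d W N' F" unfolding lipschitz_into_def
    using FW lip by (intro conjI exI[of _ 1]) auto
  have F0: "F z = 0" using linear_0[OF W(3)] by (simp add: F_def dipole_def del: pointwise)
  have E: "extends_lipschitz_into M d z V N \<delta> W N'" by (rule ext[OF W(1)])
  then have "\<exists>!g. g \<in> extensional V \<and> bounded_linear_into V N W N' g \<and> (\<forall>x\<in>M. g (\<delta> x) = F x)"
    using lipF F0 unfolding extends_lipschitz_into_def by blast
  then obtain g where g: "bounded_linear_into V N W N' g" "\<And>x. x \<in> M \<Longrightarrow> g (\<delta> x) = F x" by blast
  have norm_g: "operator_norm V N N' g = lipschitz_const M d N' F"
    using E lipF F0 g unfolding extends_lipschitz_into_def by blast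
  have "lipschitz_const M d N' F \<le> 1"
    unfolding lipschitz_const_def using lip by (intro cInf_lower) (auto simp: bdd_below_def)
  then have op: "operator_norm V N N' g \<le> 1" using norm_g by simp
  obtain C where C: "\<And>v. v \<in> V \<Longrightarrow> N' (g v) \<le> C * N v" using g(1) unfolding bounded_linear_into_def by blast
  have gadd: "g (u + v) = g u + g v" if "u \<in> V" "v \<in> V" for u v
    using g(1) that by (simp add: bounded_linear_into_def)
  have gscale: "g (a *\<^sub>R v) = a *\<^sub>R g v" if "v \<in> V" for v a
    using g(1) that by (simp add: bounded_linear_into_def)
  have gW: "g v \<in> W" if "v \<in> V" for v using g(1) that by (auto simp: bounded_linear_into_def)
  have N0: "0 \<le> N v" "N v = 0 \<Longrightarrow> v = 0" "N (a *\<^sub>R v) = \<bar>a\<bar> * N v" if "v \<in> V" for v a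
    using q that by (auto simp: quasi_norm_on_def)
  \<comment> \<open>The operator norm is a supremum over the unit ball, so \<open>v\<close> is
    normalised. Boundedness of \<open>g\<close> makes the supremum meaningful and settles
    \<open>N v = 0\<close>.\<close>
  have le: "N' (g v) \<le> N v" if v: "v \<in> V" for v
  proof (cases "N v = 0")
    case True
    then show ?thesis using C[OF v] by simp
  next
    case False
    then have pos: "0 < N v" using N0(1)[OF v] by simp
    define u where "u = (1 / N v) *\<^sub>R v"
    have u: "u \<in> V" "N u \<le> 1" using v pos N0(3)[OF v] by (auto simp: u_def subspace_scale[OF V])
    have "bdd_above {N' (g x) | x. x \<in> V \<and> N x \<le> 1}"
    proof (rule bdd_aboveI)
      fix t assume "t \<in> {N' (g x) | x. x \<in> V \<and> N x \<le> 1}"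
      then obtain x where x: "x \<in> V" "N x \<le> 1" "t = N' (g x)" by auto
      have "C * N x \<le> \<bar>C\<bar> * 1" using x N0(1)[OF x(1)] by (intro mult_mono) auto
      then show "t \<le> \<bar>C\<bar>" using C[OF x(1)] x(3) by simp
    qed
    then have "N' (g u) \<le> operator_norm V N N' g"
      unfolding operator_norm_def using u by (intro cSup_upper) auto
    then have "N' (g u) \<le> 1" using op by simp
    moreover have "N' (g u) = (1 / N v) * N' (g v)"
      using qW gW[OF v] pos gscale[OF v] by (simp add: u_def quasi_norm_on_def)
    ultimately show ?thesis using pos by (simp add: field_simps)
  qed
  have gsum: "g (\<Sum>x\<in>S. c x *\<^sub>R \<delta> (\<pi> x)) = (\<Sum>x\<in>S. c x *\<^sub>R F (\<pi> x))" if "finite S" for S :: "'a set" and c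
    using that
  proof (induction S rule: finite_induct)
    case empty
    show ?case using gscale[OF subspace_0[OF V], of 0] by simp
  next
    case (insert x S)
    have dV: "\<delta> (\<pi> x) \<in> V" for x using \<delta> \<pi> by blast
    then have "c x *\<^sub>R \<delta> (\<pi> x) \<in> V" "(\<Sum>x\<in>S. c x *\<^sub>R \<delta> (\<pi> x)) \<in> V"
      by (auto intro!: subspace_scale[OF V] subspace_sum[OF V])
    then show ?case using insert gadd gscale[OF dV] g(2)[OF \<pi>] by simp
  qed
  let ?v = "lift (\<lambda>x. \<delta> (\<pi> x)) f"
  have vV: "?v \<in> V" unfolding lift_def using \<delta> \<pi> by (intro subspace_sum[OF V] subspace_scale[OF V]) auto
  have "lift (\<lambda>x. dipole (\<pi> x) z) f = push \<pi> f"
    unfolding dipole_def lift_diff_fun lift_const[OF f] push_def by simp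
  then have "g ?v = J (push \<pi> f)"
    using gsum[OF finite_support[OF f], of f] linear_lift[OF W(3), of "\<lambda>x. dipole (\<pi> x) z" f]
    by (simp add: lift_def F_def)
  then have "P (push \<pi> f) = N' (g ?v) powr p" using W(4)[OF push_balanced[OF f]] by simp
  also have "\<dots> \<le> N ?v powr p"
    using le[OF vV] qW gW[OF vV] p by (intro powr_mono2) (auto simp: quasi_norm_on_def)
  finally show ?thesis .
qed

context snowflake
begin

text \<open>
  Either no scale separates a subsequence, and humps glide over the scales, or one scale does.
\<close>
theorem snow_norm_lp_lower_bound:
  assumes x: "\<And>n. x n \<in> balanced" and B: "\<And>n. snow_norm (x n) \<le> B" and r: "0 < r"
    and sep: "\<And>i j. i \<noteq> j \<Longrightarrow> r \<le> snow_norm (x i - x j)"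
  shows "\<exists>c>0. \<exists>\<sigma> :: nat \<Rightarrow> nat. strict_mono \<sigma> \<and>
    (\<forall>J a. c * (\<Sum>j<J. \<bar>a j\<bar> powr p) \<le> snow_norm (\<Sum>j<J. a j *\<^sub>R x (\<sigma> j)))"
proof (cases "\<exists>k e S. infinite S \<and> 0 < e \<and> (\<forall>i\<in>S. \<forall>j\<in>S. i \<noteq> j \<longrightarrow> e \<le> scale_norm k (x i - x j))")
  case True
  then obtain k e S where S: "infinite S" "0 < e"
    "\<And>i j. i \<in> S \<Longrightarrow> j \<in> S \<Longrightarrow> i \<noteq> j \<Longrightarrow> e \<le> scale_norm k (x i - x j)" by blast
  define \<tau> where "\<tau> = enumerate S"
  have \<tau>: "strict_mono \<tau>" "\<And>n. \<tau> n \<in> S"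
    using strict_mono_enumerate[OF S(1)] enumerate_in_set[OF S(1)] by (auto simp: \<tau>_def)
  have "\<exists>c>0. \<exists>\<sigma> :: nat \<Rightarrow> nat. strict_mono \<sigma> \<and>
    (\<forall>J a. c * (\<Sum>j<J. \<bar>a j\<bar> powr p) \<le> snow_norm (\<Sum>j<J. a j *\<^sub>R x (\<tau> (\<sigma> j))))"
    by (rule lp_lower_bound_of_scale_separated[of "\<lambda>n. x (\<tau> n)" B e k])
      (use x B S \<tau> strict_mono_eq[OF \<tau>(1)] in auto)
  then obtain c \<sigma> where c: "0 < c" "strict_mono (\<sigma> :: nat \<Rightarrow> nat)"
    "\<And>J a. c * (\<Sum>j<J. \<bar>a j\<bar> powr p) \<le> snow_norm (\<Sum>j<J. a j *\<^sub>R x (\<tau> (\<sigma> j)))" by blast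
  then show ?thesis
    using strict_mono_o[OF \<tau>(1) c(2)] by (intro exI[of _ c] conjI exI[of _ "\<tau> \<circ> \<sigma>"]) auto
next
  case False
  have xd: "x i - x j \<in> balanced" for i j by (rule balanced_diff[OF x x])
  \<comment> \<open>The sum over the scales controls the snowflake norm up to the factor 28 and is
    controlled by it up to \<open>window_const\<close>; this transfers separation and
    boundedness.\<close>
  interpret G: gliding_hump p balanced "\<lambda>n. scale_norm (int_decode n)" x "window_const * B" "r / 28"
  proof (rule gliding_hump.intro)
    show "p_seminorm p balanced (scale_norm (int_decode k))" for k by (rule p_seminorm_scale)
    show "summable (\<lambda>n. scale_norm (int_decode n) f)" if "f \<in> balanced" for f
      by (rule summable_scale_norm[OF that])
    show "(\<Sum>n. scale_norm (int_decode n) (x m)) \<le> window_const * B" for m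
      using summable_scale_norm(2)[OF x, of m] mult_left_mono[OF B[of m], of window_const] window_const_pos
      by linarith
    show "r / 28 \<le> (\<Sum>n. scale_norm (int_decode n) (x i - x j))" if "i \<noteq> j" for i j
      using sep[OF that] snow_norm_le_suminf[OF xd, of i j] by simp
    show "\<exists>i\<in>S. \<exists>j\<in>S. i \<noteq> j \<and> scale_norm (int_decode k) (x i - x j) < e" if "infinite S" "0 < e" for S e k
      using False that by (meson not_le)
  qed (use x r in auto)
  obtain \<sigma> :: "nat \<Rightarrow> nat" where \<sigma>: "strict_mono \<sigma>" "\<And>J a. r / 28 / 16 * (\<Sum>j<J. \<bar>a j\<bar> powr p)
    \<le> (\<Sum>n. scale_norm (int_decode n) (\<Sum>j<J. a j *\<^sub>R x (\<sigma> j)))"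
    using G.lp_lower_bound by blast
  have "r / 28 / 16 / window_const * (\<Sum>j<J. \<bar>a j\<bar> powr p) \<le> snow_norm (\<Sum>j<J. a j *\<^sub>R x (\<sigma> j))" for J a
  proof -
    have "(\<Sum>j<J. a j *\<^sub>R x (\<sigma> j)) \<in> balanced"
      by (intro balanced_sum balanced_scale x)
    from order_trans[OF \<sigma>(2) summable_scale_norm(2)[OF this]] show ?thesis
      using window_const_pos by (simp add: field_simps)
  qed
  then show ?thesis
    using \<sigma>(1) r window_const_pos by (intro exI[of _ "r / 28 / 16 / window_const"] conjI exI[of _ \<sigma>]) auto
qed

end

section \<open>Transfer to the Lipschitz-free space\<close>

theorem theorem1:
  fixes p q :: real
    and M :: "'a set" and d :: "'a \<Rightarrow> 'a \<Rightarrow> real" and z :: 'a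
    and V :: "'b::real_vector set" and N :: "'b \<Rightarrow> real" and \<delta> :: "'a \<Rightarrow> 'b"
  assumes "0 < p" and "p < q" and "q \<le> 1"
    and "s_metric_on q M d" and "z \<in> M"
    and "lipschitz_free p M d z V N \<delta>"
  shows "schur_property p V N"
proof -
  have p: "0 < p" "p \<le> 1" and q: "0 < q" using assms by auto
  have d0: "0 \<le> d x y" if "x \<in> M" "y \<in> M" for x y using assms(4) that by (simp add: s_metric_on_def)
  have metric: "Metric_space M (\<lambda>x y. d x y powr q)" using assms(4) by (simp add: s_metric_on_def)
  have ban: "s_banach_on p V N" and \<delta>: "\<delta> ` M \<subseteq> V" "\<delta> z = 0"
    and iso: "\<And>x y. x \<in> M \<Longrightarrow> y \<in> M \<Longrightarrow> N (\<delta> x - \<delta> y) = d x y"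
    and dense: "\<And>v e. v \<in> V \<Longrightarrow> 0 < e \<Longrightarrow> \<exists>y\<in>span (\<delta> ` M). N (v - y) < e"
    using assms(6) by (auto simp: lipschitz_free_def)
  \<comment> \<open>Points outside \<open>M\<close> are identified with the base point, which
    extends the metric to a pseudometric on the whole type.\<close>
  define \<pi> where "\<pi> x = (if x \<in> M then x else z)" for x
  have \<pi>: "\<pi> x \<in> M" for x using assms(5) by (simp add: \<pi>_def)
  define \<rho> where "\<rho> x y = d (\<pi> x) (\<pi> y) powr q" for x y
  interpret Q: p_seminorm p V "\<lambda>v. N v powr p" by (rule p_seminorm_of_s_banach[OF ban p(1)])
  interpret snowflake \<rho> p "p / q"
  proof
    show "\<rho> x x = 0" for x using Metric_space.mdist_zero[OF metric \<pi>] by (simp add: \<rho>_def)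
    show "\<rho> x y = \<rho> y x" for x y using Metric_space.commute[OF metric] by (simp add: \<rho>_def)
    show "\<rho> x u \<le> \<rho> x y + \<rho> y u" for x y u
      using Metric_space.triangle[OF metric \<pi> \<pi> \<pi>] by (simp add: \<rho>_def)
  qed (use p q assms in auto)
  have snow: "\<rho> x y powr (p / q) = d (\<pi> x) (\<pi> y) powr p" for x y
    using q by (simp add: \<rho>_def powr_powr)
  define L where "L = lift (\<lambda>x. \<delta> (\<pi> x))"
  have \<delta>V: "\<delta> (\<pi> x) \<in> V" for x using \<delta>(1) \<pi> by blast
  have LV: "L f \<in> V" for f
    unfolding L_def lift_def by (intro subspace_sum[OF Q.subspace] subspace_scale[OF Q.subspace] \<delta>V)
  have L_add: "L (f + g) = L f + L g" if "f \<in> balanced" "g \<in> balanced" for f g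
    using that by (simp add: L_def lift_add finite_support)
  have L_scale: "L (a *\<^sub>R f) = a *\<^sub>R L f" for a f by (simp add: L_def lift_scale)
  have L_diff: "L (f - g) = L f - L g" if "f \<in> balanced" "g \<in> balanced" for f g
    using L_add[OF balanced_diff[OF that] that(2)] by (simp add: algebra_simps del: pointwise)
  have L_sum: "L (\<Sum>i\<in>I. a i *\<^sub>R f i) = (\<Sum>i\<in>I. a i *\<^sub>R L (f i))" if "finite I" "\<And>i. f i \<in> balanced"
    for I :: "nat set" and a f
    using that(1)
  proof (induction I rule: finite_induct)
    case empty
    show ?case by (simp add: L_def lift_zero del: pointwise)
  next
    case (insert i I)
    have "a i *\<^sub>R f i \<in> balanced" "(\<Sum>i\<in>I. a i *\<^sub>R f i) \<in> balanced"
      by (intro balanced_sum balanced_scale that(2))+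
    then show ?case using insert by (simp add: L_add L_scale del: pointwise)
  qed
  \<comment> \<open>Together with \<open>lower\<close>, this identifies the \<open>p\<close>-th
    power of the free norm with the snowflake transport seminorm on the dense span.\<close>
  have upper: "N (L f) powr p \<le> snow_norm f" if "f \<in> balanced" for f
  proof (rule transport_greatest[OF that])
    fix l assume l: "combination l = f"
    have "N (L (combination l)) powr p \<le> cost p (\<lambda>x y. \<rho> x y powr (p / q)) l" for l
    proof (induction l)
      case Nil
      show ?case using Q.zero by (simp add: L_def lift_zero del: pointwise)
    next
      case (Cons e l)
      obtain a x y where e: "e = (a, x, y)" by (cases e)
      have dV: "\<delta> (\<pi> x) - \<delta> (\<pi> y) \<in> V" by (intro subspace_diff[OF Q.subspace] \<delta>V)
      have "L (combination (e # l)) = a *\<^sub>R (\<delta> (\<pi> x) - \<delta> (\<pi> y)) + L (combination l)"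
        unfolding e combination_simps
        using L_add[OF balanced_scale[OF dipole_balanced] combination_balanced, of a x y l]
          L_scale[of a "dipole x y"] by (simp add: L_def lift_dipole del: pointwise)
      then have "N (L (combination (e # l))) powr p
          \<le> \<bar>a\<bar> powr p * N (\<delta> (\<pi> x) - \<delta> (\<pi> y)) powr p + N (L (combination l)) powr p"
        using Q.triangle[OF subspace_scale[OF Q.subspace dV] LV] Q.scale[OF dV] by metis
      then show ?case using Cons by (simp add: e snow iso[OF \<pi> \<pi>] del: pointwise)
    qed
    then show "N (L f) powr p \<le> cost p (\<lambda>x y. \<rho> x y powr (p / q)) l" using l by blast
  qed
  have lower: "snow_norm f \<le> N (L f) powr p" if f: "f \<in> balanced" for f
  proof -
    interpret S: p_seminorm p balanced snow_norm by (rule p_seminorm_snow)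
    have "snow_norm (push \<pi> f) \<le> N (L f) powr p"
      unfolding L_def
    proof (rule le_lipschitz_free_norm[OF p d0 assms(5,6) p_seminorm_snow _ f \<pi>])
      show "snow_norm (dipole x y) \<le> d x y powr p" if "x \<in> M" "y \<in> M" for x y
        using transport_dipole_le[where c = "\<lambda>x y. \<rho> x y powr (p / q)" and p = p and x = x and y = y] that
        by (simp add: snow \<pi>_def)
    qed auto
    moreover have "snow_norm (f - push \<pi> f) \<le> 0"
    proof -
      have "snow_norm (f - push \<pi> f) \<le> (\<Sum>x | f x \<noteq> 0. \<bar>f x\<bar> powr p * \<rho> x (\<pi> x) powr (p / q))"
        by (rule transport_diff_push_le[OF f p(1)]) simp
      also have "\<dots> = 0"
      proof (intro sum.neutral ballI)
        fix x
        have "\<pi> (\<pi> x) = \<pi> x" using assms(5) by (simp add: \<pi>_def)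
        then have "\<rho> x (\<pi> x) = \<rho> x x" by (simp only: \<rho>_def)
        then show "\<bar>f x\<bar> powr p * \<rho> x (\<pi> x) powr (p / q) = 0" by simp
      qed
      finally show ?thesis .
    qed
    moreover have "snow_norm f \<le> snow_norm (f - push \<pi> f) + snow_norm (push \<pi> f)"
      using S.triangle[OF balanced_diff[OF f push_balanced[OF f, of \<pi>]] push_balanced[OF f, of \<pi>]]
      by simp
    ultimately show ?thesis by simp
  qed
  have span_L: "\<exists>f\<in>balanced. L f = y" if "y \<in> span (\<delta> ` M)" for y
  proof -
    have "subspace (L ` balanced)"
      unfolding subspace_def
    proof (intro conjI ballI allI)
      show "0 \<in> L ` balanced"
        using balanced_0 by (intro image_eqI[of _ _ 0]) (simp_all add: L_def lift_zero del: pointwise)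
      show "u + v \<in> L ` balanced" if "u \<in> L ` balanced" "v \<in> L ` balanced" for u v
        using that L_add balanced_add by (metis (no_types, lifting) image_iff)
      show "a *\<^sub>R u \<in> L ` balanced" if "u \<in> L ` balanced" for a u
        using that L_scale balanced_scale by (metis (no_types, lifting) image_iff)
    qed
    moreover have "\<delta> ` M \<subseteq> L ` balanced"
    proof
      fix v assume "v \<in> \<delta> ` M"
      then obtain x where x: "x \<in> M" "v = \<delta> x" by auto
      have "L (dipole x z) = v" using x \<delta>(2) assms(5) by (simp add: L_def lift_dipole \<pi>_def)
      then show "v \<in> L ` balanced" by (metis dipole_balanced image_eqI)
    qed
    ultimately have "span (\<delta> ` M) \<subseteq> L ` balanced" by (intro span_minimal)
    then show ?thesis using that by auto
  qed
  show ?thesis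
    unfolding schur_property_def
  proof (intro allI impI)
    fix A assume A: "A \<subseteq> V" "infinite A \<and> (\<exists>B. \<forall>x\<in>A. N x \<le> B) \<and> uniformly_separated N A"
    obtain B0 where B0: "\<And>x. x \<in> A \<Longrightarrow> N x \<le> B0" using A(2) by blast
    \<comment> \<open>The maximum with 1 supplies the positive upper constant required at the
      end.\<close>
    define B where "B = max B0 1"
    have B: "N x powr p \<le> B powr p" if "x \<in> A" for x
      using B0[OF that] A(1) that ban p
      by (intro powr_mono2) (auto simp: B_def s_banach_on_def quasi_norm_on_def)
    obtain r0 where r0: "0 < r0" "\<And>x y. x \<in> A \<Longrightarrow> y \<in> A \<Longrightarrow> x \<noteq> y \<Longrightarrow> r0 \<le> N (x - y)"
      using A(2) by (auto simp: uniformly_separated_def)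
    define r where "r = r0 powr p"
    have r: "0 < r" using r0 by (simp add: r_def)
    obtain v :: "nat \<Rightarrow> 'b" where v: "inj v" "range v \<subseteq> A"
      using A(2) infinite_countable_subset by blast
    have vA: "v n \<in> A" "v n \<in> V" for n using v(2) A(1) by auto
    \<comment> \<open>The bound \<open>r / 4\<close> preserves half of the separation. The errors
      also have to tend to 0, because the constant \<open>c\<close> against which they are compared
      is known only after the approximations have been chosen.\<close>
    define \<eta> where "\<eta> n = r / 4 / (real n + 1)" for n
    have \<eta>: "0 < \<eta> n" "\<eta> n \<le> r / 4" for n using r by (auto simp: \<eta>_def field_simps)
    have "\<exists>f\<in>balanced. N (v n - L f) powr p \<le> \<eta> n" for n
    proof -
      have "0 < \<eta> n powr (1 / p)" using \<eta>(1)[of n] by simp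
      from dense[OF vA(2) this] obtain y where y: "y \<in> span (\<delta> ` M)" "N (v n - y) < \<eta> n powr (1 / p)" by blast
      obtain f where f: "f \<in> balanced" "L f = y" using span_L[OF y(1)] by blast
      have "v n - L f \<in> V" by (intro subspace_diff[OF Q.subspace] vA LV)
      then have "0 \<le> N (v n - L f)" using ban by (simp add: s_banach_on_def quasi_norm_on_def)
      then have "N (v n - L f) powr p \<le> (\<eta> n powr (1 / p)) powr p"
        using y(2) f(2) p by (intro powr_mono2) auto
      then show ?thesis using f(1) \<eta>(1)[of n] p by (auto simp: powr_powr intro!: bexI[of _ f])
    qed
    then obtain f where f: "\<And>n. f n \<in> balanced" "\<And>n. N (v n - L (f n)) powr p \<le> \<eta> n" by metis
    have fb: "snow_norm (f n) \<le> B powr p + r / 4" for n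
      using lower[OF f(1)[of n]] Q.diff_ge'[OF LV vA(2), of "f n" n] Q.diff_commute[OF LV vA(2), of "f n" n]
        f(2)[of n] \<eta>(2)[of n] B[OF vA(1)[of n]] by linarith
    have fs: "r / 2 \<le> snow_norm (f i - f j)" if "i \<noteq> j" for i j
    proof -
      have "v i \<noteq> v j" using that v(1) by (simp add: inj_eq)
      then have "r \<le> N (v i - v j) powr p"
        unfolding r_def using r0(1) r0(2)[OF vA(1) vA(1)] p by (intro powr_mono2) auto
      also have "\<dots> \<le> N (v i - L (f i)) powr p + N (L (f i) - v j) powr p"
        by (rule Q.diff_triangle[OF vA(2) LV vA(2)])
      also have "N (L (f i) - v j) powr p \<le> N (L (f i) - L (f j)) powr p + N (L (f j) - v j) powr p"
        by (rule Q.diff_triangle[OF LV LV vA(2)])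
      also have "N (L (f j) - v j) powr p = N (v j - L (f j)) powr p" by (rule Q.diff_commute[OF LV vA(2)])
      also have "N (L (f i) - L (f j)) powr p \<le> snow_norm (f i - f j)"
        using upper[OF balanced_diff[OF f(1) f(1)], of i j] L_diff[OF f(1) f(1), of i j] by simp
      finally show ?thesis using f(2)[of i] f(2)[of j] \<eta>(2)[of i] \<eta>(2)[of j] by simp
    qed
    have "0 < r / 2" using r by simp
    from snow_norm_lp_lower_bound[where x = f, OF f(1) fb this fs] obtain c \<sigma> where c: "0 < c" and \<sigma>: "strict_mono (\<sigma> :: nat \<Rightarrow> nat)"
      and low: "\<And>J a. c * (\<Sum>j<J. \<bar>a j\<bar> powr p) \<le> snow_norm (\<Sum>j<J. a j *\<^sub>R f (\<sigma> j))"
      by blast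
    \<comment> \<open>Dropping the first \<open>m\<close> terms brings all remaining errors below
      \<open>c / 2\<close>, half of the lower constant.\<close>
    obtain m :: nat where m: "r / 4 / (c / 2) < real m" using reals_Archimedean2 by blast
    have \<eta>c: "\<eta> (\<sigma> (j + m)) \<le> c / 2" for j
    proof -
      have "real m \<le> real (\<sigma> (j + m)) + 1" using seq_suble[OF \<sigma>, of "j + m"] by linarith
      then have "r / 4 / (c / 2) \<le> real (\<sigma> (j + m)) + 1" using m by linarith
      then show ?thesis using c by (simp add: \<eta>_def field_simps)
    qed
    define x where "x j = v (\<sigma> (j + m))" for j
    have xV: "x j \<in> V" "x j \<in> A" for j using vA by (auto simp: x_def)
    have low': "c / 2 * (\<Sum>j<J. \<bar>a j\<bar> powr p) \<le> N (\<Sum>j<J. a j *\<^sub>R x j) powr p" for J a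
    proof -
      let ?s = "\<Sum>j<J. \<bar>a j\<bar> powr p" and ?y = "\<lambda>j. L (f (\<sigma> (j + m)))"
      \<comment> \<open>Padding with \<open>m\<close> zeros makes \<open>low\<close> applicable to
        the shifted sequence.\<close>
      define b where "b j = (if j < m then 0 else a (j - m))" for j
      have shift: "(\<Sum>j<J + m. g j) = (\<Sum>j<J. g (j + m))" if "\<And>j. j < m \<Longrightarrow> g j = 0"
        for g :: "nat \<Rightarrow> 'c::comm_monoid_add"
      proof -
        have "(\<Sum>j<J + m. g j) = (\<Sum>j\<in>{m..<J + m}. g j)"
          using that by (intro sum.mono_neutral_right) auto
        also have "\<dots> = (\<Sum>j\<in>{0 + m..<J + m}. g j)" by simp
        also have "\<dots> = (\<Sum>j<J. g (j + m))" unfolding sum.shift_bounds_nat_ivl by (simp add: lessThan_atLeast0)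
        finally show ?thesis .
      qed
      have 1: "(\<Sum>j<J + m. \<bar>b j\<bar> powr p) = ?s" by (subst shift) (auto simp: b_def)
      have "(\<Sum>j<J + m. b j *\<^sub>R L (f (\<sigma> j))) = (\<Sum>j<J. a j *\<^sub>R ?y j)" by (subst shift) (auto simp: b_def)
      then have 2: "L (\<Sum>j<J + m. b j *\<^sub>R f (\<sigma> j)) = (\<Sum>j<J. a j *\<^sub>R ?y j)"
        using L_sum[of "{..<J + m}" "\<lambda>j. f (\<sigma> j)" b] f(1) by simp
      have bal: "(\<Sum>j<J + m. b j *\<^sub>R f (\<sigma> j)) \<in> balanced"
        by (intro balanced_sum balanced_scale f)
      have yV: "(\<Sum>j<J. a j *\<^sub>R ?y j) \<in> V" and sV: "(\<Sum>j<J. a j *\<^sub>R x j) \<in> V"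
        by (intro subspace_sum[OF Q.subspace] subspace_scale[OF Q.subspace] LV xV)+
      have "c * ?s \<le> N (\<Sum>j<J. a j *\<^sub>R ?y j) powr p" using low[of b "J + m"] lower[OF bal] 1 2 by simp
      moreover have "N ((\<Sum>j<J. a j *\<^sub>R x j) - (\<Sum>j<J. a j *\<^sub>R ?y j)) powr p \<le> ?s * (c / 2)"
      proof -
        have "(\<Sum>j<J. a j *\<^sub>R x j) - (\<Sum>j<J. a j *\<^sub>R ?y j) = (\<Sum>j<J. a j *\<^sub>R (x j - ?y j))"
          by (simp add: scaleR_diff_right sum_subtractf)
        then have "N ((\<Sum>j<J. a j *\<^sub>R x j) - (\<Sum>j<J. a j *\<^sub>R ?y j)) powr p
            \<le> (\<Sum>j<J. \<bar>a j\<bar> powr p * N (x j - ?y j) powr p)"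
          using Q.sum_le[of "{..<J}" "\<lambda>j. x j - ?y j" a] subspace_diff[OF Q.subspace xV(1) LV] by simp
        also have "\<dots> \<le> (\<Sum>j<J. \<bar>a j\<bar> powr p * (c / 2))"
          using order_trans[OF f(2) \<eta>c] by (intro sum_mono mult_left_mono) (auto simp: x_def)
        finally show ?thesis by (simp only: sum_distrib_right)
      qed
      moreover have "N (\<Sum>j<J. a j *\<^sub>R ?y j) powr p - N ((\<Sum>j<J. a j *\<^sub>R x j) - (\<Sum>j<J. a j *\<^sub>R ?y j)) powr p
          \<le> N (\<Sum>j<J. a j *\<^sub>R x j) powr p"
        using Q.diff_ge'[OF yV sV] Q.diff_commute[OF yV sV] by simp
      ultimately show ?thesis by (simp add: algebra_simps)
    qed
    have "equivalent_to_lp_basis p N x"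
      unfolding equivalent_to_lp_basis_def
    proof (intro exI conjI allI impI)
      show "0 < (c / 2) powr (1 / p)" using c by simp
      show "0 < B" by (simp add: B_def)
      fix a :: "nat \<Rightarrow> real" assume fin: "finite {n. a n \<noteq> 0}"
      \<comment> \<open>The inserted 0 covers the empty support.\<close>
      define J where "J = Suc (Max (insert 0 {n. a n \<noteq> 0}))"
      have "{n. a n \<noteq> 0} \<subseteq> {..<J}" using fin by (auto simp: J_def less_Suc_eq_le)
      then have 1: "(\<Sum>n | a n \<noteq> 0. \<bar>a n\<bar> powr p) = (\<Sum>n<J. \<bar>a n\<bar> powr p)"
        and 2: "(\<Sum>n | a n \<noteq> 0. a n *\<^sub>R x n) = (\<Sum>n<J. a n *\<^sub>R x n)"
        by (auto intro!: sum.mono_neutral_left)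
      show "((c / 2) powr (1 / p)) powr p * (\<Sum>n | a n \<noteq> 0. \<bar>a n\<bar> powr p)
          \<le> N (\<Sum>n | a n \<noteq> 0. a n *\<^sub>R x n) powr p"
        unfolding 1 2 using low'[of a J] c p by (simp add: powr_powr)
      have "N (\<Sum>n<J. a n *\<^sub>R x n) powr p \<le> (\<Sum>n<J. \<bar>a n\<bar> powr p * N (x n) powr p)"
        by (rule Q.sum_le) (rule xV)
      also have "\<dots> \<le> (\<Sum>n<J. \<bar>a n\<bar> powr p * B powr p)"
        by (intro sum_mono mult_left_mono B xV) auto
      finally show "N (\<Sum>n | a n \<noteq> 0. a n *\<^sub>R x n) powr p \<le> B powr p * (\<Sum>n | a n \<noteq> 0. \<bar>a n\<bar> powr p)"
        unfolding 1 2 by (simp add: sum_distrib_left mult.commute)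
    qed
    then show "\<exists>x. range x \<subseteq> A \<and> equivalent_to_lp_basis p N x" using xV(2) by blast
  qed
qed

end
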